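(* Let $d\ge 2$. For every $s>0$, the critical escape intensity $u_c(s)$ (defined in the context) satisfies $0<u_c(s)<\infty$.
   Context: $\mathsf{N}=\{0,1,2,\dots\}$, $\mathsf{Z}$ is the set of integers, and $|x|_1=\sum_i|x_i|$. Traps. For $u\ge 0$ let $\eta_0^j$, $j\ge1$, be the points of a Poisson point process of intensity $u$ on $\mathsf{Z}^d$ (i.e. the numbers of points at the different sites are i.i.d. Poisson($u$) variables; for $u=0$ there are no points). Each trap moves as $\eta_t^j=\eta_0^j+\zeta_t^j$, $t\in\mathsf{N}$, where $(\zeta^j_t)_{t\ge0}$, $j\ge1$, are independent discrete-time simple symmetric random walks on $\mathsf{Z}^d$ started at the origin, independent of the initial positions. The environment is the random element $\xi\in\{0,1\}^{\mathsf{Z}^d\times\mathsf{N}}$ with $\xi(x,t)=1$ if $\eta^j_t=x$ for some $j\ge1$ and $\xi(x,t)=0$ otherwise. Its law is denoted $P^u$, with expectation $E^u$. Escape trajectories. An escape trajectory is a sequence $\rho=(x_k,t_k)_{k\ge0}$ with $x_k\in\mathsf{Z}^d$, $t_k\in\mathsf{N}$ such that: (1) $|(x_{k+1},t_{k+1})-(x_k,t_k)|_1=1$ for every $k\ge0$ (norm in $\mathsf{Z}^{d+1}$); (2) $(x_0,t_0)=(0,0)$, $(t_k)_{k\ge0}$ is non-decreasing and $\lim_{k\to\infty}t_k=+\infty$. The speed of $\rho$ at time $t\in\mathsf{N}$ is $S_t=S_t(\rho)=\max\{i:t_i=t\}-\min\{i:t_i=t\}$. The detection time of $\rho$ in the environment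 $\xi$ is $T_{\rm det}=T_{\rm det}(\rho)=t_\kappa$, where $\kappa=\inf\{k\ge0:\xi(x_k,t_k)=1\}$ (with $T_{\rm det}=\infty$ if $\kappa=\infty$). Escape strategies. An escape strategy is a function associating to each realization of the environment $\xi$ an escape trajectory $\rho(\xi)=(x_k,t_k)_{k\ge0}$. Let $\mathcal{G}_t=\sigma(\xi(x,s):x\in\mathsf{Z}^d,\ s\le t)$. The strategy is adapted if for all $k\ge0$ the position $\rho_k(\xi)=(x_k,t_k)$ is determined by the environment up to time $t_k$ ("$\rho_k\in\mathcal{G}_{t_k}$"), that is, $\{\xi:\rho_k(\xi)=(x,t)\}\in\mathcal{G}_t$ for all $k\ge0$, $x\in\mathsf{Z}^d$, $t\in\mathsf{N}$. For an escape strategy, $S_t$ and $T_{\rm det}$ are regarded as random variables depending on $\xi$. Critical escape intensity. For $s\ge0$, $u_c(s)$ is the supremum of the set of all $u\ge0$ for which there exists an adapted escape strategy $\rho$ with $P^u(T_{\rm det}=\infty)>0$ and $E^u[S_t\mid T_{\rm det}=\infty]\le s$ for all $t\in\mathsf{N}$. *)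

theory Defs
  imports "HOL-Probability.Probability"
begin

section \<open>Space-time points and environments\<close>

type_synonym 'd site = "int ^ 'd"

type_synonym 'd point = "'d site \<times> nat"

text \<open>An environment \<open>\<xi> \<in> {0,1}\<close> to the power \<open>\<int>\<^sup>d \<times> \<nat>\<close>; the value \<open>1\<close> is rendered by \<open>True\<close>.\<close>

type_synonym 'd env = "'d point \<Rightarrow> bool"

definition l1_norm :: "int ^ 'd::finite \<Rightarrow> int" where
  "l1_norm x = (\<Sum>i\<in>UNIV. \<bar>x $ i\<bar>)"

definition l1_dist :: "'d::finite point \<Rightarrow> 'd point \<Rightarrow> int" where
  "l1_dist p q = l1_norm (fst p - fst q) + \<bar>int (snd p) - int (snd q)\<bar>"

definition env_space :: "'d::finite env measure" where
  "env_space = (\<Pi>\<^sub>M p\<in>UNIV. count_space UNIV)"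


section \<open>Traps\<close>

text \<open>\<^const>\<open>poisson_pmf\<close> is only specified for positive rates.\<close>

definition trap_count_pmf :: "real \<Rightarrow> nat pmf" where
  "trap_count_pmf u = (if u = 0 then return_pmf 0 else poisson_pmf u)"

definition srw_step_pmf :: "'d::finite site pmf" where
  "srw_step_pmf = pmf_of_set {e. l1_norm e = 1}"

text \<open>
  Traps are labelled by their starting site \<open>y\<close> and a number \<open>i\<close>; the label \<open>(y, i)\<close> is in use
  iff \<open>i\<close> is less than the number of traps starting at \<open>y\<close>. A sample \<open>(N, Z)\<close> consists of
  the numbers \<open>N y\<close> of traps starting at the sites \<open>y\<close> and of the random walk increments,
  \<open>Z ((y, i), n)\<close> being the increment of trap \<open>(y, i)\<close> from time \<open>n\<close> to time \<open>n + 1\<close>.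
\<close>

type_synonym 'd traps = "('d site \<Rightarrow> nat) \<times> (('d site \<times> nat) \<times> nat \<Rightarrow> 'd site)"

definition trap_measure :: "real \<Rightarrow> 'd::finite traps measure" where
  "trap_measure u =
     (\<Pi>\<^sub>M y\<in>UNIV. measure_pmf (trap_count_pmf u)) \<Otimes>\<^sub>M (\<Pi>\<^sub>M l\<in>UNIV. measure_pmf srw_step_pmf)"

definition trap_position :: "'d::finite traps \<Rightarrow> 'd site \<times> nat \<Rightarrow> nat \<Rightarrow> 'd site" where
  "trap_position \<omega> l t = fst l + (\<Sum>n<t. snd \<omega> (l, n))"

definition environment :: "'d::finite traps \<Rightarrow> 'd env" where
  "environment \<omega> = (\<lambda>(x, t). \<exists>y i. i < fst \<omega> y \<and> trap_position \<omega> (y, i) t = x)"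

definition env_law :: "real \<Rightarrow> 'd::finite env measure" where
  "env_law u = distr (trap_measure u) env_space environment"


section \<open>Escape trajectories\<close>

type_synonym 'd trajectory = "nat \<Rightarrow> 'd point"

definition escape_trajectory :: "'d::finite trajectory \<Rightarrow> bool" where
  "escape_trajectory \<rho> \<longleftrightarrow>
     (\<forall>k. l1_dist (\<rho> (Suc k)) (\<rho> k) = 1) \<and>
     \<rho> 0 = (0, 0) \<and>
     mono (\<lambda>k. snd (\<rho> k)) \<and>
     filterlim (\<lambda>k. snd (\<rho> k)) at_top sequentially"

text \<open>
  For an escape trajectory the set \<open>{i. snd (\<rho> i) = t}\<close> is finite and nonempty.
\<close>

definition speed :: "'d trajectory \<Rightarrow> nat \<Rightarrow> nat" where
  "speed \<rho> t = Max {i. snd (\<rho> i) = t} - Min {i. snd (\<rho> i) = t}"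

definition detection_index :: "'d trajectory \<Rightarrow> 'd env \<Rightarrow> enat" where
  "detection_index \<rho> \<xi> = (INF k\<in>{k. \<xi> (\<rho> k)}. enat k)"

definition detection_time :: "'d trajectory \<Rightarrow> 'd env \<Rightarrow> enat" where
  "detection_time \<rho> \<xi> =
     (case detection_index \<rho> \<xi> of enat k \<Rightarrow> enat (snd (\<rho> k)) | \<infinity> \<Rightarrow> \<infinity>)"


section \<open>Escape strategies\<close>

type_synonym 'd strategy = "'d env \<Rightarrow> 'd trajectory"

definition escape_strategy :: "'d::finite strategy \<Rightarrow> bool" where
  "escape_strategy \<rho> \<longleftrightarrow> (\<forall>\<xi>. escape_trajectory (\<rho> \<xi>))"

text \<open>The \<open>\<sigma>\<close>-algebra \<open>\<sigma>(\<xi>(x,s) : x \<in> \<int>\<^sup>d, s \<le> t)\<close>.\<close>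

definition env_filtration :: "nat \<Rightarrow> 'd::finite env measure" where
  "env_filtration t = sigma UNIV {{\<xi>. \<xi> (x, s) \<in> B} | x s B. s \<le> t}"

definition adapted :: "'d::finite strategy \<Rightarrow> bool" where
  "adapted \<rho> \<longleftrightarrow> (\<forall>k x t. {\<xi>. \<rho> \<xi> k = (x, t)} \<in> sets (env_filtration t))"

definition escape_event :: "'d strategy \<Rightarrow> 'd env set" where
  "escape_event \<rho> = {\<xi>. detection_time (\<rho> \<xi>) \<xi> = \<infinity>}"

text \<open>
  The conditional expectation of the speed given the (non-null) escape event, taken as a
  Lebesgue integral with values in \<open>[0, \<infinity>]\<close> so that it also makes sense when it is infinite.
\<close>

definition expected_speed_given_escape ::
    "real \<Rightarrow> 'd::finite strategy \<Rightarrow> nat \<Rightarrow> ennreal" where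
  "expected_speed_given_escape u \<rho> t =
     (\<integral>\<^sup>+ \<xi>. of_nat (speed (\<rho> \<xi>) t) \<partial>uniform_measure (env_law u) (escape_event \<rho>))"

definition critical_intensity :: "'d::finite itself \<Rightarrow> real \<Rightarrow> ennreal" where
  "critical_intensity _ s = (SUP u\<in>{u. 0 \<le> u \<and> (\<exists>\<rho> :: 'd strategy.
      escape_strategy \<rho> \<and> adapted \<rho> \<and>
      0 < emeasure (env_law u) (escape_event \<rho>) \<and>
      (\<forall>t. expected_speed_given_escape u \<rho> t \<le> ennreal s))}. ennreal u)"


section \<open>Well-definedness\<close>

lemma finite_unit_steps: "finite {e :: int ^ 'd::finite. l1_norm e = 1}"
proof -
  have "{e :: int ^ 'd. l1_norm e = 1} \<subseteq> vec_lambda ` (\<Pi>\<^sub>E i\<in>UNIV. {-1..1})"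
  proof
    fix e :: "int ^ 'd"
    assume "e \<in> {e. l1_norm e = 1}"
    then have "\<bar>e $ i\<bar> \<le> 1" for i
      using member_le_sum[of i UNIV "\<lambda>i. \<bar>e $ i\<bar>"] by (simp add: l1_norm_def)
    then have "vec_nth e \<in> (\<Pi>\<^sub>E i\<in>UNIV. {-1..1})"
      by (auto simp: abs_le_iff minus_le_iff)
    then show "e \<in> vec_lambda ` (\<Pi>\<^sub>E i\<in>UNIV. {-1..1})"
      by (metis image_eqI vec_nth_inverse)
  qed
  then show ?thesis
    by (rule finite_subset) (intro finite_imageI finite_PiE; simp)
qed

lemma unit_steps_nonempty: "{e :: int ^ 'd::finite. l1_norm e = 1} \<noteq> {}"
proof -
  have "l1_norm (axis (undefined :: 'd) 1) = 1"
    by (simp add: l1_norm_def axis_def if_distrib cong: if_cong)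
  then show ?thesis by blast
qed

lemma environment_measurable:
  "(environment :: 'd::finite traps \<Rightarrow> 'd env) \<in> trap_measure u \<rightarrow>\<^sub>M env_space"
  unfolding env_space_def
proof (rule measurable_PiM_single')
  fix p :: "'d point"
  obtain x t where p: "p = (x, t)" by (cases p)
  have N: "(\<lambda>\<omega> :: 'd traps. fst \<omega> y) \<in> trap_measure u \<rightarrow>\<^sub>M count_space UNIV" for y
    unfolding trap_measure_def
    by (rule measurable_compose[OF measurable_fst])
       (rule measurable_PiM_component_rev; simp)
  have Z: "(\<lambda>\<omega> :: 'd traps. snd \<omega> l) \<in> trap_measure u \<rightarrow>\<^sub>M count_space UNIV" for l
    unfolding trap_measure_def
    by (rule measurable_compose[OF measurable_snd])
       (rule measurable_PiM_component_rev; simp)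
  have S: "(\<lambda>\<omega> :: 'd traps. \<Sum>n<m. snd \<omega> (l, n)) \<in> trap_measure u \<rightarrow>\<^sub>M count_space UNIV" for l m
  proof (induction m)
    case (Suc m)
    show ?case
      by (simp, rule measurable_compose_countable[OF _ Z],
          rule measurable_compose[OF Suc]) simp
  qed simp
  have [measurable]: "Measurable.pred (trap_measure u) (\<lambda>\<omega> :: 'd traps. i < fst \<omega> y)" for i y
    by (rule measurable_compose[OF N]) simp
  have [measurable]:
    "Measurable.pred (trap_measure u) (\<lambda>\<omega> :: 'd traps. trap_position \<omega> l t = x)" for l
    unfolding trap_position_def by (rule measurable_compose[OF S]) simp
  show "(\<lambda>\<omega>. environment \<omega> p) \<in> trap_measure u \<rightarrow>\<^sub>M count_space UNIV"
    unfolding environment_def p by simp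
qed simp

lemma prob_space_env_law: "prob_space (env_law u :: 'd::finite env measure)"
proof -
  interpret A: product_prob_space "\<lambda>_. measure_pmf (trap_count_pmf u)" "UNIV :: 'd site set"
    by unfold_locales
  interpret B: product_prob_space "\<lambda>_. measure_pmf srw_step_pmf"
      "UNIV :: (('d site \<times> nat) \<times> nat) set"
    by unfold_locales
  interpret pair_prob_space "\<Pi>\<^sub>M y\<in>(UNIV :: 'd site set). measure_pmf (trap_count_pmf u)"
      "\<Pi>\<^sub>M l\<in>(UNIV :: (('d site \<times> nat) \<times> nat) set). measure_pmf (srw_step_pmf :: 'd site pmf)"
    by unfold_locales
  have "prob_space (trap_measure u :: 'd traps measure)"
    unfolding trap_measure_def by unfold_locales
  then show ?thesis
    unfolding env_law_def by (rule prob_space.prob_space_distr) (rule environment_measurable)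
qed

lemma sets_env_filtration_subset:
  "sets (env_filtration t) \<subseteq> sets (env_space :: 'd::finite env measure)"
proof -
  have sp: "space (env_space :: 'd env measure) = UNIV"
    by (simp add: env_space_def space_PiM)
  have "{\<xi>. \<xi> p \<in> B} \<in> sets (env_space :: 'd env measure)" for p B
  proof -
    have "(\<lambda>\<xi>. \<xi> p) \<in> (env_space :: 'd env measure) \<rightarrow>\<^sub>M count_space UNIV"
      unfolding env_space_def by (rule measurable_component_singleton) simp
    from measurable_sets[OF this, of B] show ?thesis by (simp add: sp vimage_def)
  qed
  then have "{{\<xi>. \<xi> (x, s) \<in> B} | x s B. s \<le> t} \<subseteq> sets (env_space :: 'd env measure)"
    by blast
  from sets.sigma_sets_subset[OF this] show ?thesis
    by (simp add: env_filtration_def sp sets_measure_of)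
qed

lemma escape_event_eq: "escape_event \<rho> = {\<xi>. \<forall>k. \<not> \<xi> (\<rho> \<xi> k)}"
proof -
  have "detection_time \<sigma> \<xi> = \<infinity> \<longleftrightarrow> (\<forall>k. \<not> \<xi> (\<sigma> k))" for \<sigma> and \<xi> :: "'a env"
  proof (cases "\<exists>k. \<xi> (\<sigma> k)")
    case True
    then obtain k where "\<xi> (\<sigma> k)" by blast
    then have "detection_index \<sigma> \<xi> \<le> enat k"
      unfolding detection_index_def by (intro INF_lower) simp
    then obtain j where "detection_index \<sigma> \<xi> = enat j"
      by (cases "detection_index \<sigma> \<xi>") auto
    then show ?thesis using True by (simp add: detection_time_def)
  next
    case False
    then show ?thesis by (simp add: detection_time_def detection_index_def top_enat_def)
  qed
  then show ?thesis by (simp add: escape_event_def)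
qed

lemma escape_event_measurable:
  fixes \<rho> :: "'d::finite strategy"
  assumes "adapted \<rho>"
  shows "escape_event \<rho> \<in> sets (env_law u)"
proof -
  have sp: "space (env_space :: 'd env measure) = UNIV"
    by (simp add: env_space_def space_PiM)
  have [measurable]: "Measurable.pred env_space (\<lambda>\<xi>. \<rho> \<xi> k = p)" for k p
    using assms sets_env_filtration_subset[where 'd = 'd]
    by (cases p) (simp add: adapted_def pred_def sp subset_iff, blast)
  have [measurable]: "Measurable.pred (env_space :: 'd env measure) (\<lambda>\<xi>. \<xi> p)" for p
    unfolding env_space_def by (rule measurable_component_singleton) simp
  have "escape_event \<rho> = {\<xi>\<in>space env_space. \<forall>k p. \<rho> \<xi> k = p \<longrightarrow> \<not> \<xi> p}"
    by (simp add: escape_event_eq sp)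
  also have "\<dots> \<in> sets env_space" by measurable
  finally show ?thesis by (simp add: env_law_def)
qed

end

theory Submission
  imports Defs
begin

text \<open>
  No escape at high intensity. Fix a final time \<open>T\<close>. For a site \<open>z\<close> the expected number of
  traps at \<open>z\<close> at time \<open>T\<close>, given the traps at time \<open>t\<close>, is a martingale in \<open>t\<close>. It is a sum
  over independent traps of terms bounded by the supremum of the heat kernel for the remaining time
  \<open>T - t\<close>, so the probability that it drops by a definite factor as the remaining time goes from
  \<open>B ^ (k + 1)\<close> to \<open>B ^ k\<close> is at most \<open>exp (- c u 2 ^ k)\<close>. This beats the polynomial number of sites that
  the target can reach in the remaining time at its bounded mean speed. As the event of not being detected
  before \<open>t\<close> is determined by the environment up to \<open>t\<close> and its probability decreases to the
  escape probability, conditioning on it at a late \<open>t\<close> costs a factor of at most 2 and does not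
  influence the later steps of the traps. Hence for large \<open>u\<close> the target is at an occupied site at time
  \<open>T\<close> with conditional probability bounded below, which is a contradiction.

  Escape at low intensity. A site whose neighbourhood is vacant at time \<open>t\<close> is surely vacant at time
  \<open>t + 1\<close>. In a coordinate plane, blocks without traps form Lipschitz curves close to either axis. The target
  spends even times on such a curve over the first axis and odd times on one over the second axis;
  at time \<open>t + 1\<close> the curves of the times \<open>t\<close> and \<open>t + 1\<close> are both vacant, and since they
  cross, the target can change from one to the other. Its position is a function of the environment at the
  present time alone, so stationarity bounds the mean speed.
\<close>

section \<open>Products over the traps\<close>

text \<open>In the upper bound the target chooses its site at time \<open>T\<close> with knowledge
  of the traps, so the trap density has to be controlled at all sites still within reach, and their
  number must shrink as \<open>T\<close> approaches. Hence the geometric sequence of times before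
  \<open>T\<close>, with one union bound per scale. Some polynomial decay of the heat kernel is
  enough, because the base of the sequence can be adapted to the exponent. The scale that begins at
  time 0 cannot use the factor 2; it is estimated without conditioning, and its failure probability
  vanishes as \<open>T\<close> grows while the escape probability stays fixed. In the lower bound,
  curves over one and the same axis at consecutive times could miss each other; exchanging the axes
  forces a crossing. Low enough curves exist almost surely at all times, at whatever height, so that
  only time 0 costs probability. When both curves are low at height 0 the target does not move at
  all, so the mean speed is of the order of the small parameter \<open>\<beta>\<close> and can be
  brought below any \<open>s > 0\<close>.\<close>

abbreviation unit_steps :: "(int ^ 'd::finite) set" where
  "unit_steps \<equiv> {e. l1_norm e = 1}"

text \<open>The one-step transition operator of the random walk, acting on functions.\<close>

definition avg :: "(int ^ 'd::finite \<Rightarrow> real) \<Rightarrow> int ^ 'd \<Rightarrow> real" where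
  "avg f x = (\<Sum>e\<in>unit_steps. f (x + e)) / card (unit_steps :: (int ^ 'd) set)"

lemma card_unit_steps_pos: "card (unit_steps :: (int ^ 'd::finite) set) > 0"
  using finite_unit_steps unit_steps_nonempty by (simp add: card_gt_0_iff)

lemma avg_nonneg: "(\<And>x. 0 \<le> f x) \<Longrightarrow> 0 \<le> avg f x"
  by (simp add: avg_def sum_nonneg)

lemma avg_mono: "(\<And>x. f x \<le> g x) \<Longrightarrow> avg f x \<le> avg g x"
  by (simp add: avg_def sum_mono divide_right_mono)

lemma avg_const [simp]: "avg (\<lambda>_. c) x = c"
  using card_unit_steps_pos[where 'd='a] by (simp add: avg_def)

lemma avg_add: "avg (\<lambda>x. f x + g x) x = avg f x + avg g x"
  by (simp add: avg_def sum.distrib add_divide_distrib)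

lemma avg_cmult: "avg (\<lambda>x. c * f x) x = c * avg f x"
  by (simp add: avg_def sum_distrib_left)

lemma avg_translate: "avg (\<lambda>x. f (x - z)) x = avg f (x - z)"
  by (simp add: avg_def algebra_simps)

lemma avg_pow_nonneg: "(\<And>x. 0 \<le> f x) \<Longrightarrow> 0 \<le> (avg ^^ n) f x"
  by (induction n arbitrary: x) (auto intro: avg_nonneg)

lemma avg_pow_mono: "(\<And>x. f x \<le> g x) \<Longrightarrow> (avg ^^ n) f x \<le> (avg ^^ n) g x"
  by (induction n arbitrary: x) (auto intro: avg_mono)

lemma avg_pow_affine: "(avg ^^ n) (\<lambda>x. c + k * f x) x = c + k * (avg ^^ n) f x"
proof (induction n arbitrary: x)
  case (Suc n)
  then have "(avg ^^ n) (\<lambda>x. c + k * f x) = (\<lambda>x. c + k * (avg ^^ n) f x)" by blast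
  then show ?case by (simp add: avg_add avg_cmult)
qed simp

lemma avg_pow_translate: "(avg ^^ n) (\<lambda>x. f (x - z)) x = (avg ^^ n) f (x - z)"
proof (induction n arbitrary: x)
  case (Suc n)
  then have "(avg ^^ n) (\<lambda>x. f (x - z)) = (\<lambda>x. (avg ^^ n) f (x - z))" by blast
  then show ?case by (simp add: avg_translate)
qed simp

lemma nn_integral_srw_step:
  assumes "\<And>x. 0 \<le> f x"
  shows "(\<integral>\<^sup>+ e. ennreal (f (x + e)) \<partial>measure_pmf srw_step_pmf) = ennreal (avg f x)"
  unfolding srw_step_pmf_def avg_def
  using assms card_unit_steps_pos[where 'd='a]
  by (subst nn_integral_pmf_of_set[OF unit_steps_nonempty finite_unit_steps])
     (simp add: sum_nonneg divide_ennreal[symmetric] ennreal_of_nat_eq_real_of_nat)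

text \<open>This takes the place of conditional expectations: a single count or increment is
  integrated out by substituting an independent copy, which preserves the product measure.\<close>

lemma nn_integral_PiM_resample:
  assumes M: "\<And>i. prob_space (M i)"
    and F [measurable]: "F \<in> borel_measurable (\<Pi>\<^sub>M i\<in>UNIV. M i)"
  shows "(\<integral>\<^sup>+ X. F X \<partial>(\<Pi>\<^sub>M i\<in>UNIV. M i)) =
    (\<integral>\<^sup>+ X. \<integral>\<^sup>+ x. F (X(i := x)) \<partial>M i \<partial>(\<Pi>\<^sub>M i\<in>UNIV. M i))"
proof -
  interpret I: prob_space "\<Pi>\<^sub>M i\<in>UNIV. M i" by (intro prob_space_PiM M)
  interpret i: prob_space "M i" by (rule M)
  interpret p: pair_sigma_finite "M i" "\<Pi>\<^sub>M i\<in>UNIV. M i" ..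
  have [measurable]: "(\<lambda>(x, X). X(i := x)) \<in> M i \<Otimes>\<^sub>M (\<Pi>\<^sub>M i\<in>UNIV. M i) \<rightarrow>\<^sub>M (\<Pi>\<^sub>M i\<in>UNIV. M i)"
    using measurable_fun_upd[of UNIV UNIV i snd "M i \<Otimes>\<^sub>M (\<Pi>\<^sub>M i\<in>UNIV. M i)" M fst]
    by (simp add: case_prod_beta')
  have eq: "distr (M i \<Otimes>\<^sub>M (\<Pi>\<^sub>M i\<in>UNIV. M i)) (\<Pi>\<^sub>M i\<in>UNIV. M i) (\<lambda>(x, X). X(i := x)) = (\<Pi>\<^sub>M i\<in>UNIV. M i)"
    using distr_pair_PiM_eq_PiM[of UNIV M i] M by simp
  have "(\<integral>\<^sup>+ X. F X \<partial>(\<Pi>\<^sub>M i\<in>UNIV. M i)) =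
      (\<integral>\<^sup>+ p. F ((\<lambda>(x, X). X(i := x)) p) \<partial>(M i \<Otimes>\<^sub>M (\<Pi>\<^sub>M i\<in>UNIV. M i)))"
    by (subst eq[symmetric], subst nn_integral_distr) simp_all
  also have "\<dots> = (\<integral>\<^sup>+ X. \<integral>\<^sup>+ x. F (X(i := x)) \<partial>M i \<partial>(\<Pi>\<^sub>M i\<in>UNIV. M i))"
    by (subst p.nn_integral_snd[symmetric]) (simp_all add: measurable_compose[OF _ F])
  finally show ?thesis .
qed

definition step_space :: "(('d::finite site \<times> nat) \<times> nat \<Rightarrow> 'd site) measure" where
  "step_space = (\<Pi>\<^sub>M l\<in>UNIV. measure_pmf srw_step_pmf)"

definition count_measure :: "real \<Rightarrow> ('d::finite site \<Rightarrow> nat) measure" where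
  "count_measure u = (\<Pi>\<^sub>M y\<in>UNIV. measure_pmf (trap_count_pmf u))"

lemma trap_measure_eq: "trap_measure u = count_measure u \<Otimes>\<^sub>M step_space"
  by (simp add: trap_measure_def count_measure_def step_space_def)

lemma prob_space_step_space: "prob_space step_space"
  unfolding step_space_def by (intro prob_space_PiM prob_space_measure_pmf)

lemma prob_space_count_measure: "prob_space (count_measure u)"
  unfolding count_measure_def by (intro prob_space_PiM prob_space_measure_pmf)

lemma prob_space_trap_measure: "prob_space (trap_measure u)"
proof -
  interpret A: prob_space "count_measure u :: ('a site \<Rightarrow> nat) measure" by (rule prob_space_count_measure)
  interpret B: prob_space "step_space :: (('a site \<times> nat) \<times> nat \<Rightarrow> 'a site) measure"
    by (rule prob_space_step_space)
  interpret pair_prob_space "count_measure u :: ('a site \<Rightarrow> nat) measure"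
      "step_space :: (('a site \<times> nat) \<times> nat \<Rightarrow> 'a site) measure" ..
  show ?thesis unfolding trap_measure_eq by unfold_locales
qed

lemma space_trap_measure [simp]: "space (trap_measure u) = UNIV"
  by (simp add: trap_measure_def space_pair_measure space_PiM)

lemma measurable_step [measurable]: "(\<lambda>Z. Z c) \<in> step_space \<rightarrow>\<^sub>M count_space UNIV"
  unfolding step_space_def by (rule measurable_PiM_component_rev) simp_all

lemma measurable_count [measurable]: "(\<lambda>N. N y) \<in> count_measure u \<rightarrow>\<^sub>M count_space UNIV"
  unfolding count_measure_def by (rule measurable_PiM_component_rev) simp_all

lemma measurable_site_sum:
  fixes Z :: "'b \<Rightarrow> nat \<Rightarrow> 'd::finite site"
  assumes Z: "\<And>n. n < m \<Longrightarrow> (\<lambda>\<omega>. Z \<omega> n) \<in> M \<rightarrow>\<^sub>M count_space UNIV"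
  shows "(\<lambda>\<omega>. \<Sum>n<m. Z \<omega> n) \<in> M \<rightarrow>\<^sub>M count_space UNIV"
  using assms
proof (induction m)
  case (Suc m)
  have S: "(\<lambda>\<omega>. \<Sum>n<m. Z \<omega> n) \<in> M \<rightarrow>\<^sub>M count_space UNIV" using Suc by simp
  show ?case
    by (simp, rule measurable_compose_countable[OF _ Suc.prems[OF lessI]],
        rule measurable_compose[OF S]) simp
qed simp

lemma measurable_snd_trap_step [measurable]:
  "(\<lambda>\<omega>. snd \<omega> c) \<in> trap_measure u \<rightarrow>\<^sub>M count_space UNIV"
  unfolding trap_measure_eq by (rule measurable_compose[OF measurable_snd measurable_step])

lemma measurable_fst_trap_count [measurable]:
  "(\<lambda>\<omega>. fst \<omega> y) \<in> trap_measure u \<rightarrow>\<^sub>M count_space UNIV"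
  unfolding trap_measure_eq by (rule measurable_compose[OF measurable_fst measurable_count])

lemma measurable_trap_position [measurable]:
  "(\<lambda>\<omega>. trap_position \<omega> l t) \<in> trap_measure u \<rightarrow>\<^sub>M count_space UNIV"
  unfolding trap_position_def
  by (rule measurable_compose[OF measurable_site_sum[where m = t and Z = "\<lambda>\<omega> n. snd \<omega> (l, n)"], where g = "\<lambda>x. fst l + x"])
     measurable

lemma measurable_trap_position_step [measurable]:
  "(\<lambda>Z. trap_position (N, Z) l t) \<in> step_space \<rightarrow>\<^sub>M count_space UNIV"
  unfolding trap_position_def snd_conv
  by (rule measurable_compose[OF measurable_site_sum[where m = t and Z = "\<lambda>\<omega> n. \<omega> (l, n)"], where g = "\<lambda>x. fst l + x"])
     measurable

lemma nn_integral_step_resample: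
  assumes "F \<in> borel_measurable step_space"
  shows "(\<integral>\<^sup>+ Z. F Z \<partial>step_space) = (\<integral>\<^sup>+ Z. \<integral>\<^sup>+ e. F (Z(c := e)) \<partial>measure_pmf srw_step_pmf \<partial>step_space)"
  using assms unfolding step_space_def by (rule nn_integral_PiM_resample[OF prob_space_measure_pmf])

lemma nn_integral_count_resample:
  assumes "F \<in> borel_measurable (count_measure u)"
  shows "(\<integral>\<^sup>+ N. F N \<partial>count_measure u) =
    (\<integral>\<^sup>+ N. \<integral>\<^sup>+ n. F (N(y := n)) \<partial>measure_pmf (trap_count_pmf u) \<partial>count_measure u)"
  using assms unfolding count_measure_def by (rule nn_integral_PiM_resample[OF prob_space_measure_pmf])

lemma trap_position_cong:
  assumes "\<And>n. n < t \<Longrightarrow> Z (l, n) = Z' (l, n)"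
  shows "trap_position (N, Z) l t = trap_position (N', Z') l t"
  using assms by (auto simp: trap_position_def intro!: arg_cong2[where f = "(+)"] sum.cong)

lemma trap_position_Suc: "trap_position \<omega> l (Suc t) = trap_position \<omega> l t + snd \<omega> (l, t)"
  by (simp add: trap_position_def add.assoc)

text \<open>The increments at time \<open>t\<close> of the labels in \<open>L\<close> are integrated out one label at a time.\<close>

lemma nn_integral_steps_labels:
  fixes f :: "'d::finite site \<Rightarrow> real"
  assumes "finite L" and f: "\<And>x. 0 \<le> f x"
    and "g \<in> borel_measurable step_space"
    and "\<And>Z Z'. (\<And>l n. n < t \<Longrightarrow> Z (l, n) = Z' (l, n)) \<Longrightarrow> g Z = g Z'"
  shows "(\<integral>\<^sup>+ Z. g Z * ennreal (\<Prod>l\<in>L. f (trap_position (N, Z) l (Suc t))) \<partial>step_space) =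
    (\<integral>\<^sup>+ Z. g Z * ennreal (\<Prod>l\<in>L. avg f (trap_position (N, Z) l t)) \<partial>step_space)"
  using assms(1,3,4)
proof (induction L arbitrary: g rule: finite_induct)
  case (insert l L)
  have [measurable]: "g \<in> borel_measurable step_space" by (rule insert.prems)
  define F where "F = (\<lambda>Z. g Z * ennreal (\<Prod>l\<in>L. f (trap_position (N, Z) l (Suc t))))"
  have [measurable]: "F \<in> borel_measurable step_space" unfolding F_def by measurable
  have g_upd: "g (Z((l, t) := e)) = g Z" for Z e
    by (rule insert.prems(2)) auto
  have F_upd: "F (Z((l, t) := e)) = F Z" for Z e
  proof -
    have "trap_position (N, Z((l, t) := e)) l' (Suc t) = trap_position (N, Z) l' (Suc t)"
      if "l' \<in> L" for l'
      using that insert.hyps by (intro trap_position_cong) auto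
    then show ?thesis by (simp add: F_def g_upd)
  qed
  have pos_upd: "trap_position (N, Z((l, t) := e)) l t = trap_position (N, Z) l t" for Z e
    by (intro trap_position_cong) auto
  have "(\<integral>\<^sup>+ Z. g Z * ennreal (\<Prod>l\<in>insert l L. f (trap_position (N, Z) l (Suc t))) \<partial>step_space) =
      (\<integral>\<^sup>+ Z. F Z * ennreal (f (trap_position (N, Z) l t + Z (l, t))) \<partial>step_space)"
    using insert.hyps f
    by (simp add: F_def ennreal_mult prod_nonneg trap_position_Suc mult_ac)
  also have "\<dots> = (\<integral>\<^sup>+ Z. \<integral>\<^sup>+ e. F Z * ennreal (f (trap_position (N, Z) l t + e))
      \<partial>measure_pmf srw_step_pmf \<partial>step_space)"
    by (subst nn_integral_step_resample[where c = "(l, t)"]) (simp_all add: F_upd pos_upd)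
  also have "\<dots> = (\<integral>\<^sup>+ Z. F Z * ennreal (avg f (trap_position (N, Z) l t)) \<partial>step_space)"
    by (simp add: nn_integral_cmult nn_integral_srw_step[of f, OF f])
  also have "\<dots> = (\<integral>\<^sup>+ Z. (g Z * ennreal (avg f (trap_position (N, Z) l t))) *
      ennreal (\<Prod>l\<in>L. f (trap_position (N, Z) l (Suc t))) \<partial>step_space)"
    by (simp add: F_def mult_ac)
  \<comment> \<open>The averaged factor of \<open>l\<close> depends on the increments before
    \<open>t\<close> only, so it joins \<open>g\<close> and the induction hypothesis
    applies.\<close>
  also have "\<dots> = (\<integral>\<^sup>+ Z. (g Z * ennreal (avg f (trap_position (N, Z) l t))) *
      ennreal (\<Prod>l\<in>L. avg f (trap_position (N, Z) l t)) \<partial>step_space)"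
  proof (rule insert.IH)
    fix Z Z' :: "('d site \<times> nat) \<times> nat \<Rightarrow> 'd site"
    assume *: "\<And>l n. n < t \<Longrightarrow> Z (l, n) = Z' (l, n)"
    then have "g Z = g Z'" by (rule insert.prems(2))
    moreover have "trap_position (N, Z) l t = trap_position (N, Z') l t"
      by (intro trap_position_cong *)
    ultimately show "g Z * ennreal (avg f (trap_position (N, Z) l t)) =
      g Z' * ennreal (avg f (trap_position (N, Z') l t))" by simp
  qed measurable
  also have "\<dots> = (\<integral>\<^sup>+ Z. g Z * ennreal (\<Prod>l\<in>insert l L. avg f (trap_position (N, Z) l t)) \<partial>step_space)"
    using insert.hyps f by (simp add: ennreal_mult prod_nonneg avg_nonneg mult_ac)
  finally show ?case .
next
  case empty
  show ?case by simp
qed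

text \<open>A multiplicative functional of the traps at time \<open>t\<close>, the quantity behind
  all Laplace and Chernoff bounds below. Starting sites are restricted to \<open>Y\<close>, finite
  in every use, so that the product is a finite one.\<close>

definition trap_product :: "'d::finite site set \<Rightarrow> ('d site \<Rightarrow> real) \<Rightarrow> nat \<Rightarrow> 'd traps \<Rightarrow> real" where
  "trap_product Y f t \<omega> = (\<Prod>y\<in>Y. \<Prod>i<fst \<omega> y. f (trap_position \<omega> (y, i) t))"

text \<open>Plays the role of measurability with respect to the counts and the increments before
  \<open>t\<close>, stated pointwise.\<close>

definition past_dependent :: "nat \<Rightarrow> ('d::finite traps \<Rightarrow> 'b) \<Rightarrow> bool" where
  "past_dependent t g \<longleftrightarrow>
    (\<forall>N Z Z'. (\<forall>l n. n < t \<longrightarrow> Z (l, n) = Z' (l, n)) \<longrightarrow> g (N, Z) = g (N, Z'))"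

lemma past_dependent_mono: "past_dependent s g \<Longrightarrow> s \<le> t \<Longrightarrow> past_dependent t g"
proof -
  assume dep: "past_dependent s g" and le: "s \<le> t"
  show "past_dependent t g" unfolding past_dependent_def
  proof (intro allI impI)
    fix N :: "'a site \<Rightarrow> nat" and Z Z' :: "('a site \<times> nat) \<times> nat \<Rightarrow> 'a site"
    assume *: "\<forall>l n. n < t \<longrightarrow> Z (l, n) = Z' (l, n)"
    have "\<forall>l n. n < s \<longrightarrow> Z (l, n) = Z' (l, n)" using * le by simp
    then show "g (N, Z) = g (N, Z')" using dep unfolding past_dependent_def by blast
  qed
qed

lemma trap_product_nonneg: "(\<And>x. 0 \<le> f x) \<Longrightarrow> 0 \<le> trap_product Y f t \<omega>"
  unfolding trap_product_def by (intro prod_nonneg) simp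

lemma measurable_trap_product [measurable]:
  "finite Y \<Longrightarrow> trap_product Y f t \<in> borel_measurable (trap_measure u)"
proof -
  have "(\<lambda>\<omega>. \<Prod>i<fst \<omega> y. f (trap_position \<omega> (y, i) t)) \<in> borel_measurable (trap_measure u)" for y
    by (rule measurable_compose_countable[where f = "\<lambda>n \<omega>. \<Prod>i<n. f (trap_position \<omega> (y, i) t)"]) measurable
  then show ?thesis unfolding trap_product_def by measurable
qed

text \<open>Once the counts are fixed, the labels in use are finitely many and walk independently,
  so each increment at time \<open>t\<close> turns its factor \<open>f\<close> into
  \<open>avg f\<close> while \<open>g\<close> does not see it.\<close>

lemma trap_product_markov:
  fixes f :: "'d::finite site \<Rightarrow> real"
  assumes Y: "finite Y" and f: "\<And>x. 0 \<le> f x"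
    and g [measurable]: "g \<in> borel_measurable (trap_measure u)" and dep: "past_dependent t g"
  shows "(\<integral>\<^sup>+ \<omega>. g \<omega> * ennreal (trap_product Y f (Suc t) \<omega>) \<partial>trap_measure u) =
    (\<integral>\<^sup>+ \<omega>. g \<omega> * ennreal (trap_product Y (avg f) t \<omega>) \<partial>trap_measure u)"
proof -
  interpret B: prob_space "step_space :: (('d site \<times> nat) \<times> nat \<Rightarrow> 'd site) measure"
    by (rule prob_space_step_space)
  note [measurable] = measurable_trap_product[OF Y, where u = u]
  have prod: "trap_product Y h s (N, Z) = (\<Prod>l\<in>Sigma Y (\<lambda>y. {..<N y}). h (trap_position (N, Z) l s))"
    for h s N Z
    using Y by (simp add: trap_product_def prod.Sigma case_prod_beta')
  have *: "(\<integral>\<^sup>+ \<omega>. g \<omega> * ennreal (trap_product Y h s \<omega>) \<partial>trap_measure u) =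
    (\<integral>\<^sup>+ N. \<integral>\<^sup>+ Z. g (N, Z) * ennreal (trap_product Y h s (N, Z)) \<partial>step_space \<partial>count_measure u)" for h s
  proof -
    have "(\<lambda>\<omega>. g \<omega> * ennreal (trap_product Y h s \<omega>)) \<in> borel_measurable (trap_measure u)" by measurable
    then show ?thesis unfolding trap_measure_eq
      by (subst B.nn_integral_fst[symmetric]) simp_all
  qed
  have g': "(\<lambda>Z. g (N, Z)) \<in> borel_measurable step_space" for N
    using g unfolding trap_measure_eq
    by (rule measurable_compose[OF measurable_Pair1', rotated]) (simp add: count_measure_def space_PiM)
  show ?thesis unfolding * prod
  proof (rule nn_integral_cong, rule nn_integral_steps_labels)
    show "finite (Sigma Y (\<lambda>y. {..<N y}))" for N :: "'d site \<Rightarrow> nat" using Y by auto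
    show "g (N, Z) = g (N, Z')" if "\<And>l n. n < t \<Longrightarrow> Z (l, n) = Z' (l, n)" for N Z Z'
      using dep that unfolding past_dependent_def by blast
  qed (use f g' in auto)
qed

lemma trap_product_markov_pow:
  assumes "finite Y" and f: "\<And>x. 0 \<le> f x"
    and "g \<in> borel_measurable (trap_measure u)" and dep: "past_dependent t g"
  shows "(\<integral>\<^sup>+ \<omega>. g \<omega> * ennreal (trap_product Y f (t + n) \<omega>) \<partial>trap_measure u) =
    (\<integral>\<^sup>+ \<omega>. g \<omega> * ennreal (trap_product Y ((avg ^^ n) f) t \<omega>) \<partial>trap_measure u)"
  using f
proof (induction n arbitrary: f)
  case (Suc n)
  have "(\<integral>\<^sup>+ \<omega>. g \<omega> * ennreal (trap_product Y f (t + Suc n) \<omega>) \<partial>trap_measure u) =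
    (\<integral>\<^sup>+ \<omega>. g \<omega> * ennreal (trap_product Y (avg f) (t + n) \<omega>) \<partial>trap_measure u)"
    using trap_product_markov[OF assms(1) Suc.prems assms(3) past_dependent_mono[OF dep, of "t + n"]] by simp
  also have "\<dots> = (\<integral>\<^sup>+ \<omega>. g \<omega> * ennreal (trap_product Y ((avg ^^ n) (avg f)) t \<omega>) \<partial>trap_measure u)"
    by (intro Suc.IH avg_nonneg Suc.prems)
  finally show ?case by (simp add: funpow_Suc_right del: funpow.simps)
qed simp

lemma trap_count_pgf:
  assumes "0 \<le> u" "0 \<le> a"
  shows "(\<integral>\<^sup>+ n. ennreal (a ^ n) \<partial>measure_pmf (trap_count_pmf u)) = ennreal (exp (u * (a - 1)))"
proof (cases "u = 0")
  case False
  then have u: "u > 0" using assms by simp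
  have "(\<lambda>n. (u * a) ^ n / fact n * exp (- u)) sums (exp (u * a) * exp (- u))"
    using exp_converges[of "u * a"] by (intro sums_mult2) (simp add: divide_inverse mult.commute)
  then have s: "(\<lambda>n. pmf (poisson_pmf u) n * a ^ n) sums exp (u * (a - 1))"
    using u by (simp add: power_mult_distrib right_diff_distrib exp_diff exp_minus field_simps)
  have "(\<integral>\<^sup>+ n. ennreal (a ^ n) \<partial>measure_pmf (poisson_pmf u)) =
      (\<Sum>n. ennreal (pmf (poisson_pmf u) n * a ^ n))"
    using assms
    by (simp add: nn_integral_measure_pmf nn_integral_count_space_nat ennreal_mult[symmetric] u
        del: pmf_poisson)
  also have "\<dots> = ennreal (exp (u * (a - 1)))"
    using assms s by (intro suminf_ennreal_eq) auto
  finally show ?thesis using u by (simp add: trap_count_pmf_def)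
qed (simp add: trap_count_pmf_def)

text \<open>At time 0 the traps from \<open>y\<close> are still at \<open>y\<close>, so the
  functional is a product of independent powers \<open>f y ^ N y\<close>, and each site contributes
  a Poisson generating function.\<close>

lemma trap_product_initial:
  fixes f :: "'d::finite site \<Rightarrow> real"
  assumes Y: "finite Y" and f: "\<And>x. 0 \<le> f x" and u: "0 \<le> u"
  shows "(\<integral>\<^sup>+ \<omega>. ennreal (trap_product Y f 0 \<omega>) \<partial>trap_measure u) =
    ennreal (exp (u * (\<Sum>y\<in>Y. f y - 1)))"
proof -
  interpret B: prob_space "step_space :: (('d site \<times> nat) \<times> nat \<Rightarrow> 'd site) measure"
    by (rule prob_space_step_space)
  interpret A: prob_space "count_measure u :: ('d site \<Rightarrow> nat) measure" by (rule prob_space_count_measure)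
  have "(\<integral>\<^sup>+ \<omega>. ennreal (trap_product Y f 0 \<omega>) \<partial>trap_measure u) =
    (\<integral>\<^sup>+ N. \<integral>\<^sup>+ Z. ennreal (\<Prod>y\<in>Y. f y ^ N y) \<partial>(step_space :: (('d site \<times> nat) \<times> nat \<Rightarrow> 'd site) measure) \<partial>count_measure u)"
    using measurable_compose[OF measurable_trap_product[OF Y, of f 0 u] measurable_ennreal]
    unfolding trap_measure_eq
    by (subst B.nn_integral_fst[symmetric]) (simp_all add: trap_product_def trap_position_def)
  also have "\<dots> = (\<integral>\<^sup>+ N. ennreal (\<Prod>y\<in>Y. f y ^ N y) \<partial>count_measure u)"
    by (simp add: B.emeasure_space_1)
  also have "\<dots> = ennreal (exp (u * (\<Sum>y\<in>Y. f y - 1)))"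
    using Y
  proof induction
    case (insert y Y)
    have upd: "(\<Prod>z\<in>Y. f z ^ (if z = y then n else N z)) = (\<Prod>z\<in>Y. f z ^ N z)" for N n
      using insert.hyps by (intro prod.cong) auto
    have "(\<integral>\<^sup>+ N. ennreal (\<Prod>z\<in>insert y Y. f z ^ N z) \<partial>count_measure u) =
      (\<integral>\<^sup>+ N. ennreal (\<Prod>z\<in>Y. f z ^ N z) * ennreal (f y ^ N y) \<partial>count_measure u)"
      using insert.hyps f by (simp add: ennreal_mult prod_nonneg mult.commute)
    also have "\<dots> = (\<integral>\<^sup>+ N. \<integral>\<^sup>+ n. ennreal (\<Prod>z\<in>Y. f z ^ N z) * ennreal (f y ^ n)
        \<partial>measure_pmf (trap_count_pmf u) \<partial>count_measure u)"
      by (subst nn_integral_count_resample[where y = y]) (simp_all add: upd)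
    also have "\<dots> = (\<integral>\<^sup>+ N. ennreal (\<Prod>z\<in>Y. f z ^ N z) * ennreal (exp (u * (f y - 1))) \<partial>count_measure u)"
      using f by (simp add: nn_integral_cmult trap_count_pgf[OF u])
    also have "\<dots> = ennreal (exp (u * (\<Sum>y\<in>Y. f y - 1))) * ennreal (exp (u * (f y - 1)))"
      by (simp add: nn_integral_multc insert.IH)
    finally show ?case
      using insert.hyps by (simp add: ennreal_mult[symmetric] exp_add[symmetric] algebra_simps)
  qed (simp add: A.emeasure_space_1)
  finally show ?thesis .
qed

text \<open>The Laplace functional of the moving Poisson system: the motion acts on the test
  function, and then the initial configuration is integrated out.\<close>

lemma trap_product_laplace:
  assumes Y: "finite Y" and f: "\<And>x. 0 \<le> f x" and u: "0 \<le> u"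
  shows "(\<integral>\<^sup>+ \<omega>. ennreal (trap_product Y f t \<omega>) \<partial>trap_measure u) =
    ennreal (exp (u * (\<Sum>y\<in>Y. (avg ^^ t) f y - 1)))"
proof -
  have "(\<integral>\<^sup>+ \<omega>. 1 * ennreal (trap_product Y f (0 + t) \<omega>) \<partial>trap_measure u) =
      (\<integral>\<^sup>+ \<omega>. 1 * ennreal (trap_product Y ((avg ^^ t) f) 0 \<omega>) \<partial>trap_measure u)"
    by (rule trap_product_markov_pow[OF Y f]) (simp_all add: past_dependent_def)
  then show ?thesis
    using trap_product_initial[OF Y avg_pow_nonneg[of f t, OF f] u] by simp
qed

section \<open>Decay of the heat kernel\<close>

text \<open>\<open>heat n (x - z)\<close> is the probability that a walk from \<open>x\<close> is at
  \<open>z\<close> after \<open>n\<close> steps.\<close>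

definition heat :: "nat \<Rightarrow> int ^ 'd::finite \<Rightarrow> real" where
  "heat n = (avg ^^ n) (\<lambda>x. of_bool (x = 0))"

lemma heat_0: "heat 0 x = of_bool (x = 0)"
  by (simp add: heat_def)

lemma heat_Suc: "heat (Suc n) = avg (heat n)"
  by (simp add: heat_def)

text \<open>The Chapman-Kolmogorov equation, the source of the martingale property of the smoothed
  trap densities.\<close>

lemma heat_add: "(avg ^^ m) (\<lambda>x. heat n (x - z)) x = heat (m + n) (x - z)"
  unfolding avg_pow_translate by (simp add: heat_def funpow_add)

lemma heat_nonneg: "0 \<le> heat n x"
  unfolding heat_def by (rule avg_pow_nonneg) simp

lemma heat_le_1: "heat n x \<le> 1"
proof -
  have "heat n x \<le> (avg ^^ n) (\<lambda>_. 1 + 0 * 0) x"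
    unfolding heat_def by (rule avg_pow_mono) simp
  then show ?thesis unfolding avg_pow_affine by simp
qed

lemma has_sum_finite_sum:
  fixes f :: "'b \<Rightarrow> 'c \<Rightarrow> real"
  assumes "finite E" "\<And>e. e \<in> E \<Longrightarrow> (f e has_sum s e) A"
  shows "((\<lambda>x. \<Sum>e\<in>E. f e x) has_sum (\<Sum>e\<in>E. s e)) A"
  using assms by (induction E rule: finite_induct) (auto intro!: has_sum_add)

lemma has_sum_translate:
  fixes f :: "int ^ 'd::finite \<Rightarrow> real"
  assumes "(f has_sum s) UNIV"
  shows "((\<lambda>x. f (x + e)) has_sum s) UNIV"
  using assms has_sum_reindex_bij_betw[OF bij_plus_right, of f e s] by simp

lemma has_sum_avg:
  assumes "(f has_sum s) UNIV"
  shows "(avg f has_sum s) UNIV"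
proof -
  let ?E = "unit_steps :: (int ^ 'a) set"
  have "((\<lambda>x. (\<Sum>e\<in>?E. f (x + e)) * inverse (card ?E)) has_sum (\<Sum>e\<in>?E. s) * inverse (card ?E)) UNIV"
    by (intro has_sum_cmult_left has_sum_finite_sum finite_unit_steps has_sum_translate assms)
  moreover have "(\<Sum>e\<in>?E. s) * inverse (card ?E) = s"
    using card_unit_steps_pos[where 'd='a] by simp
  ultimately show ?thesis unfolding avg_def[abs_def] divide_inverse by (simp only:)
qed

lemma has_sum_heat: "(heat n has_sum 1) (UNIV :: (int ^ 'd::finite) set)"
proof (induction n)
  case 0
  have "((\<lambda>x::int ^ 'd. of_bool (x = 0) :: real) has_sum 1) {0}" by (rule has_sum_finiteI) simp_all
  then have "((\<lambda>x::int ^ 'd. of_bool (x = 0) :: real) has_sum 1) UNIV"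
    by (rule has_sum_cong_neutral[THEN iffD1, rotated -1]) auto
  then show ?case by (simp add: heat_def)
next
  case (Suc n)
  then show ?case unfolding heat_Suc by (rule has_sum_avg)
qed

section \<open>Dissipation of the square sum under averaging\<close>

definition energy :: "(int ^ 'd::finite \<Rightarrow> real) \<Rightarrow> real" where
  "energy f = infsum (\<lambda>x. (f x)\<^sup>2) UNIV"

lemma has_sum_square:
  assumes "\<And>x. 0 \<le> f x" "\<And>x. f x \<le> 1" "(f has_sum s) UNIV"
  shows "((\<lambda>x. (f x)\<^sup>2) has_sum energy f) UNIV"
proof -
  have "(\<lambda>x. (f x)\<^sup>2) summable_on UNIV"
  proof (rule summable_on_comparison_test)
    show "f summable_on UNIV" using assms(3) by (rule has_sum_imp_summable)
    show "(f x)\<^sup>2 \<le> f x" for x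
      using mult_left_le[OF assms(2) assms(1), of x x] by (simp add: power2_eq_square)
  qed simp
  then show ?thesis by (simp add: energy_def)
qed

text \<open>Jensen's inequality with part of the variance kept: the two points \<open>p\<close> and
  \<open>q\<close> alone contribute at least what they would if the mean lay midway between their
  values.\<close>

lemma mean_square_gap:
  fixes g :: "'b \<Rightarrow> real"
  assumes "finite E" "p \<in> E" "q \<in> E" "p \<noteq> q"
  shows "((\<Sum>e\<in>E. g e) / card E)\<^sup>2 + (g p - g q)\<^sup>2 / (2 * real (card E)) \<le> (\<Sum>e\<in>E. (g e)\<^sup>2) / card E"
proof -
  define m where "m = (\<Sum>e\<in>E. g e) / card E"
  have c: "real (card E) > 0" using assms by (auto simp: card_gt_0_iff)
  have s: "(\<Sum>e\<in>E. g e) = m * card E" using c by (simp add: m_def)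
  have "(g p - m)\<^sup>2 + (g q - m)\<^sup>2 = (\<Sum>e\<in>{p, q}. (g e - m)\<^sup>2)" using assms by simp
  also have "\<dots> \<le> (\<Sum>e\<in>E. (g e - m)\<^sup>2)" using assms by (intro sum_mono2) auto
  also have "\<dots> = (\<Sum>e\<in>E. (g e)\<^sup>2) - 2 * m * (\<Sum>e\<in>E. g e) + card E * m\<^sup>2"
  proof -
    have "(g e - m)\<^sup>2 = (g e)\<^sup>2 - 2 * m * g e + m\<^sup>2" for e by (simp add: power2_eq_square algebra_simps)
    then show ?thesis by (simp add: sum.distrib sum_subtractf sum_distrib_left[symmetric])
  qed
  also have "\<dots> = (\<Sum>e\<in>E. (g e)\<^sup>2) - card E * m\<^sup>2" by (simp add: s power2_eq_square)
  finally have 1: "(g p - m)\<^sup>2 + (g q - m)\<^sup>2 \<le> (\<Sum>e\<in>E. (g e)\<^sup>2) - card E * m\<^sup>2" .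
  have "(g p - g q)\<^sup>2 / 2 \<le> (g p - m)\<^sup>2 + (g q - m)\<^sup>2"
  proof -
    have "(g p - m)\<^sup>2 + (g q - m)\<^sup>2 = (g p - g q)\<^sup>2 / 2 + (g p + g q - 2 * m)\<^sup>2 / 2"
      by (simp add: power2_eq_square field_simps)
    then show ?thesis by simp
  qed
  with 1 have "(g p - g q)\<^sup>2 / 2 + card E * m\<^sup>2 \<le> (\<Sum>e\<in>E. (g e)\<^sup>2)" by linarith
  then have "((g p - g q)\<^sup>2 / 2 + card E * m\<^sup>2) / card E \<le> (\<Sum>e\<in>E. (g e)\<^sup>2) / card E"
    using c by (intro divide_right_mono) auto
  then show ?thesis unfolding m_def[symmetric] using c by (simp add: add_divide_distrib add.commute)
qed

definition unit_vec :: "'d::finite \<Rightarrow> int ^ 'd" where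
  "unit_vec i = axis i 1"

lemma unit_vec_step: "l1_norm (unit_vec i) = 1" "l1_norm (- unit_vec i) = 1"
  by (simp_all add: unit_vec_def l1_norm_def axis_def if_distrib[of abs] if_distrib[of uminus] cong: if_cong)

text \<open>
  A discrete Nash inequality in the direction of a single axis: along the axis through a point where
  \<open>f\<close> is at least its energy \<open>a\<close>, the total mass \<open>1\<close> forces \<open>f\<close> to drop by \<open>a / 2\<close>
  within \<open>3 / a\<close> steps.
\<close>

lemma energy_avg_le:
  fixes f :: "int ^ 'd::finite \<Rightarrow> real"
  assumes f0: "\<And>x. 0 \<le> f x" and f1: "\<And>x. f x \<le> 1" and f: "(f has_sum 1) UNIV"
  shows "energy (avg f) \<le> energy f - energy f ^ 3 / (24 * real (card (unit_steps :: (int ^ 'd) set)))"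
proof -
  define N where "N = real (card (unit_steps :: (int ^ 'd) set))"
  define e where "e = unit_vec (undefined :: 'd)"
  define a where "a = energy f"
  have N: "N > 0" using card_unit_steps_pos[where 'd='d] by (simp add: N_def)
  have sq: "((\<lambda>x. (f x)\<^sup>2) has_sum a) UNIV" unfolding a_def by (rule has_sum_square[OF f0 f1 f])
  have e_ne: "e \<noteq> - e"
  proof
    assume "e = - e"
    then have "e $ undefined = - (e $ undefined)" by (metis vector_uminus_component)
    then show False by (simp add: e_def unit_vec_def)
  qed
  define D where "D = infsum (\<lambda>x. (f (x + e) - f (x + (- e)))\<^sup>2) UNIV"
  have D: "((\<lambda>x. (f (x + e) - f (x + (- e)))\<^sup>2) has_sum D) UNIV"
  proof -
    have "(\<lambda>x. 2 * (f (x + e))\<^sup>2 + 2 * (f (x + (- e)))\<^sup>2) summable_on UNIV"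
      using has_sum_translate[OF sq] by (intro summable_on_add summable_on_cmult_right has_sum_imp_summable)
    then have "(\<lambda>x. (f (x + e) - f (x + (- e)))\<^sup>2) summable_on UNIV"
    proof (rule summable_on_comparison_test)
      show "(f (x + e) - f (x + (- e)))\<^sup>2 \<le> 2 * (f (x + e))\<^sup>2 + 2 * (f (x + (- e)))\<^sup>2" for x
        using zero_le_power2[of "f (x + e) + f (x + (- e))"] by (simp add: power2_eq_square algebra_simps)
    qed simp
    then show ?thesis by (simp add: D_def)
  qed
  have gap: "energy (avg f) + D / (2 * N) \<le> a"
  proof (rule has_sum_mono)
    show "((\<lambda>x. (avg f x)\<^sup>2 + (f (x + e) - f (x + (- e)))\<^sup>2 * inverse (2 * N)) has_sum
        energy (avg f) + D / (2 * N)) UNIV"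
      unfolding divide_inverse
    proof (intro has_sum_add has_sum_cmult_left D has_sum_square[where s = 1])
      show "avg f x \<le> 1" for x using avg_mono[of f "\<lambda>_. 1" x] f1 by simp
    qed (auto intro: avg_nonneg f0 has_sum_avg f)
    show "((\<lambda>x. avg (\<lambda>x. (f x)\<^sup>2) x) has_sum a) UNIV" by (rule has_sum_avg[OF sq])
    show "(avg f x)\<^sup>2 + (f (x + e) - f (x + (- e)))\<^sup>2 * inverse (2 * N) \<le> avg (\<lambda>x. (f x)\<^sup>2) x" for x
    proof -
      have "e \<in> unit_steps" "- e \<in> unit_steps" by (simp_all add: e_def unit_vec_step)
      from mean_square_gap[OF finite_unit_steps this e_ne, of "\<lambda>e. f (x + e)"]
      show ?thesis unfolding avg_def N_def divide_inverse .
    qed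
  qed
  have a0: "0 \<le> a" by (rule has_sum_nonneg[OF sq]) simp
  have a1: "a \<le> 1"
  proof (rule has_sum_mono[OF sq f])
    show "(f x)\<^sup>2 \<le> f x" for x
      using mult_left_le[OF f1 f0, of x x] by (simp add: power2_eq_square)
  qed
  have D0: "0 \<le> D" by (rule has_sum_nonneg[OF D]) simp
  have "a ^ 3 / 12 \<le> D"
  proof (cases "a = 0")
    case False
    then have a: "a > 0" using a0 by simp
    \<comment> \<open>The mass is 1 and the square sum is \<open>a\<close>, so \<open>f < a\<close>
      everywhere would give \<open>a < a\<close>.\<close>
    obtain x0 where x0: "f x0 \<ge> a"
    proof (rule ccontr)
      assume "\<not> thesis"
      then have lt: "f x < a" for x using that by (meson not_le_imp_less)
      have "(f x)\<^sup>2 \<le> a * f x" for x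
        using mult_right_mono[OF less_imp_le[OF lt] f0, of x x] by (simp add: power2_eq_square)
      moreover obtain y where "f y > 0"
      proof (rule ccontr)
        assume "\<not> thesis"
        then have "f = (\<lambda>_. 0)" using f0 that by (metis order_le_less)
        then show False using f by (metis has_sum_0_simp has_sum_unique zero_neq_one)
      qed
      then have "(f y)\<^sup>2 < a * f y" using lt[of y] by (simp add: power2_eq_square)
      ultimately have "a < a * 1"
        using has_sum_strict_mono[OF sq has_sum_cmult_right[OF f, of a]] by blast
      then show False by simp
    qed
    \<comment> \<open>With \<open>J \<ge> 2 / a\<close> points of total mass at most 1, some point
      has value at most \<open>a / 2\<close>.\<close>
    define J where "J = nat \<lceil>2 / a\<rceil>"
    have J: "2 / a \<le> real J" "real J \<le> 2 / a + 1"
      using a by (auto simp: J_def) 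
    have Jpos: "real J > 0" using J(1) a by (meson divide_pos_pos less_le_trans zero_less_numeral)
    have "2 / a + 1 \<le> 3 / a" using a a1 by (simp add: field_simps)
    then have J3: "real J \<le> 3 / a" using J by linarith
    \<comment> \<open>Only every second site of the axis is used, since \<open>D\<close> compares
      \<open>x + e\<close> with \<open>x + (- e)\<close>.\<close>
    define g where "g = (\<lambda>i::nat. f (x0 + int (2 * i) *s e))"
    have inj: "inj (\<lambda>i::nat. x0 + int (m * i + k) *s e)" if "m > 0" for m k
    proof (rule injI)
      fix i j assume "x0 + int (m * i + k) *s e = x0 + int (m * j + k) *s e"
      then have "(int (m * i + k) *s e) $ undefined = (int (m * j + k) *s e) $ undefined" by simp
      then show "i = j" using that by (simp add: e_def unit_vec_def)
    qed
    have "(\<Sum>i\<in>{1..J}. g i) = (\<Sum>x\<in>(\<lambda>i. x0 + int (2 * i) *s e) ` {1..J}. f x)"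
      using inj[of 2 0] by (subst sum.reindex) (auto simp: g_def inj_on_def)
    also have "\<dots> \<le> 1"
      using f f0 by (metis finite_sum_le_has_sum finite_atLeastAtMost finite_imageI subset_UNIV)
    finally have sum_g: "(\<Sum>i\<in>{1..J}. g i) \<le> 1" .
    have "\<exists>j\<in>{1..J}. g j \<le> 1 / J"
    proof (rule ccontr)
      assume "\<not> ?thesis"
      then have "(\<Sum>i\<in>{1..J}. 1 / real J) < (\<Sum>i\<in>{1..J}. g i)"
        using Jpos by (intro sum_strict_mono) (auto simp: not_le)
      then show False using sum_g Jpos by simp
    qed
    then obtain j where j: "1 \<le> j" "j \<le> J" "g j \<le> 1 / J" by auto
    have "1 / J \<le> a / 2" using J(1) a Jpos by (simp add: field_simps)
    then have "a / 2 \<le> g 0 - g j" using x0 j by (simp add: g_def)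
    also have "\<dots> = (\<Sum>i<j. g i - g (Suc i))"
      using sum_lessThan_telescope[of "\<lambda>i. - g i" j] by simp
    finally have "(a / 2)\<^sup>2 \<le> (\<Sum>i<j. 1 * (g i - g (Suc i)))\<^sup>2" using a by (intro power_mono) auto
    also have "\<dots> \<le> (\<Sum>i<j. 1\<^sup>2) * (\<Sum>i<j. (g i - g (Suc i))\<^sup>2)"
      by (rule Cauchy_Schwarz_ineq_sum)
    also have "\<dots> \<le> J * (\<Sum>i<j. (g i - g (Suc i))\<^sup>2)"
      using j by (intro mult_right_mono sum_nonneg) auto
    also have "(\<Sum>i<j. (g i - g (Suc i))\<^sup>2) =
        (\<Sum>x\<in>(\<lambda>i. x0 + int (2 * i + 1) *s e) ` {..<j}. (f (x + e) - f (x + (- e)))\<^sup>2)"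
    proof (subst sum.reindex)
      show "inj_on (\<lambda>i. x0 + int (2 * i + 1) *s e) {..<j}" using inj[of 2 1] by (auto simp: inj_on_def)
      have "x0 + int (2 * i + 1) *s e + e = x0 + int (2 * Suc i) *s e"
        "x0 + int (2 * i + 1) *s e + (- e) = x0 + int (2 * i) *s e" for i
        by (simp_all add: vec_eq_iff algebra_simps)
      then show "(\<Sum>i<j. (g i - g (Suc i))\<^sup>2) = sum ((\<lambda>x. (f (x + e) - f (x + (- e)))\<^sup>2) \<circ>
          (\<lambda>i. x0 + int (2 * i + 1) *s e)) {..<j}"
        by (simp only: g_def o_def) (simp only: power2_commute)
    qed
    also have "\<dots> \<le> D"
      using D by (metis (no_types, lifting) finite_sum_le_has_sum finite_imageI finite_lessThan subset_UNIV zero_le_power2)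
    finally have "(a / 2)\<^sup>2 \<le> J * D" using Jpos by simp
    also have "\<dots> \<le> 3 / a * D" using J3 D0 by (intro mult_right_mono)
    finally show ?thesis using a by (simp add: field_simps power2_eq_square power3_eq_cube)
  qed (use D0 in simp)
  then have "a ^ 3 / 12 / (2 * N) \<le> D / (2 * N)" using N by (intro divide_right_mono) auto
  with gap show ?thesis by (simp add: a_def N_def)
qed

text \<open>The energy is decreasing, so each of the \<open>n + 1\<close> averaging steps removes at
  least the amount \<open>c\<close> computed from the energy of \<open>heat n\<close>, while the
  initial energy is at most 1. A single squared value is at most the energy, which gives the sixth
  power.\<close>

lemma heat_pow_le:
  "heat n (x :: int ^ 'd::finite) ^ 6 \<le> 24 * real (card (unit_steps :: (int ^ 'd) set)) / (real n + 1)"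
proof -
  define N where "N = real (card (unit_steps :: (int ^ 'd) set))"
  define a where "a = (\<lambda>n. energy (heat n :: int ^ 'd \<Rightarrow> real))"
  have N: "N > 0" using card_unit_steps_pos[where 'd='d] by (simp add: N_def)
  have sq: "((\<lambda>x. (heat n x)\<^sup>2) has_sum a n) (UNIV :: (int ^ 'd) set)" for n
    unfolding a_def by (rule has_sum_square[OF heat_nonneg heat_le_1 has_sum_heat])
  have a0: "0 \<le> a n" for n by (rule has_sum_nonneg[OF sq]) simp
  have step: "a (Suc n) \<le> a n - a n ^ 3 / (24 * N)" for n
    unfolding a_def N_def heat_Suc
    by (rule energy_avg_le[of "heat n", OF heat_nonneg heat_le_1 has_sum_heat])
  have mono: "a (Suc n) \<le> a n" for n
    using step[of n] a0[of n] N by (smt (verit) divide_nonneg_nonneg zero_le_power)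
  have dec: "a n \<le> a m" if "m \<le> n" for m n by (rule lift_Suc_antimono_le[of a, OF mono that])
  define c where "c = a n ^ 3 / (24 * N)"
  have "a (Suc m) \<le> a 0 - real (Suc m) * c" if "m \<le> n" for m
    using that
  proof (induction m)
    case 0
    have "c \<le> a 0 ^ 3 / (24 * N)"
      using dec[of 0 n] a0 N unfolding c_def by (intro divide_right_mono power_mono) auto
    then show ?case using step[of 0] by simp
  next
    case (Suc m)
    have "c \<le> a (Suc m) ^ 3 / (24 * N)"
      using dec[of "Suc m" n] Suc.prems a0 N unfolding c_def by (intro divide_right_mono power_mono) auto
    then show ?case using step[of "Suc m"] Suc by (simp add: algebra_simps)
  qed
  from this[of n] have "real (Suc n) * c \<le> a 0" using a0[of "Suc n"] by simp
  also have "a 0 \<le> 1"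
  proof (rule has_sum_mono[OF sq has_sum_heat])
    show "(heat 0 x)\<^sup>2 \<le> heat 0 x" for x :: "int ^ 'd" by (simp add: heat_0)
  qed
  finally have "a n ^ 3 \<le> 24 * N / (real n + 1)" using N by (simp add: c_def field_simps)
  moreover have "(heat n x)\<^sup>2 \<le> a n"
    using finite_sum_le_has_sum[OF sq, of "{x}"] by simp
  then have "((heat n x)\<^sup>2) ^ 3 \<le> a n ^ 3" by (intro power_mono) simp_all
  ultimately show ?thesis by (simp add: N_def power_mult[symmetric])
qed

section \<open>Trajectories and smoothed trap densities\<close>

definition entry :: "'d trajectory \<Rightarrow> nat \<Rightarrow> nat" where
  "entry \<rho> t = (LEAST i. snd (\<rho> i) = t)"

text \<open>The upper bound follows the target only through these sites: their increments are
  bounded by the speed, and a trap at one of them already detects the target.\<close>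

definition entry_site :: "'d trajectory \<Rightarrow> nat \<Rightarrow> 'd site" where
  "entry_site \<rho> t = fst (\<rho> (entry \<rho> t))"

lemma l1_norm_nonneg: "0 \<le> l1_norm x"
  by (simp add: l1_norm_def sum_nonneg)

lemma l1_norm_zero_iff: "l1_norm x = 0 \<longleftrightarrow> x = 0"
  by (simp add: l1_norm_def sum_nonneg_eq_0_iff vec_eq_iff)

lemma l1_norm_0 [simp]: "l1_norm 0 = 0"
  by (simp add: l1_norm_zero_iff)

lemma l1_norm_triangle: "l1_norm (x + y) \<le> l1_norm x + l1_norm y"
  unfolding l1_norm_def sum.distrib[symmetric] by (intro sum_mono) (simp add: abs_triangle_ineq)

lemma escape_trajectory_step:
  assumes "escape_trajectory \<rho>"
  shows "snd (\<rho> k) \<le> snd (\<rho> (Suc k))"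
    and "snd (\<rho> (Suc k)) \<le> Suc (snd (\<rho> k))"
    and "l1_norm (fst (\<rho> (Suc k)) - fst (\<rho> k)) \<le> 1"
    and "snd (\<rho> (Suc k)) = Suc (snd (\<rho> k)) \<Longrightarrow> fst (\<rho> (Suc k)) = fst (\<rho> k)"
proof -
  have d: "l1_norm (fst (\<rho> (Suc k)) - fst (\<rho> k)) + \<bar>int (snd (\<rho> (Suc k))) - int (snd (\<rho> k))\<bar> = 1"
    using assms by (simp add: escape_trajectory_def l1_dist_def)
  note n = l1_norm_nonneg[of "fst (\<rho> (Suc k)) - fst (\<rho> k)"]
  show "snd (\<rho> k) \<le> snd (\<rho> (Suc k))" using assms by (auto simp: escape_trajectory_def mono_def)
  show "snd (\<rho> (Suc k)) \<le> Suc (snd (\<rho> k))" using d n by linarith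
  show "l1_norm (fst (\<rho> (Suc k)) - fst (\<rho> k)) \<le> 1" using d by linarith
  show "fst (\<rho> (Suc k)) = fst (\<rho> k)" if "snd (\<rho> (Suc k)) = Suc (snd (\<rho> k))"
  proof -
    have "l1_norm (fst (\<rho> (Suc k)) - fst (\<rho> k)) = 0" using d n that by simp
    then show ?thesis by (simp add: l1_norm_zero_iff)
  qed
qed

lemma escape_trajectory_mono: "escape_trajectory \<rho> \<Longrightarrow> i \<le> j \<Longrightarrow> snd (\<rho> i) \<le> snd (\<rho> j)"
  by (auto simp: escape_trajectory_def mono_def)

lemma escape_trajectory_ex_time:
  assumes "escape_trajectory \<rho>"
  shows "\<exists>i. snd (\<rho> i) = t"
proof -
  have "\<exists>i. t \<le> snd (\<rho> i)"
    using assms unfolding escape_trajectory_def filterlim_at_top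
    by (metis eventually_happens' sequentially_bot)
  define k where "k = (LEAST i. t \<le> snd (\<rho> i))"
  have k: "t \<le> snd (\<rho> k)" unfolding k_def using \<open>\<exists>i. t \<le> snd (\<rho> i)\<close> by (rule LeastI_ex)
  have "snd (\<rho> k) = t"
  proof (cases k)
    case 0
    then show ?thesis using k assms by (simp add: escape_trajectory_def)
  next
    case (Suc j)
    then have "snd (\<rho> j) < t" using not_less_Least[of j "\<lambda>i. t \<le> snd (\<rho> i)"] by (simp add: k_def)
    then show ?thesis using k escape_trajectory_step(2)[OF assms, of j] Suc by simp
  qed
  then show ?thesis by blast
qed

lemma entry_time: "escape_trajectory \<rho> \<Longrightarrow> snd (\<rho> (entry \<rho> t)) = t"
  unfolding entry_def by (rule LeastI_ex) (rule escape_trajectory_ex_time)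

lemma finite_time_indices:
  assumes "escape_trajectory \<rho>"
  shows "finite {i. snd (\<rho> i) = t}"
proof (rule finite_subset)
  show "{i. snd (\<rho> i) = t} \<subseteq> {..entry \<rho> (Suc t)}"
  proof
    fix i assume "i \<in> {i. snd (\<rho> i) = t}"
    then have "\<not> entry \<rho> (Suc t) \<le> i"
      using escape_trajectory_mono[OF assms, of "entry \<rho> (Suc t)" i] entry_time[OF assms, of "Suc t"] by auto
    then show "i \<in> {..entry \<rho> (Suc t)}" by simp
  qed
qed simp

lemma l1_norm_displacement:
  assumes "escape_trajectory \<rho>"
  shows "l1_norm (fst (\<rho> (i + n)) - fst (\<rho> i)) \<le> int n"
proof (induction n)
  case (Suc n)
  have "fst (\<rho> (i + Suc n)) - fst (\<rho> i) =
    (fst (\<rho> (Suc (i + n))) - fst (\<rho> (i + n))) + (fst (\<rho> (i + n)) - fst (\<rho> i))" by simp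
  then have "l1_norm (fst (\<rho> (i + Suc n)) - fst (\<rho> i)) \<le>
    l1_norm (fst (\<rho> (Suc (i + n))) - fst (\<rho> (i + n))) + l1_norm (fst (\<rho> (i + n)) - fst (\<rho> i))"
    by (metis l1_norm_triangle)
  then show ?case using Suc escape_trajectory_step(3)[OF assms, of "i + n"] by simp
qed simp

text \<open>The step that advances time does not move the site, so time \<open>Suc t\<close> is
  entered at the last site visited at time \<open>t\<close>.\<close>

lemma entry_displacement_le_speed:
  assumes \<rho>: "escape_trajectory \<rho>"
  shows "l1_norm (entry_site \<rho> (Suc t) - entry_site \<rho> t) \<le> int (speed \<rho> t)"
proof -
  let ?S = "{i. snd (\<rho> i) = t}"
  define j where "j = Max ?S"
  have S: "finite ?S" "?S \<noteq> {}"
    using finite_time_indices[OF \<rho>] escape_trajectory_ex_time[OF \<rho>] by auto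
  have j: "snd (\<rho> j) = t" using Max_in[OF S] by (simp add: j_def)
  have min: "Min ?S = entry \<rho> t" unfolding entry_def by (rule Least_Min[OF S(1), symmetric]) (use S in auto)
  have le: "entry \<rho> t \<le> j" using j by (simp add: entry_def Least_le)
  have "snd (\<rho> (Suc j)) \<noteq> t" using Max_ge[OF S(1), of "Suc j"] unfolding j_def by auto
  then have Sj: "snd (\<rho> (Suc j)) = Suc t" using escape_trajectory_step(1,2)[OF \<rho>, of j] j by simp
  have "entry \<rho> (Suc t) = Suc j" unfolding entry_def
  proof (rule Least_equality[where P = "\<lambda>i. snd (\<rho> i) = Suc t", OF Sj])
    fix i assume "snd (\<rho> i) = Suc t"
    then show "Suc j \<le> i" using escape_trajectory_mono[OF \<rho>, of i j] j by (auto simp: not_less_eq_eq[symmetric])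
  qed
  then have "entry_site \<rho> (Suc t) = fst (\<rho> j)"
    using escape_trajectory_step(4)[OF \<rho>, of j] j Sj by (simp add: entry_site_def)
  then show ?thesis
    using l1_norm_displacement[OF \<rho>, of "entry \<rho> t" "j - entry \<rho> t"] le
    by (simp add: entry_site_def speed_def min j_def[symmetric])
qed

section \<open>Adaptedness as pointwise dependence on the past\<close>

definition agree :: "nat \<Rightarrow> 'd::finite env \<Rightarrow> 'd env \<Rightarrow> bool" where
  "agree t \<xi> \<xi>' \<longleftrightarrow> (\<forall>x s. s \<le> t \<longrightarrow> \<xi> (x, s) = \<xi>' (x, s))"

lemma agree_sym: "agree t \<xi> \<xi>' \<Longrightarrow> agree t \<xi>' \<xi>"
  by (simp add: agree_def)

lemma agree_mono: "agree t \<xi> \<xi>' \<Longrightarrow> s \<le> t \<Longrightarrow> agree s \<xi> \<xi>'"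
  by (simp add: agree_def)

text \<open>True for the generators and inherited by complements and countable unions; this is how
  membership in the filtration becomes usable pointwise.\<close>

lemma env_filtration_agree:
  assumes "A \<in> sets (env_filtration t)" "agree t \<xi> \<xi>'"
  shows "\<xi> \<in> A \<longleftrightarrow> \<xi>' \<in> A"
proof -
  have "A \<in> sigma_sets UNIV {{\<xi>. \<xi> (x, s) \<in> B} | x s B. s \<le> t}"
    using assms(1) by (simp add: env_filtration_def sets_measure_of)
  then show ?thesis
    by induction (use assms(2) in \<open>auto simp: agree_def\<close>)
qed

text \<open>The event that step \<open>k\<close> is at the particular point \<open>(x, s)\<close>
  lies in the filtration at \<open>s \<le> t\<close>, so it contains \<open>\<xi>'\<close> along
  with \<open>\<xi>\<close>.\<close>

lemma adapted_agree:
  assumes "adapted \<rho>" "agree t \<xi> \<xi>'" "snd (\<rho> \<xi> k) \<le> t"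
  shows "\<rho> \<xi>' k = \<rho> \<xi> k"
proof -
  obtain x s where p: "\<rho> \<xi> k = (x, s)" by (cases "\<rho> \<xi> k")
  then have "{\<xi>. \<rho> \<xi> k = (x, s)} \<in> sets (env_filtration s)" "s \<le> t"
    using assms by (auto simp: adapted_def)
  from env_filtration_agree[OF this(1) agree_mono[OF assms(2) this(2)]] p show ?thesis by simp
qed

lemma adapted_agree_time:
  assumes "adapted \<rho>" "agree t \<xi> \<xi>'" "s \<le> t"
  shows "snd (\<rho> \<xi> k) = s \<longleftrightarrow> snd (\<rho> \<xi>' k) = s"
  using adapted_agree[OF assms(1,2), of k] adapted_agree[OF assms(1) agree_sym[OF assms(2)], of k] assms(3)
  by auto

lemma entry_site_agree:
  assumes "escape_strategy \<rho>" "adapted \<rho>" "agree t \<xi> \<xi>'"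
  shows "entry_site (\<rho> \<xi>) t = entry_site (\<rho> \<xi>') t"
proof -
  have e: "entry (\<rho> \<xi>) t = entry (\<rho> \<xi>') t"
    unfolding entry_def using adapted_agree_time[OF assms(2,3) order.refl] by simp
  have "snd (\<rho> \<xi> (entry (\<rho> \<xi>) t)) = t"
    using assms(1) by (intro entry_time) (simp add: escape_strategy_def)
  then show ?thesis
    using adapted_agree[OF assms(2,3), of "entry (\<rho> \<xi>) t"] by (simp add: entry_site_def e)
qed

definition undetected_until :: "'d strategy \<Rightarrow> nat \<Rightarrow> 'd env set" where
  "undetected_until \<rho> t = {\<xi>. \<forall>k. snd (\<rho> \<xi> k) \<le> t \<longrightarrow> \<not> \<xi> (\<rho> \<xi> k)}"

lemma undetected_until_agree:
  assumes "adapted \<rho>" "agree t \<xi> \<xi>'" "\<xi> \<in> undetected_until \<rho> t"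
  shows "\<xi>' \<in> undetected_until \<rho> t"
  unfolding undetected_until_def
proof (intro CollectI allI impI)
  fix k assume k: "snd (\<rho> \<xi>' k) \<le> t"
  have eq: "\<rho> \<xi> k = \<rho> \<xi>' k" by (rule adapted_agree[OF assms(1) agree_sym[OF assms(2)] k])
  have "\<forall>k. snd (\<rho> \<xi> k) \<le> t \<longrightarrow> \<not> \<xi> (\<rho> \<xi> k)" using assms(3) by (simp add: undetected_until_def)
  then have "\<not> \<xi> (\<rho> \<xi> k)" using k eq by metis
  then show "\<not> \<xi>' (\<rho> \<xi>' k)" using assms(2) k eq by (cases "\<rho> \<xi>' k") (auto simp: agree_def)
qed

lemma environment_agree:
  assumes "\<forall>l n. n < t \<longrightarrow> Z (l, n) = Z' (l, n)"
  shows "agree t (environment (N, Z)) (environment (N, Z'))"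
proof -
  have "trap_position (N, Z) l s = trap_position (N, Z') l s" if "s \<le> t" for l s
    by (rule trap_position_cong) (use assms that in \<open>meson less_le_trans\<close>)
  then show ?thesis by (auto simp: agree_def environment_def)
qed

lemma past_dependent_environment:
  assumes "\<And>\<xi> \<xi>'. agree t \<xi> \<xi>' \<Longrightarrow> h \<xi> = h \<xi>'"
  shows "past_dependent t (\<lambda>\<omega>. h (environment \<omega>))"
  unfolding past_dependent_def
proof (intro allI impI assms)
  fix N :: "'a site \<Rightarrow> nat" and Z Z' :: "('a site \<times> nat) \<times> nat \<Rightarrow> 'a site"
  assume "\<forall>l n. n < t \<longrightarrow> Z (l, n) = Z' (l, n)"
  then show "agree t (environment (N, Z)) (environment (N, Z'))" by (rule environment_agree)
qed

lemma space_env_space [simp]: "space env_space = UNIV"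
  by (simp add: env_space_def space_PiM)

lemma adapted_measurable:
  fixes \<rho> :: "'d::finite strategy"
  assumes "adapted \<rho>"
  shows "(\<lambda>\<xi>. \<rho> \<xi> k) \<in> env_space \<rightarrow>\<^sub>M count_space UNIV"
proof (rule measurable_count_space_eq2_countable[THEN iffD2], safe)
  fix x :: "'d site" and t
  have "{\<xi>. \<rho> \<xi> k = (x, t)} \<in> sets env_space"
    using assms sets_env_filtration_subset[of t] by (auto simp: adapted_def)
  then show "(\<lambda>\<xi>. \<rho> \<xi> k) -` {(x, t)} \<inter> space env_space \<in> sets env_space"
    by (simp add: vimage_def)
qed auto

lemma measurable_env_at [measurable]: "Measurable.pred env_space (\<lambda>\<xi>. \<xi> p)"
  unfolding env_space_def by (rule measurable_component_singleton) simp

lemma undetected_until_measurable: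
  assumes "adapted \<rho>"
  shows "undetected_until \<rho> t \<in> sets env_space"
proof -
  note [measurable] = adapted_measurable[OF assms]
  have "undetected_until \<rho> t = {\<xi>\<in>space env_space. \<forall>k p. \<rho> \<xi> k = p \<longrightarrow> snd p \<le> t \<longrightarrow> \<not> \<xi> p}"
    by (auto simp: undetected_until_def)
  also have "\<dots> \<in> sets env_space" by measurable
  finally show ?thesis .
qed

lemma entry_site_measurable:
  assumes "adapted \<rho>"
  shows "(\<lambda>\<xi>. entry_site (\<rho> \<xi>) t) \<in> env_space \<rightarrow>\<^sub>M count_space UNIV"
proof -
  note [measurable] = adapted_measurable[OF assms]
  have "(\<lambda>\<xi>. entry (\<rho> \<xi>) t) \<in> env_space \<rightarrow>\<^sub>M count_space UNIV" unfolding entry_def by measurable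
  then have "(\<lambda>\<xi>. \<rho> \<xi> (entry (\<rho> \<xi>) t)) \<in> env_space \<rightarrow>\<^sub>M count_space UNIV"
    by (rule measurable_compose_countable[rotated]) measurable
  then show ?thesis unfolding entry_site_def by (rule measurable_compose) simp
qed

section \<open>Balls of sites and lower tails of the smoothed density\<close>

definition site_ball :: "'d::finite site \<Rightarrow> real \<Rightarrow> 'd site set" where
  "site_ball y r = {z. real_of_int (l1_norm (z - y)) \<le> r}"

lemma box_bound:
  fixes c :: "int ^ 'd::finite"
  shows "finite {z. \<forall>k. \<bar>z $ k - c $ k\<bar> \<le> r}"
    and "card {z. \<forall>k. \<bar>z $ k - c $ k\<bar> \<le> r} \<le> nat (2 * r + 1) ^ CARD('d)"
proof -
  let ?B = "{z. \<forall>k. \<bar>z $ k - c $ k\<bar> \<le> r}" and ?P = "\<Pi>\<^sub>E k\<in>UNIV. {c $ k - r..c $ k + r}"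
  have sub: "?B \<subseteq> vec_lambda ` ?P"
  proof
    fix z assume z: "z \<in> ?B"
    have "vec_nth z \<in> ?P"
    proof (rule PiE_I)
      show "z $ k \<in> {c $ k - r..c $ k + r}" for k
        using z[THEN CollectD, rule_format, of k] by (simp add: abs_le_iff)
    qed simp
    then have "vec_lambda (vec_nth z) \<in> vec_lambda ` ?P" by (rule imageI)
    then show "z \<in> vec_lambda ` ?P" by (simp only: vec_nth_inverse)
  qed
  have fin: "finite ?P" by (intro finite_PiE) auto
  show "finite ?B" using sub fin by (meson finite_imageI finite_subset)
  have "card ?B \<le> card ?P" using sub fin by (meson card_image_le card_mono finite_imageI le_trans)
  also have "card ?P = nat (2 * r + 1) ^ CARD('d)" by (simp add: card_PiE algebra_simps)
  finally show "card ?B \<le> nat (2 * r + 1) ^ CARD('d)" .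
qed

lemma l1_norm_component_le: "\<bar>x $ k\<bar> \<le> l1_norm x"
  using member_le_sum[of k UNIV "\<lambda>k. \<bar>x $ k\<bar>"] by (simp add: l1_norm_def)

lemma site_ball_bound:
  fixes y :: "'d::finite site"
  assumes r: "0 \<le> r"
  shows "finite (site_ball y r)" and "real (card (site_ball y r)) \<le> (2 * r + 1) ^ CARD('d)"
proof -
  let ?B = "{z. \<forall>k. \<bar>z $ k - y $ k\<bar> \<le> \<lfloor>r\<rfloor>}"
  have sub: "site_ball y r \<subseteq> ?B"
  proof (intro subsetI CollectI allI)
    fix z k assume z: "z \<in> site_ball y r"
    have "\<bar>z $ k - y $ k\<bar> \<le> l1_norm (z - y)" using l1_norm_component_le[of "z - y" k] by simp
    then have "real_of_int \<bar>z $ k - y $ k\<bar> \<le> r" using z unfolding site_ball_def by simp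
    then show "\<bar>z $ k - y $ k\<bar> \<le> \<lfloor>r\<rfloor>" by (simp add: le_floor_iff)
  qed
  show "finite (site_ball y r)" using sub box_bound(1) by (rule finite_subset)
  have "card (site_ball y r) \<le> nat (2 * \<lfloor>r\<rfloor> + 1) ^ CARD('d)"
    using card_mono[OF box_bound(1) sub] box_bound(2) by (rule order_trans)
  then have "real (card (site_ball y r)) \<le> real (nat (2 * \<lfloor>r\<rfloor> + 1)) ^ CARD('d)"
    unfolding of_nat_power[symmetric] of_nat_le_iff .
  also have "\<dots> \<le> (2 * r + 1) ^ CARD('d)"
  proof (rule power_mono)
    have "real (nat (2 * \<lfloor>r\<rfloor> + 1)) = 2 * real_of_int \<lfloor>r\<rfloor> + 1" using r by simp
    then show "real (nat (2 * \<lfloor>r\<rfloor> + 1)) \<le> 2 * r + 1" by (simp add: of_int_floor_le)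
  qed simp
  finally show "real (card (site_ball y r)) \<le> (2 * r + 1) ^ CARD('d)" .
qed

text \<open>The expected number of traps at \<open>z\<close> at time \<open>t + r\<close>, given the traps at time \<open>t\<close>.\<close>

definition smoothed :: "'d::finite site set \<Rightarrow> nat \<Rightarrow> nat \<Rightarrow> 'd site \<Rightarrow> 'd traps \<Rightarrow> real" where
  "smoothed Y t r z \<omega> = (\<Sum>y\<in>Y. \<Sum>i<fst \<omega> y. heat r (trap_position \<omega> (y, i) t - z))"

lemma trap_product_exp:
  "finite Y \<Longrightarrow> trap_product Y (\<lambda>x. exp (c * heat r (x - z))) t \<omega> = exp (c * smoothed Y t r z \<omega>)"
  by (simp add: trap_product_def smoothed_def sum_distrib_left exp_sum)

lemma exp_minus_le_quadratic:
  assumes "0 \<le> (v::real)"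
  shows "exp (- v) \<le> 1 - v + v\<^sup>2 / 2"
proof -
  have pos: "0 < 1 + v + v\<^sup>2 / 2" using assms by (simp add: add_pos_nonneg)
  have "exp (- v) = 1 / exp v" by (simp add: exp_minus inverse_eq_divide)
  also have "\<dots> \<le> 1 / (1 + v + v\<^sup>2 / 2)"
    using exp_lower_Taylor_quadratic[OF assms] pos by (intro divide_left_mono) auto
  also have "\<dots> \<le> 1 - v + v\<^sup>2 / 2"
  proof -
    have "(1 - v + v\<^sup>2 / 2) * (1 + v + v\<^sup>2 / 2) = 1 + v ^ 4 / 4"
      by (simp add: power2_eq_square power4_eq_xxxx field_simps)
    moreover have "0 \<le> v ^ 4" by simp
    ultimately show ?thesis using pos by (subst pos_divide_le_eq) auto
  qed
  finally show ?thesis .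
qed

text \<open>The exponential is replaced by a bound affine in the heat kernel, because affine
  expressions pass through \<open>avg ^^ n\<close>; the bound \<open>m\<close> turns the square in
  the expansion into a linear term.\<close>

lemma avg_pow_exp_heat_le:
  fixes z :: "'d::finite site"
  assumes \<theta>: "0 \<le> \<theta>" and m: "\<And>x :: 'd site. heat r x \<le> m"
  shows "(avg ^^ n) (\<lambda>x. exp (- \<theta> * heat r (x - z))) x \<le>
    1 - \<theta> * (1 - \<theta> * m / 2) * heat (n + r) (x - z)"
proof -
  have "exp (- \<theta> * heat r (x - z)) \<le> 1 + (- (\<theta> * (1 - \<theta> * m / 2))) * heat r (x - z)" for x
  proof -
    define h where "h = heat r (x - z)"
    have h: "0 \<le> h" "h \<le> m" unfolding h_def by (rule heat_nonneg, rule m)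
    have "exp (- (\<theta> * h)) \<le> 1 - \<theta> * h + (\<theta> * h)\<^sup>2 / 2"
      using \<theta> h by (intro exp_minus_le_quadratic) simp
    also have "(\<theta> * h)\<^sup>2 = \<theta>\<^sup>2 * (h * h)" by (simp add: power2_eq_square)
    also have "\<dots> \<le> \<theta>\<^sup>2 * (m * h)" using h by (intro mult_left_mono mult_right_mono) auto
    finally show ?thesis unfolding h_def[symmetric] by (simp add: power2_eq_square algebra_simps)
  qed
  then have "(avg ^^ n) (\<lambda>x. exp (- \<theta> * heat r (x - z))) x \<le>
      (avg ^^ n) (\<lambda>x. 1 + (- (\<theta> * (1 - \<theta> * m / 2))) * heat r (x - z)) x"
    by (rule avg_pow_mono)
  also have "\<dots> = 1 - \<theta> * (1 - \<theta> * m / 2) * heat (n + r) (x - z)"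
    unfolding avg_pow_affine heat_add by simp
  finally show ?thesis .
qed

lemma trap_product_mono:
  assumes "\<And>x. 0 \<le> f x" "\<And>x. f x \<le> g x"
  shows "trap_product Y f t \<omega> \<le> trap_product Y g t \<omega>"
  unfolding trap_product_def by (intro prod_mono conjI prod_nonneg ballI assms)

lemma measurable_smoothed [measurable]:
  "smoothed Y t r z \<in> borel_measurable (trap_measure u)"
proof -
  have "(\<lambda>\<omega>. \<Sum>i<fst \<omega> y. heat r (trap_position \<omega> (y, i) t - z)) \<in> borel_measurable (trap_measure u)" for y
  proof (rule measurable_compose_countable[where f = "\<lambda>n \<omega>. \<Sum>i<n. heat r (trap_position \<omega> (y, i) t - z)"])
    show "(\<lambda>\<omega>. \<Sum>i<n. heat r (trap_position \<omega> (y, i) t - z)) \<in> borel_measurable (trap_measure u)" for n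
      by (intro borel_measurable_sum measurable_compose[OF measurable_trap_position]) simp
  qed measurable
  then show ?thesis unfolding smoothed_def by (intro borel_measurable_sum)
qed

lemma past_dependent_smoothed: "past_dependent t (smoothed Y t r (z :: 'd::finite site))"
  unfolding past_dependent_def
proof (intro allI impI)
  fix N :: "'d site \<Rightarrow> nat" and Z Z' :: "('d site \<times> nat) \<times> nat \<Rightarrow> 'd site"
  assume *: "\<forall>l n. n < t \<longrightarrow> Z (l, n) = Z' (l, n)"
  have "trap_position (N, Z) l t = trap_position (N, Z') l t" for l
    by (rule trap_position_cong) (use * in blast)
  then show "smoothed Y t r z (N, Z) = smoothed Y t r z (N, Z')" by (simp add: smoothed_def)
qed

text \<open>The exponential Markov inequality, restricted to an event \<open>H\<close> so that
  information on the past can be carried along.\<close>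

lemma emeasure_smoothed_less_le:
  assumes Y: "finite Y" and \<theta>: "0 \<le> \<theta>" and H [measurable]: "H \<in> sets (trap_measure u)"
  shows "emeasure (trap_measure u) {\<omega>\<in>H. smoothed Y t r z \<omega> < a} \<le> ennreal (exp (\<theta> * a)) *
    (\<integral>\<^sup>+ \<omega>. indicator H \<omega> * ennreal (trap_product Y (\<lambda>x. exp (- \<theta> * heat r (x - z))) t \<omega>) \<partial>trap_measure u)"
proof -
  let ?M = "trap_measure u :: 'a traps measure" and ?f = "\<lambda>x. exp (- \<theta> * heat r (x - z))"
  have [measurable]: "trap_product Y ?f t \<in> borel_measurable ?M" by (rule measurable_trap_product[OF Y])
  have "{\<omega>\<in>H. smoothed Y t r z \<omega> < a} = {\<omega>\<in>space ?M. \<omega> \<in> H \<and> smoothed Y t r z \<omega> < a}" by simp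
  also have "\<dots> \<in> sets ?M" by measurable
  finally have "emeasure ?M {\<omega>\<in>H. smoothed Y t r z \<omega> < a} = (\<integral>\<^sup>+ \<omega>. indicator {\<omega>\<in>H. smoothed Y t r z \<omega> < a} \<omega> \<partial>?M)"
    by (rule nn_integral_indicator[symmetric])
  also have "\<dots> \<le> (\<integral>\<^sup>+ \<omega>. ennreal (exp (\<theta> * a)) * (indicator H \<omega> * ennreal (trap_product Y ?f t \<omega>)) \<partial>?M)"
  proof (rule nn_integral_mono)
    fix \<omega>
    have "1 \<le> exp (\<theta> * a + - \<theta> * smoothed Y t r z \<omega>)" if "smoothed Y t r z \<omega> < a"
      using that \<theta> by (simp add: mult_left_mono)
    then show "indicator {\<omega>\<in>H. smoothed Y t r z \<omega> < a} \<omega> \<le>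
      ennreal (exp (\<theta> * a)) * (indicator H \<omega> * ennreal (trap_product Y ?f t \<omega>))"
      unfolding trap_product_exp[OF Y] exp_add
      by (auto simp: indicator_def ennreal_mult[symmetric] split: if_splits)
  qed
  also have "\<dots> = ennreal (exp (\<theta> * a)) * (\<integral>\<^sup>+ \<omega>. indicator H \<omega> * ennreal (trap_product Y ?f t \<omega>) \<partial>?M)"
    by (intro nn_integral_cmult) measurable
  finally show ?thesis .
qed

text \<open>The Chernoff bound for one scale. Averaging over \<open>n\<close> steps turns the
  density at time \<open>t + n\<close> with horizon \<open>r\<close> into the density at time
  \<open>t\<close> with horizon \<open>n + r\<close>, at the price of the factor
  \<open>1 - \<theta> * m / 2\<close> from the quadratic term. As \<open>H\<close> is an arbitrary
  past event, this is a bound given the past.\<close>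

lemma smoothed_drop:
  fixes z :: "'d::finite site"
  assumes Y: "finite Y" and \<theta>: "0 \<le> \<theta>" "\<theta> * m \<le> 2" and m: "\<And>x :: 'd site. heat r x \<le> m"
    and H: "H \<in> sets (trap_measure u)" "past_dependent t (\<lambda>\<omega>. \<omega> \<in> H)"
  shows "emeasure (trap_measure u) {\<omega>\<in>H. a \<le> smoothed Y t (n + r) z \<omega> \<and> smoothed Y (t + n) r z \<omega> < a'}
    \<le> ennreal (exp (\<theta> * a' - \<theta> * (1 - \<theta> * m / 2) * a)) * emeasure (trap_measure u) H"
proof -
  let ?M = "trap_measure u :: 'd traps measure"
  let ?f = "\<lambda>x. exp (- \<theta> * heat r (x - z))"
  define \<kappa> where "\<kappa> = \<theta> * (1 - \<theta> * m / 2)"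
  have \<kappa>: "0 \<le> \<kappa>" using \<theta> by (simp add: \<kappa>_def)
  define H' where "H' = {\<omega>\<in>H. a \<le> smoothed Y t (n + r) z \<omega>}"
  have [measurable]: "H \<in> sets ?M" by (rule H)
  have "H' = {\<omega>\<in>space ?M. \<omega> \<in> H \<and> a \<le> smoothed Y t (n + r) z \<omega>}" by (simp add: H'_def)
  then have [measurable]: "H' \<in> sets ?M" by simp
  have dep: "past_dependent t (\<lambda>\<omega>. indicator H' \<omega> :: ennreal)"
    unfolding past_dependent_def
  proof (intro allI impI)
    fix N :: "'d site \<Rightarrow> nat" and Z Z' :: "('d site \<times> nat) \<times> nat \<Rightarrow> 'd site"
    assume *: "\<forall>l n. n < t \<longrightarrow> Z (l, n) = Z' (l, n)"
    have "(N, Z) \<in> H \<longleftrightarrow> (N, Z') \<in> H" "smoothed Y t (n + r) z (N, Z) = smoothed Y t (n + r) z (N, Z')"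
      using H(2) past_dependent_smoothed[of t Y "n + r" z] * unfolding past_dependent_def by blast+
    then show "indicator H' (N, Z) = (indicator H' (N, Z') :: ennreal)" by (simp add: H'_def indicator_def)
  qed
  \<comment> \<open>Going back from the affine bound to an exponential makes the product a function
    of the smoothed density again.\<close>
  have le: "(avg ^^ n) ?f x \<le> exp (- \<kappa> * heat (n + r) (x - z))" for x
    using avg_pow_exp_heat_le[OF \<theta>(1) m, of n z x] exp_ge_add_one_self[of "- \<kappa> * heat (n + r) (x - z)"]
    by (simp add: \<kappa>_def)
  have "{\<omega>\<in>H. a \<le> smoothed Y t (n + r) z \<omega> \<and> smoothed Y (t + n) r z \<omega> < a'} = {\<omega>\<in>H'. smoothed Y (t + n) r z \<omega> < a'}"
    by (auto simp: H'_def)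
  also have "emeasure ?M \<dots> \<le> ennreal (exp (\<theta> * a')) * (\<integral>\<^sup>+ \<omega>. indicator H' \<omega> * ennreal (trap_product Y ?f (t + n) \<omega>) \<partial>?M)"
    by (rule emeasure_smoothed_less_le[OF Y \<theta>(1)]) measurable
  also have "(\<integral>\<^sup>+ \<omega>. indicator H' \<omega> * ennreal (trap_product Y ?f (t + n) \<omega>) \<partial>?M) =
      (\<integral>\<^sup>+ \<omega>. indicator H' \<omega> * ennreal (trap_product Y ((avg ^^ n) ?f) t \<omega>) \<partial>?M)"
    by (rule trap_product_markov_pow[OF Y _ _ dep]) auto
  also have "\<dots> \<le> (\<integral>\<^sup>+ \<omega>. ennreal (exp (- \<kappa> * a)) * indicator H \<omega> \<partial>?M)"
  proof (rule nn_integral_mono)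
    fix \<omega>
    have "trap_product Y ((avg ^^ n) ?f) t \<omega> \<le> trap_product Y (\<lambda>x. exp (- \<kappa> * heat (n + r) (x - z))) t \<omega>"
      by (rule trap_product_mono[OF avg_pow_nonneg le]) simp
    also have "\<dots> = exp (- \<kappa> * smoothed Y t (n + r) z \<omega>)" by (rule trap_product_exp[OF Y])
    finally have *: "trap_product Y ((avg ^^ n) ?f) t \<omega> \<le> exp (- \<kappa> * smoothed Y t (n + r) z \<omega>)" .
    show "indicator H' \<omega> * ennreal (trap_product Y ((avg ^^ n) ?f) t \<omega>) \<le> ennreal (exp (- \<kappa> * a)) * indicator H \<omega>"
    proof (cases "\<omega> \<in> H'")
      case True
      then have "exp (- \<kappa> * smoothed Y t (n + r) z \<omega>) \<le> exp (- \<kappa> * a)"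
        using \<kappa> by (simp add: H'_def mult_left_mono)
      then have "ennreal (trap_product Y ((avg ^^ n) ?f) t \<omega>) \<le> ennreal (exp (- \<kappa> * a))"
        using * by (intro ennreal_leI) (rule order.trans)
      then show ?thesis using True by (simp add: H'_def)
    qed simp
  qed
  also have "\<dots> = ennreal (exp (- \<kappa> * a)) * emeasure ?M H"
    by (simp add: nn_integral_cmult)
  finally show ?thesis
    by (simp add: \<kappa>_def[symmetric] mult.assoc[symmetric] ennreal_mult[symmetric] exp_add[symmetric] mult_left_mono)
qed

text \<open>The counterpart of \<open>smoothed_drop\<close> for an interval that begins at time 0:
  the Poisson Laplace functional replaces the comparison with an earlier density.\<close>

lemma smoothed_low:
  fixes z :: "'d::finite site"
  assumes Y: "finite Y" and \<theta>: "0 \<le> \<theta>" and m: "\<And>x :: 'd site. heat r x \<le> m" and u: "0 \<le> u"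
  shows "emeasure (trap_measure u) {\<omega>. smoothed Y t r z \<omega> < a'} \<le>
    ennreal (exp (\<theta> * a' - \<theta> * (1 - \<theta> * m / 2) * (u * (\<Sum>y\<in>Y. heat (t + r) (y - z)))))"
proof -
  let ?M = "trap_measure u :: 'd traps measure"
  let ?f = "\<lambda>x. exp (- \<theta> * heat r (x - z))"
  define \<kappa> where "\<kappa> = \<theta> * (1 - \<theta> * m / 2)"
  have "UNIV \<in> sets ?M" using sets.top[of ?M] by simp
  from emeasure_smoothed_less_le[OF Y \<theta> this, of t r z a']
  have "emeasure ?M {\<omega>. smoothed Y t r z \<omega> < a'} \<le>
      ennreal (exp (\<theta> * a')) * (\<integral>\<^sup>+ \<omega>. ennreal (trap_product Y ?f t \<omega>) \<partial>?M)" by simp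
  also have "\<dots> = ennreal (exp (\<theta> * a')) * ennreal (exp (u * (\<Sum>y\<in>Y. (avg ^^ t) ?f y - 1)))"
    by (subst trap_product_laplace[OF Y _ u]) auto
  also have "\<dots> = ennreal (exp (\<theta> * a' + u * (\<Sum>y\<in>Y. (avg ^^ t) ?f y - 1)))"
    by (simp add: ennreal_mult[symmetric] exp_add)
  also have "\<dots> \<le> ennreal (exp (\<theta> * a' - \<kappa> * (u * (\<Sum>y\<in>Y. heat (t + r) (y - z)))))"
  proof -
    have "(\<Sum>y\<in>Y. (avg ^^ t) ?f y - 1) \<le> (\<Sum>y\<in>Y. - \<kappa> * heat (t + r) (y - z))"
    proof (rule sum_mono)
      show "(avg ^^ t) ?f y - 1 \<le> - \<kappa> * heat (t + r) (y - z)" for y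
        using avg_pow_exp_heat_le[OF \<theta> m, of t z y] by (simp add: \<kappa>_def)
    qed
    then have "u * (\<Sum>y\<in>Y. (avg ^^ t) ?f y - 1) \<le> u * (- \<kappa> * (\<Sum>y\<in>Y. heat (t + r) (y - z)))"
      using u by (intro mult_left_mono) (auto simp: sum_distrib_left)
    then show ?thesis by (intro ennreal_leI) (simp add: mult_ac)
  qed
  finally show ?thesis unfolding \<kappa>_def .
qed

section \<open>No escape at high intensity\<close>

lemma past_dependent_comp2:
  assumes "past_dependent t f" "past_dependent t g"
  shows "past_dependent t (\<lambda>\<omega>. h (f \<omega>) (g \<omega>))"
  unfolding past_dependent_def
proof (intro allI impI)
  fix N :: "'a site \<Rightarrow> nat" and Z Z' :: "('a site \<times> nat) \<times> nat \<Rightarrow> 'a site"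
  assume *: "\<forall>l n. n < t \<longrightarrow> Z (l, n) = Z' (l, n)"
  have "f (N, Z) = f (N, Z')" "g (N, Z) = g (N, Z')"
    using assms * unfolding past_dependent_def by blast+
  then show "h (f (N, Z)) (g (N, Z)) = h (f (N, Z')) (g (N, Z'))" by simp
qed

text \<open>A union over all possible sites would be infinite. It is organised by the displacement
  \<open>v\<close> from \<open>X\<close> instead: for fixed \<open>v\<close> the events
  \<open>X \<omega> = y\<close> are disjoint in \<open>y\<close>, so their bounds add up to that of
  \<open>H\<close>, once per displacement. The bound for \<open>E z\<close> is assumed on every past
  event because it is applied to the part of \<open>H\<close> where
  \<open>X \<omega> = y\<close>.\<close>

lemma emeasure_ball_union:
  fixes X :: "'d::finite traps \<Rightarrow> 'd site"
  assumes r: "0 \<le> r" and q: "0 \<le> q"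
    and H [measurable]: "H \<in> sets (trap_measure u)" and dep: "past_dependent t (\<lambda>\<omega>. \<omega> \<in> H)"
    and X [measurable]: "X \<in> trap_measure u \<rightarrow>\<^sub>M count_space UNIV" and depX: "past_dependent t X"
    and E [measurable]: "\<And>z. E z \<in> sets (trap_measure u)"
    and le: "\<And>H' z. H' \<in> sets (trap_measure u) \<Longrightarrow> past_dependent t (\<lambda>\<omega>. \<omega> \<in> H') \<Longrightarrow>
      emeasure (trap_measure u) (H' \<inter> E z) \<le> ennreal q * emeasure (trap_measure u) H'"
  shows "{\<omega>\<in>H. \<exists>z\<in>site_ball (X \<omega>) r. \<omega> \<in> E z} \<in> sets (trap_measure u)"
    and "emeasure (trap_measure u) {\<omega>\<in>H. \<exists>z\<in>site_ball (X \<omega>) r. \<omega> \<in> E z} \<le>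
    ennreal ((2 * r + 1) ^ CARD('d) * q) * emeasure (trap_measure u) H"
proof -
  let ?M = "trap_measure u :: 'd traps measure" and ?B = "site_ball (0 :: 'd site) r"
  let ?F = "\<lambda>v y. {\<omega>\<in>H. X \<omega> = y} \<inter> E (y + v)"
  let ?G = "\<lambda>y. {\<omega>\<in>H. X \<omega> = y}"
  have G_eq: "?G y = {\<omega>\<in>space ?M. \<omega> \<in> H \<and> X \<omega> = y}" for y by auto
  have G [measurable]: "?G y \<in> sets ?M" for y unfolding G_eq by measurable
  have eq: "{\<omega>\<in>H. \<exists>z\<in>site_ball (X \<omega>) r. \<omega> \<in> E z} = (\<Union>v\<in>?B. \<Union>y. ?F v y)"
  proof (intro set_eqI iffI)
    fix \<omega> assume "\<omega> \<in> {\<omega>\<in>H. \<exists>z\<in>site_ball (X \<omega>) r. \<omega> \<in> E z}"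
    then obtain z where z: "\<omega> \<in> H" "z \<in> site_ball (X \<omega>) r" "\<omega> \<in> E z" by auto
    then have "z - X \<omega> \<in> ?B" "\<omega> \<in> ?F (z - X \<omega>) (X \<omega>)" by (auto simp: site_ball_def)
    then show "\<omega> \<in> (\<Union>v\<in>?B. \<Union>y. ?F v y)" by blast
  next
    fix \<omega> assume "\<omega> \<in> (\<Union>v\<in>?B. \<Union>y. ?F v y)"
    then obtain v where v: "v \<in> ?B" "\<omega> \<in> H" "\<omega> \<in> E (X \<omega> + v)" by auto
    then have "X \<omega> + v \<in> site_ball (X \<omega>) r" by (simp add: site_ball_def)
    then show "\<omega> \<in> {\<omega>\<in>H. \<exists>z\<in>site_ball (X \<omega>) r. \<omega> \<in> E z}" using v by blast
  qed
  have F: "(\<Union>y. ?F v y) \<in> sets ?M" for v by (intro sets.countable_UN'' sets.Int G E) simp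
  have fin: "finite ?B" by (rule site_ball_bound[OF r])
  show "{\<omega>\<in>H. \<exists>z\<in>site_ball (X \<omega>) r. \<omega> \<in> E z} \<in> sets ?M"
    unfolding eq by (rule sets.finite_UN[OF fin F])
  have one: "emeasure ?M (\<Union>y. ?F v y) \<le> ennreal q * emeasure ?M H" for v
  proof -
    have "emeasure ?M (\<Union>y. ?F v y) = (\<integral>\<^sup>+ y. emeasure ?M (?F v y) \<partial>count_space UNIV)"
      by (intro emeasure_UN_countable) (auto simp: disjoint_family_on_def)
    also have "\<dots> \<le> (\<integral>\<^sup>+ y. ennreal q * emeasure ?M (?G y) \<partial>count_space UNIV)"
    proof (intro nn_integral_mono le G)
      fix y
      show "past_dependent t (\<lambda>\<omega>. \<omega> \<in> ?G y)"
        using past_dependent_comp2[OF dep depX, of "\<lambda>a b. a \<and> b = y"] by simp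
    qed
    also have "\<dots> = ennreal q * (\<integral>\<^sup>+ y. emeasure ?M (?G y) \<partial>count_space UNIV)"
      by (simp add: nn_integral_cmult)
    also have "(\<integral>\<^sup>+ y. emeasure ?M (?G y) \<partial>count_space UNIV) = emeasure ?M (\<Union>y. ?G y)"
      by (intro emeasure_UN_countable[symmetric]) (auto simp: disjoint_family_on_def)
    also have "(\<Union>y. ?G y) = H" by auto
    finally show ?thesis .
  qed
  have "emeasure ?M {\<omega>\<in>H. \<exists>z\<in>site_ball (X \<omega>) r. \<omega> \<in> E z} \<le> (\<Sum>v\<in>?B. emeasure ?M (\<Union>y. ?F v y))"
    unfolding eq using fin F by (intro emeasure_subadditive_finite) auto
  also have "\<dots> \<le> (\<Sum>v\<in>?B. ennreal q * emeasure ?M H)" by (intro sum_mono one)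
  also have "\<dots> = ennreal (real (card ?B) * q) * emeasure ?M H"
    using q by (simp add: ennreal_mult ennreal_of_nat_eq_real_of_nat mult.assoc)
  also have "\<dots> \<le> ennreal ((2 * r + 1) ^ CARD('d) * q) * emeasure ?M H"
    using site_ball_bound(2)[OF r, of "0 :: 'd site"] q
    by (intro mult_right_mono ennreal_leI mult_right_mono) auto
  finally show "emeasure ?M {\<omega>\<in>H. \<exists>z\<in>site_ball (X \<omega>) r. \<omega> \<in> E z} \<le>
    ennreal ((2 * r + 1) ^ CARD('d) * q) * emeasure ?M H" .
qed

lemma environment_comp [measurable (raw)]:
  fixes h :: "'d::finite env \<Rightarrow> 'b"
  shows "h \<in> env_space \<rightarrow>\<^sub>M N \<Longrightarrow> (\<lambda>\<omega>. h (environment \<omega>)) \<in> trap_measure u \<rightarrow>\<^sub>M N"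
  by (rule measurable_compose[OF environment_measurable])

lemma escape_event_conv_undetected:
  "escape_event \<rho> = (\<Inter>t. undetected_until \<rho> t)"
  by (auto simp: escape_event_eq undetected_until_def)

text \<open>
  The base \<open>8 ^ 6\<close> turns the decay of the heat
  kernel with exponent \<open>1 / 6\<close> into \<open>8 ^ -k\<close>.
\<close>

definition remaining :: "nat \<Rightarrow> nat" where
  "remaining k = 262144 ^ k - 1"

lemma remaining_0 [simp]: "remaining 0 = 0"
  by (simp add: remaining_def)

lemma remaining_mono: "k \<le> l \<Longrightarrow> remaining k \<le> remaining l"
  unfolding remaining_def by (intro diff_le_mono power_increasing) auto

lemma of_nat_remaining: "real (remaining k) = 262144 ^ k - 1"
  by (simp add: remaining_def of_nat_diff)

definition heat_const :: "'d::finite itself \<Rightarrow> real" where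
  "heat_const _ = 24 * real (card (unit_steps :: (int ^ 'd) set))"

lemma heat_const_ge_1: "1 \<le> heat_const TYPE('d::finite)"
  using card_unit_steps_pos[where 'd='d] by (simp add: heat_const_def)

lemma heat_remaining_le: "heat (remaining k) (x :: int ^ 'd::finite) \<le> heat_const TYPE('d) / 8 ^ k"
proof (rule power_le_imp_le_base)
  let ?C = "heat_const TYPE('d)"
  have "heat (remaining k) x ^ 6 \<le> ?C / 262144 ^ k"
    using heat_pow_le[of "remaining k" x] by (simp add: of_nat_remaining heat_const_def)
  \<comment> \<open>As \<open>?C \<ge> 1\<close>, the constant may be raised to the sixth power,
    which makes the bound a perfect sixth power.\<close>
  also have "\<dots> \<le> ?C ^ 6 / 262144 ^ k"
    using power_increasing[of 1 6 ?C] heat_const_ge_1[where 'd='d] by (intro divide_right_mono) auto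
  also have "\<dots> = (?C / 8 ^ k) ^ 6"
    by (simp add: power_divide power_mult[symmetric] mult.commute[of k]) (simp add: power_mult)
  finally show "heat (remaining k) x ^ Suc 5 \<le> (?C / 8 ^ k) ^ Suc 5" by simp
  show "0 \<le> ?C / 8 ^ k" using heat_const_ge_1[where 'd='d] by simp
qed

text \<open>Rises from \<open>u / 4\<close> at \<open>k = 0\<close> towards \<open>u / 2\<close>.
  The gap from \<open>k\<close> to \<open>Suc k\<close> is \<open>u / (8 * 2 ^ k)\<close>: the loss
  of density tolerated at scale \<open>k\<close>, summable so that a positive density is left at the
  end.\<close>

definition level :: "real \<Rightarrow> nat \<Rightarrow> real" where
  "level u k = u / 4 * (2 - (1 / 2) ^ k)"

text \<open>
  Here \<open>4 ^ k / (4 C)\<close> is the Chernoff parameter at scale \<open>k\<close>, and \<open>C / 8 ^ k\<close> bounds the heat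
  kernel for the remaining time.
\<close>

lemma level_exponent:
  assumes "C > 0" "u \<ge> 0"
  shows "4 ^ k / (4 * C) * level u k - 4 ^ k / (4 * C) * (1 - 4 ^ k / (4 * C) * (C / 8 ^ k) / 2) * level u (Suc k)
    \<le> - (u * 2 ^ k / (64 * C))"
proof -
  have p: "(4::real) ^ k = 2 ^ k * 2 ^ k" "(8::real) ^ k = 2 ^ k * 2 ^ k * 2 ^ k"
    by (simp_all add: power_mult_distrib[symmetric])
  define a where "a = (2::real) ^ k"
  have a: "a > 0" by (simp add: a_def)
  \<comment> \<open>The gap between the levels contributes \<open>- (u * a / (32 * C))\<close>; the
    quadratic term gives back less than half of it.\<close>
  have "4 ^ k / (4 * C) * level u k - 4 ^ k / (4 * C) * (1 - 4 ^ k / (4 * C) * (C / 8 ^ k) / 2) * level u (Suc k)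
      = - (u * a / (64 * C)) - u / (256 * C)"
    using assms(1) a unfolding level_def p power_one_over a_def[symmetric] power_Suc
    by (simp add: field_simps)
  moreover have "0 \<le> u / (256 * C)" using assms by simp
  ultimately show ?thesis unfolding a_def by linarith
qed

text \<open>By Markov's inequality, exceeded with conditional probability at most \<open>2 ^ -j / 8\<close> given escape.\<close>

definition move_bound :: "real \<Rightarrow> nat \<Rightarrow> real" where
  "move_bound s j = 8 * s * real (remaining (Suc j) - remaining j) * 2 ^ j"

definition reach :: "real \<Rightarrow> nat \<Rightarrow> real" where
  "reach s k = (\<Sum>j<k. move_bound s j)"

lemma move_bound_nonneg: "0 \<le> s \<Longrightarrow> 0 \<le> move_bound s j"
  by (simp add: move_bound_def)

lemma reach_nonneg: "0 \<le> s \<Longrightarrow> 0 \<le> reach s k"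
  by (simp add: reach_def sum_nonneg move_bound_nonneg)

lemma reach_le:
  assumes "0 \<le> s"
  shows "reach s k \<le> 8 * 262144 * s * 524288 ^ k"
proof (induction k)
  case (Suc k)
  have "real (remaining (Suc k) - remaining k) \<le> real (remaining (Suc k))" by simp
  also have "\<dots> \<le> 262144 * 262144 ^ k" by (simp add: of_nat_remaining)
  finally have "move_bound s k \<le> 8 * s * (262144 * 262144 ^ k) * 2 ^ k"
    unfolding move_bound_def using assms by (intro mult_right_mono mult_left_mono) auto
  also have "\<dots> = 8 * 262144 * s * 524288 ^ k"
    using power_mult_distrib[of "262144::real" 2 k] by simp
  finally have "reach s (Suc k) \<le> 8 * 262144 * s * 524288 ^ k + 8 * 262144 * s * 524288 ^ k"
    using Suc by (simp add: reach_def)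
  also have "\<dots> \<le> 8 * 262144 * s * 524288 ^ Suc k" using assms by simp
  finally show ?case .
qed (use assms in \<open>simp add: reach_def\<close>)

text \<open>The number of sites within reach at scale \<open>k\<close> times the Chernoff bound for
  a single site, in the form delivered by \<open>emeasure_ball_union\<close>.\<close>

definition failure_bound :: "'d::finite itself \<Rightarrow> real \<Rightarrow> real \<Rightarrow> nat \<Rightarrow> real" where
  "failure_bound _ s u k = (2 * reach s (Suc k) + 1) ^ CARD('d) * exp (- (u * 2 ^ k / (64 * heat_const TYPE('d))))"

lemma failure_bound_nonneg: "0 \<le> s \<Longrightarrow> 0 \<le> failure_bound TYPE('d::finite) s u k"
  using reach_nonneg[of s "Suc k"] by (simp add: failure_bound_def)

text \<open>The site count grows only geometrically in \<open>k\<close>, so a large \<open>u\<close>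
  makes \<open>x\<close> small enough to win for all \<open>k\<close> at once.\<close>

lemma ex_failure_bound:
  assumes s: "0 \<le> s"
  shows "\<exists>u0>0. \<forall>u\<ge>u0. \<forall>k. failure_bound TYPE('d::finite) s u k \<le> (1 / 2) ^ k / 16"
proof -
  define C where "C = heat_const TYPE('d)"
  have C: "C > 0" using heat_const_ge_1[where 'd='d] by (simp add: C_def)
  define c1 where "c1 = ((16 * 262144 * s + 1) * 524288) ^ CARD('d)"
  define c2 where "c2 = (524288::real) ^ CARD('d)"
  have c1: "c1 > 0" unfolding c1_def using s by (intro zero_less_power) simp
  have c2: "c2 > 0" by (simp add: c2_def)
  define \<epsilon> where "\<epsilon> = min (1 / (2 * c2)) (1 / (16 * c1))"
  have \<epsilon>: "\<epsilon> > 0" using c1 c2 by (simp add: \<epsilon>_def)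
  define u0 where "u0 = max 1 (64 * C * (- ln \<epsilon>))"
  show ?thesis
  proof (intro exI conjI allI impI)
    show "u0 > 0" by (simp add: u0_def)
    fix u k assume u: "u0 \<le> u"
    define x where "x = exp (- (u / (64 * C)))"
    have "64 * C * (- ln \<epsilon>) \<le> u" using u by (simp add: u0_def)
    then have "- (u / (64 * C)) \<le> ln \<epsilon>" using C by (simp add: field_simps)
    then have "x \<le> \<epsilon>" using \<epsilon> by (simp add: x_def ln_ge_iff)
    then have x: "c2 * x \<le> 1 / 2" "c1 * x \<le> 1 / 16" "0 < x"
      using c1 c2 by (auto simp: \<epsilon>_def x_def field_simps)
    have "2 * reach s (Suc k) + 1 \<le> 2 * (8 * 262144 * s * 524288 ^ Suc k) + 1"
      using reach_le[OF s, of "Suc k"] by simp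
    also have "\<dots> \<le> (16 * 262144 * s + 1) * 524288 ^ Suc k"
      using one_le_power[of "524288::real" "Suc k"] by (simp add: algebra_simps)
    finally have "(2 * reach s (Suc k) + 1) ^ CARD('d) \<le> ((16 * 262144 * s + 1) * 524288 ^ Suc k) ^ CARD('d)"
      using reach_nonneg[OF s, of "Suc k"] by (intro power_mono) auto
    also have "\<dots> = c1 * c2 ^ k"
    proof -
      have "(a * b ^ Suc k) ^ n = (a * b) ^ n * (b ^ n) ^ k" for a b :: real and n
        by (simp add: power_mult_distrib power_mult[symmetric] mult_ac)
      then show ?thesis unfolding c1_def c2_def by blast
    qed
    finally have 1: "(2 * reach s (Suc k) + 1) ^ CARD('d) \<le> c1 * c2 ^ k" .
    \<comment> \<open>Weakening \<open>2 ^ k\<close> to \<open>k + 1\<close> leaves a geometric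
      sequence and keeps one factor \<open>x\<close> even at \<open>k = 0\<close>, to be set against
      \<open>c1\<close>.\<close>
    have "real (Suc k) \<le> 2 ^ k" by (induction k) auto
    then have "u / (64 * C) * real (Suc k) \<le> u / (64 * C) * 2 ^ k"
      using u C by (intro mult_left_mono) (auto simp: u0_def)
    then have "exp (- (u * 2 ^ k / (64 * C))) \<le> exp (real (Suc k) * - (u / (64 * C)))"
      by (simp add: mult_ac)
    also have "\<dots> = x ^ Suc k" unfolding x_def by (rule exp_of_nat_mult)
    finally have "failure_bound TYPE('d) s u k \<le> c1 * c2 ^ k * x ^ Suc k"
      unfolding failure_bound_def C_def[symmetric] using 1 c1 c2 by (intro mult_mono) auto
    also have "\<dots> = (c1 * x) * (c2 * x) ^ k" by (simp add: power_mult_distrib mult_ac)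
    also have "\<dots> \<le> 1 / 16 * (1 / 2) ^ k"
      using x c1 c2 by (intro mult_mono power_mono) auto
    finally show "failure_bound TYPE('d) s u k \<le> (1 / 2) ^ k / 16" by simp
  qed
qed

lemma site_ball_path:
  fixes X :: "nat \<Rightarrow> 'd::finite site"
  assumes "t \<le> T"
  shows "real_of_int (l1_norm (X T - X t)) \<le> (\<Sum>\<tau>\<in>{t..<T}. real_of_int (l1_norm (X (Suc \<tau>) - X \<tau>)))"
  using assms
proof (induction T rule: dec_induct)
  case (step T)
  have "l1_norm (X (Suc T) - X t) \<le> l1_norm (X (Suc T) - X T) + l1_norm (X T - X t)"
    using l1_norm_triangle[of "X (Suc T) - X T" "X T - X t"] by simp
  then have "real_of_int (l1_norm (X (Suc T) - X t)) \<le>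
      real_of_int (l1_norm (X (Suc T) - X T)) + real_of_int (l1_norm (X T - X t))"
    by (metis of_int_add of_int_le_iff)
  then show ?case using step by simp
qed simp


text \<open>Permits finitely many starting sites: the expected density \<open>3 * u / 4\<close> that
  they supply still exceeds all levels, which stay below \<open>u / 2\<close>.\<close>

lemma ex_finite_heat_mass:
  fixes z :: "int ^ 'd::finite"
  shows "\<exists>Y. finite Y \<and> 3 / 4 \<le> (\<Sum>y\<in>Y. heat n (y - z))"
proof -
  have "((\<lambda>y. heat n (y + (- z))) has_sum 1) UNIV" by (rule has_sum_translate[OF has_sum_heat])
  from has_sum_finite_approximation[OF this, of "1 / 4"]
  obtain Y where Y: "finite Y" "dist (\<Sum>y\<in>Y. heat n (y + (- z))) 1 \<le> 1 / 4" by auto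
  then have "3 / 4 \<le> (\<Sum>y\<in>Y. heat n (y + (- z)))" unfolding dist_real_def by linarith
  then show ?thesis using Y(1) by auto
qed

text \<open>On the escape event one of three things must go wrong: the target moves too far during a
  scale (\<open>V\<close>), the density drops during a scale (\<open>F\<close>), or it is low
  already after the interval that begins at time 0 (\<open>F'\<close>). The first two kinds have
  total probability at most \<open>p / 2\<close>, the third tends to 0 with growing
  \<open>K\<close>, so they cannot cover an event of probability \<open>p > 0\<close>.\<close>

lemma escape_probability_zero:
  fixes \<rho> :: "'d::finite strategy"
  assumes \<rho>: "escape_strategy \<rho>" "adapted \<rho>" and u: "0 < u" and s: "0 < s"
    and speed: "\<And>t. expected_speed_given_escape u \<rho> t \<le> ennreal s"
    and small: "\<And>k. failure_bound TYPE('d) s u k \<le> (1 / 2) ^ k / 16"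
  shows "emeasure (env_law u) (escape_event \<rho>) = 0"
proof (rule ccontr)
  assume "emeasure (env_law u) (escape_event \<rho>) \<noteq> 0"
  let ?M = "trap_measure u :: 'd traps measure"
  interpret M: prob_space ?M by (rule prob_space_trap_measure)
  define C where "C = heat_const TYPE('d)"
  have C: "C > 0" using heat_const_ge_1[where 'd='d] by (simp add: C_def)
  define X where "X = (\<lambda>t \<omega>. entry_site (\<rho> (environment \<omega>)) t)"
  define A where "A = {\<omega>. environment \<omega> \<in> escape_event \<rho>}"
  define U where "U = (\<lambda>t. {\<omega>. environment \<omega> \<in> undetected_until \<rho> t})"
  define D where "D = (\<lambda>t \<omega>. real_of_int (l1_norm (X (Suc t) \<omega> - X t \<omega>)))"
  define p where "p = M.prob A"
  have X [measurable]: "X t \<in> ?M \<rightarrow>\<^sub>M count_space UNIV" for t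
    unfolding X_def by (rule environment_comp[OF entry_site_measurable[OF \<rho>(2)]])
  have D [measurable]: "D t \<in> borel_measurable ?M" for t
  proof -
    have "(\<lambda>\<omega>. (\<lambda>y. real_of_int (l1_norm (X (Suc t) \<omega> - y))) (X t \<omega>)) \<in> borel_measurable ?M"
      by (rule measurable_compose_countable[OF _ X], rule measurable_compose[OF X]) simp
    then show ?thesis by (simp add: D_def)
  qed
  have D0: "0 \<le> D t \<omega>" for t \<omega> by (simp add: D_def l1_norm_nonneg)
  have esc_sets: "escape_event \<rho> \<in> sets (env_law u)" by (rule escape_event_measurable[OF \<rho>(2)])
  then have esc_sets': "escape_event \<rho> \<in> sets env_space" by (simp add: env_law_def)
  have A [measurable]: "A \<in> sets ?M"
    using measurable_sets[OF environment_measurable esc_sets'] by (simp add: A_def vimage_def)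
  have U [measurable]: "U t \<in> sets ?M" for t
    using measurable_sets[OF environment_measurable[of u] undetected_until_measurable[OF \<rho>(2), of t]]
    by (simp add: U_def vimage_def)
  have emeasure_A: "emeasure (env_law u) (escape_event \<rho>) = emeasure ?M A"
    unfolding env_law_def
    by (subst emeasure_distr[OF environment_measurable esc_sets']) (simp add: A_def vimage_def)
  then have p: "p > 0"
    using \<open>emeasure (env_law u) (escape_event \<rho>) \<noteq> 0\<close>
    by (simp add: p_def M.emeasure_eq_measure zero_less_measure_iff)
  have depU: "past_dependent t (\<lambda>\<omega>. \<omega> \<in> U t)" for t
  proof -
    have "past_dependent t (\<lambda>\<omega>. environment \<omega> \<in> undetected_until \<rho> t)"
      by (rule past_dependent_environment)
         (use undetected_until_agree[OF \<rho>(2)] agree_sym in blast)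
    then show ?thesis by (simp add: U_def)
  qed
  have depX: "past_dependent t (X t)" for t
    unfolding X_def by (rule past_dependent_environment) (rule entry_site_agree[OF \<rho>])
  have UA: "(\<Inter>t. U t) = A" by (simp add: U_def A_def escape_event_conv_undetected INT_extend_simps) auto
  have "(\<lambda>t. M.prob (U t)) \<longlonglongrightarrow> M.prob (\<Inter>t. U t)"
  proof (rule M.finite_Lim_measure_decseq)
    show "range U \<subseteq> M.events" using U by blast
    show "decseq U" by (auto simp: decseq_def U_def undetected_until_def intro: order_trans)
  qed
  then have "\<forall>\<^sub>F t in sequentially. M.prob (U t) < 2 * p"
    using p unfolding UA p_def by (intro order_tendstoD(2)) auto
  then obtain t0 where t0: "\<And>t. t0 \<le> t \<Longrightarrow> M.prob (U t) \<le> 2 * p"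
    unfolding eventually_sequentially by (meson less_imp_le)
  \<comment> \<open>The speed bound enters here: freed of the conditioning, it controls the
    displacements of the entry sites on \<open>A\<close>.\<close>
  have mean_D: "(\<integral>\<^sup>+ \<omega>. indicator A \<omega> * ennreal (D t \<omega>) \<partial>?M) \<le> ennreal (s * p)" for t
  proof -
    let ?d = "\<lambda>\<xi>. ennreal (real_of_int (l1_norm (entry_site (\<rho> \<xi>) (Suc t) - entry_site (\<rho> \<xi>) t)))"
    have d [measurable]: "?d \<in> borel_measurable env_space"
    proof -
      note e = entry_site_measurable[OF \<rho>(2)]
      have "(\<lambda>\<xi>. (\<lambda>y. ennreal (real_of_int (l1_norm (entry_site (\<rho> \<xi>) (Suc t) - y)))) (entry_site (\<rho> \<xi>) t))
        \<in> borel_measurable env_space"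
        by (rule measurable_compose_countable[OF _ e], rule measurable_compose[OF e]) simp
      then show ?thesis by simp
    qed
    have d' [measurable]: "?d \<in> borel_measurable (env_law u)" using d by (simp add: env_law_def)
    have "(\<integral>\<^sup>+ \<xi>. ?d \<xi> \<partial>uniform_measure (env_law u) (escape_event \<rho>)) \<le> expected_speed_given_escape u \<rho> t"
      unfolding expected_speed_given_escape_def
    proof (rule nn_integral_mono)
      fix \<xi>
      have "l1_norm (entry_site (\<rho> \<xi>) (Suc t) - entry_site (\<rho> \<xi>) t) \<le> int (speed (\<rho> \<xi>) t)"
        using \<rho>(1) by (intro entry_displacement_le_speed) (simp add: escape_strategy_def)
      then show "?d \<xi> \<le> of_nat (speed (\<rho> \<xi>) t)"
        by (simp add: ennreal_of_nat_eq_real_of_nat ennreal_leI)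
    qed
    also have "\<dots> \<le> ennreal s" by (rule speed)
    finally have "(\<integral>\<^sup>+ \<xi>. ?d \<xi> * indicator (escape_event \<rho>) \<xi> \<partial>env_law u) / emeasure ?M A \<le> ennreal s"
      by (subst (asm) nn_integral_uniform_measure[OF d' esc_sets]) (simp add: emeasure_A)
    also have "(\<integral>\<^sup>+ \<xi>. ?d \<xi> * indicator (escape_event \<rho>) \<xi> \<partial>env_law u) =
        (\<integral>\<^sup>+ \<omega>. ?d (environment \<omega>) * indicator (escape_event \<rho>) (environment \<omega>) \<partial>?M)"
      unfolding env_law_def
    proof (rule nn_integral_distr[OF environment_measurable])
      show "(\<lambda>\<xi>. ?d \<xi> * indicator (escape_event \<rho>) \<xi>) \<in> borel_measurable (distr ?M env_space environment)"
        unfolding measurable_distr_eq1 using d esc_sets'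
        by (intro borel_measurable_times_ennreal borel_measurable_indicator)
    qed
    also have "\<dots> = (\<integral>\<^sup>+ \<omega>. indicator A \<omega> * ennreal (D t \<omega>) \<partial>?M)"
      by (intro nn_integral_cong) (simp add: D_def X_def A_def indicator_def)
    finally have *: "(\<integral>\<^sup>+ \<omega>. indicator A \<omega> * ennreal (D t \<omega>) \<partial>?M) / ennreal p \<le> ennreal s"
      by (simp add: M.emeasure_eq_measure p_def)
    have "(\<integral>\<^sup>+ \<omega>. indicator A \<omega> * ennreal (D t \<omega>) \<partial>?M) =
        (\<integral>\<^sup>+ \<omega>. indicator A \<omega> * ennreal (D t \<omega>) \<partial>?M) / ennreal p * ennreal p"
      using p by (simp add: ennreal_divide_times ennreal_divide_self[symmetric] divide_ennreal_def mult.assoc ennreal_mult[symmetric] inverse_ennreal)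
    also have "\<dots> \<le> ennreal s * ennreal p" using * by (intro mult_right_mono) auto
    finally show ?thesis using s p by (simp add: ennreal_mult)
  qed
  \<comment> \<open>\<open>K\<close> has to be large for two reasons: the conditioning times must
    come after \<open>t0\<close>, and the last term must become small against
    \<open>p\<close>.\<close>
  have main: "p \<le> p / 4 + p / 4 + (1 / 2) ^ K / 16" if K: "t0 \<le> remaining (Suc K) - remaining K" for K
  proof -
    define T where "T = remaining (Suc K)"
    \<comment> \<open>Scale \<open>k\<close> is the time interval from \<open>\<tau> (Suc k)\<close>
      to \<open>\<tau> k\<close>; larger \<open>k\<close> means earlier, and scale \<open>K\<close>
      begins at time 0.\<close>
    define \<tau> where "\<tau> = (\<lambda>k. T - remaining k)"
    have \<tau>_Suc: "\<tau> k = \<tau> (Suc k) + (remaining (Suc k) - remaining k)" if "k \<le> K" for k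
      using remaining_mono[of "Suc k" "Suc K"] remaining_mono[of k "Suc k"] that
      unfolding \<tau>_def T_def by simp
    have \<tau>_0: "\<tau> 0 = T" and \<tau>_K: "\<tau> (Suc K) = 0" by (simp_all add: \<tau>_def T_def)
    obtain Y where Y: "\<And>z. finite (Y z)" "\<And>z :: 'd site. 3 / 4 \<le> (\<Sum>y\<in>Y z. heat T (y - z))"
      using ex_finite_heat_mass by metis
    define S where "S = (\<lambda>k z. smoothed (Y z) (\<tau> k) (remaining k) z)"
    define V where "V = (\<lambda>k. {\<omega>\<in>A. move_bound s k < (\<Sum>t\<in>{\<tau> (Suc k)..<\<tau> k}. D t \<omega>)})"
    define E where "E = (\<lambda>k z. {\<omega>. level u (Suc k) \<le> S (Suc k) z \<omega> \<and> S k z \<omega> < level u k})"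
    \<comment> \<open>\<open>U\<close> stands in for \<open>A\<close>, because the event that
      restricts the traps before \<open>\<tau> (Suc k)\<close> must depend on the past only.\<close>
    define F where "F = (\<lambda>k. {\<omega>\<in>U (\<tau> (Suc k)). \<exists>z\<in>site_ball (X (\<tau> (Suc k)) \<omega>) (reach s (Suc k)). \<omega> \<in> E k z})"
    \<comment> \<open>The target starts at the origin, so at scale \<open>K\<close> the candidate
      sites form a fixed ball.\<close>
    define F' where "F' = {\<omega>. \<exists>z\<in>site_ball 0 (reach s (Suc K)). S K z \<omega> < level u K}"
    define \<theta> where "\<theta> = (\<lambda>k. 4 ^ k / (4 * C))"
    define q where "q = (\<lambda>k. exp (- (u * 2 ^ k / (64 * C))))"
    have \<theta>: "0 \<le> \<theta> k" "\<theta> k * (C / 8 ^ k) \<le> 2" for k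
    proof -
      show "0 \<le> \<theta> k" using C by (simp add: \<theta>_def)
      have "(4::real) ^ k \<le> 8 ^ k" by (rule power_mono) auto
      also have "(8::real) ^ k \<le> 8 * 8 ^ k" by simp
      finally have "(4::real) ^ k \<le> 8 * 8 ^ k" .
      then show "\<theta> k * (C / 8 ^ k) \<le> 2" using C by (simp add: \<theta>_def field_simps)
    qed
    have heat_le: "heat (remaining k) x \<le> C / 8 ^ k" for k and x :: "int ^ 'd"
      unfolding C_def by (rule heat_remaining_le)
    have S [measurable]: "S k z \<in> borel_measurable ?M" for k z
      unfolding S_def by (rule measurable_smoothed)
    have E [measurable]: "E k z \<in> sets ?M" for k z
    proof -
      have "E k z = {\<omega>\<in>space ?M. level u (Suc k) \<le> S (Suc k) z \<omega> \<and> S k z \<omega> < level u k}"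
        by (simp add: E_def)
      also have "\<dots> \<in> sets ?M" by measurable
      finally show ?thesis .
    qed
    have V [measurable]: "V k \<in> sets ?M" for k
    proof -
      have "V k = {\<omega>\<in>space ?M. \<omega> \<in> A \<and> move_bound s k < (\<Sum>t\<in>{\<tau> (Suc k)..<\<tau> k}. D t \<omega>)}"
        by (simp add: V_def)
      also have "\<dots> \<in> sets ?M" by measurable
      finally show ?thesis .
    qed
    have reach0: "0 \<le> reach s k" for k using s by (intro reach_nonneg) simp
    have V_le: "M.prob (V k) \<le> p / 8 * (1 / 2) ^ k" if "k \<le> K" for k
    proof -
      define n where "n = remaining (Suc k) - remaining k"
      have n: "n > 0" by (simp add: n_def remaining_def)
      have card: "card {\<tau> (Suc k)..<\<tau> k} = n" using \<tau>_Suc[OF that] by (simp add: n_def)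
      have w: "move_bound s k = 8 * s * real n * 2 ^ k" by (simp add: move_bound_def n_def)
      have w0: "0 < move_bound s k" using s n by (simp add: w)
      have "ennreal (move_bound s k) * emeasure ?M (V k) = (\<integral>\<^sup>+ \<omega>. ennreal (move_bound s k) * indicator (V k) \<omega> \<partial>?M)"
        by (simp add: nn_integral_cmult)
      also have "\<dots> \<le> (\<integral>\<^sup>+ \<omega>. (\<Sum>t\<in>{\<tau> (Suc k)..<\<tau> k}. indicator A \<omega> * ennreal (D t \<omega>)) \<partial>?M)"
      proof (rule nn_integral_mono)
        fix \<omega>
        show "ennreal (move_bound s k) * indicator (V k) \<omega> \<le>
            (\<Sum>t\<in>{\<tau> (Suc k)..<\<tau> k}. indicator A \<omega> * ennreal (D t \<omega>))"
          by (cases "\<omega> \<in> V k") (auto simp: V_def D0 sum_nonneg intro!: ennreal_leI)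
      qed
      also have "\<dots> = (\<Sum>t\<in>{\<tau> (Suc k)..<\<tau> k}. (\<integral>\<^sup>+ \<omega>. indicator A \<omega> * ennreal (D t \<omega>) \<partial>?M))"
        by (intro nn_integral_sum) measurable
      also have "\<dots> \<le> (\<Sum>t\<in>{\<tau> (Suc k)..<\<tau> k}. ennreal (s * p))" by (intro sum_mono mean_D)
      also have "\<dots> = ennreal (real n * (s * p))"
        unfolding sum_constant card using s p by (simp add: ennreal_mult ennreal_of_nat_eq_real_of_nat)
      finally have "move_bound s k * M.prob (V k) \<le> real n * (s * p)"
        using w0 s p by (simp add: M.emeasure_eq_measure ennreal_mult[symmetric])
      then show ?thesis using s n by (simp add: w power_one_over field_simps)
    qed
    have F_sets: "F k \<in> sets ?M" 
      and F_emeasure: "emeasure ?M (F k) \<le> ennreal (failure_bound TYPE('d) s u k) * emeasure ?M (U (\<tau> (Suc k)))"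
      if k: "k \<le> K" for k
    proof -
      define n where "n = remaining (Suc k) - remaining k"
      have n: "n + remaining k = remaining (Suc k)" "\<tau> (Suc k) + n = \<tau> k"
        using remaining_mono[of k "Suc k"] \<tau>_Suc[OF k] by (auto simp: n_def)
      have q: "0 \<le> q k" by (simp add: q_def)
      have le: "emeasure ?M (H' \<inter> E k z) \<le> ennreal (q k) * emeasure ?M H'"
        if H': "H' \<in> sets ?M" "past_dependent (\<tau> (Suc k)) (\<lambda>\<omega>. \<omega> \<in> H')" for H' z
      proof -
        have "H' \<inter> E k z = {\<omega>\<in>H'. level u (Suc k) \<le> smoothed (Y z) (\<tau> (Suc k)) (n + remaining k) z \<omega> \<and>
            smoothed (Y z) (\<tau> (Suc k) + n) (remaining k) z \<omega> < level u k}"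
          by (auto simp: E_def S_def n)
        also have "emeasure ?M \<dots> \<le> ennreal (exp (\<theta> k * level u k -
            \<theta> k * (1 - \<theta> k * (C / 8 ^ k) / 2) * level u (Suc k))) * emeasure ?M H'"
          by (rule smoothed_drop[OF Y(1) \<theta> heat_le H'])
        also have "\<dots> \<le> ennreal (q k) * emeasure ?M H'"
          using level_exponent[OF C, of u k] u
          by (intro mult_right_mono ennreal_leI) (auto simp: q_def \<theta>_def)
        finally show ?thesis .
      qed
      note union = emeasure_ball_union[OF reach0 q U depU X depX E le]
      show "F k \<in> sets ?M" unfolding F_def by (rule union(1))
      show "emeasure ?M (F k) \<le> ennreal (failure_bound TYPE('d) s u k) * emeasure ?M (U (\<tau> (Suc k)))"
        using union(2) unfolding F_def failure_bound_def q_def C_def .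
    qed
    \<comment> \<open>\<open>k < K\<close> keeps \<open>\<tau> (Suc k)\<close> beyond
      \<open>t0\<close>. For \<open>k = K\<close> this time is 0, and \<open>U\<close> may then be
      much more likely than escape.\<close>
    have F_le: "M.prob (F k) \<le> failure_bound TYPE('d) s u k * (2 * p)" if "k < K" for k
    proof -
      have "remaining (Suc k) \<le> remaining K" using that by (intro remaining_mono) simp
      then have "t0 \<le> \<tau> (Suc k)" using K by (simp add: \<tau>_def T_def)
      then have U_le: "M.prob (U (\<tau> (Suc k))) \<le> 2 * p" by (rule t0)
      have f0: "0 \<le> failure_bound TYPE('d) s u k" using s by (intro failure_bound_nonneg) simp
      have "M.prob (F k) \<le> failure_bound TYPE('d) s u k * M.prob (U (\<tau> (Suc k)))"
        using F_emeasure[of k] that f0 by (simp add: M.emeasure_eq_measure ennreal_mult[symmetric])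
      also have "\<dots> \<le> failure_bound TYPE('d) s u k * (2 * p)" using U_le f0 by (intro mult_left_mono)
      finally show ?thesis .
    qed
    have F'_sets: "F' \<in> sets ?M" and F'_emeasure: "emeasure ?M F' \<le> ennreal (failure_bound TYPE('d) s u K)"
    proof -
      let ?B = "site_ball (0 :: 'd site) (reach s (Suc K))"
      let ?G = "\<lambda>z. {\<omega>\<in>space ?M. S K z \<omega> < level u K}"
      have eq: "F' = (\<Union>z\<in>?B. ?G z)" by (auto simp: F'_def)
      have fin: "finite ?B" by (rule site_ball_bound[OF reach0])
      have G: "?G z \<in> sets ?M" for z by measurable
      show "F' \<in> sets ?M" unfolding eq by (rule sets.finite_UN[OF fin G])
      have le: "emeasure ?M (?G z) \<le> ennreal (q K)" for z
      proof -
        have T: "\<tau> K + remaining K = T" using remaining_mono[of K "Suc K"] by (simp add: \<tau>_def T_def)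
        have "emeasure ?M (?G z) = emeasure ?M {\<omega>. smoothed (Y z) (\<tau> K) (remaining K) z \<omega> < level u K}"
          by (simp add: S_def)
        also have "\<dots> \<le> ennreal (exp (\<theta> K * level u K - \<theta> K * (1 - \<theta> K * (C / 8 ^ K) / 2) *
            (u * (\<Sum>y\<in>Y z. heat (\<tau> K + remaining K) (y - z)))))"
          using u by (intro smoothed_low[OF Y(1) \<theta>(1) heat_le]) simp
        also have "\<dots> \<le> ennreal (exp (\<theta> K * level u K - \<theta> K * (1 - \<theta> K * (C / 8 ^ K) / 2) * level u (Suc K)))"
        proof -
          have "level u (Suc K) \<le> u / 4 * 2" unfolding level_def using u by (intro mult_left_mono) auto
          also have "\<dots> \<le> u * (3 / 4)" using u by simp
          also have "\<dots> \<le> u * (\<Sum>y\<in>Y z. heat (\<tau> K + remaining K) (y - z))"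
            unfolding T using Y(2)[of z] u by (intro mult_left_mono) auto
          finally have "\<theta> K * (1 - \<theta> K * (C / 8 ^ K) / 2) * level u (Suc K) \<le>
              \<theta> K * (1 - \<theta> K * (C / 8 ^ K) / 2) * (u * (\<Sum>y\<in>Y z. heat (\<tau> K + remaining K) (y - z)))"
          proof (rule mult_left_mono)
            have "x \<le> 2 \<Longrightarrow> 0 \<le> 1 - x / 2" for x :: real by simp
            from this[OF \<theta>(2)] have "0 \<le> 1 - \<theta> K * (C / 8 ^ K) / 2" .
            then show "0 \<le> \<theta> K * (1 - \<theta> K * (C / 8 ^ K) / 2)" by (rule mult_nonneg_nonneg[OF \<theta>(1)])
          qed
          then show ?thesis by (intro ennreal_leI) simp
        qed
        also have "\<dots> \<le> ennreal (q K)"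
          using level_exponent[OF C, of u K] u by (intro ennreal_leI) (auto simp: q_def \<theta>_def)
        finally show ?thesis .
      qed
      have "emeasure ?M F' \<le> (\<Sum>z\<in>?B. emeasure ?M (?G z))"
        unfolding eq using G by (intro emeasure_subadditive_finite fin) blast
      also have "\<dots> \<le> (\<Sum>z\<in>?B. ennreal (q K))" by (intro sum_mono le)
      also have "\<dots> = ennreal (real (card ?B) * q K)"
        by (simp add: ennreal_mult ennreal_of_nat_eq_real_of_nat q_def)
      also have "\<dots> \<le> ennreal (failure_bound TYPE('d) s u K)"
        unfolding failure_bound_def q_def C_def
        using site_ball_bound(2)[OF reach0] by (intro ennreal_leI mult_right_mono) auto
      finally show "emeasure ?M F' \<le> ennreal (failure_bound TYPE('d) s u K)" .
    qed
    \<comment> \<open>Outside the bad events the site \<open>z\<close> entered at time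
      \<open>T\<close> is within reach at every scale, so its density stays above the levels down to
      \<open>k = 0\<close>. With no time remaining the density counts traps at \<open>z\<close>, so
      \<open>z\<close> is occupied and the target is detected.\<close>
    have cover: "A \<subseteq> (\<Union>k\<in>{..K}. V k) \<union> (\<Union>k\<in>{..<K}. F k) \<union> F'"
    proof (rule subsetI, rule ccontr)
      fix \<omega> assume \<omega>: "\<omega> \<in> A" and no: "\<omega> \<notin> (\<Union>k\<in>{..K}. V k) \<union> (\<Union>k\<in>{..<K}. F k) \<union> F'"
      let ?\<xi> = "environment \<omega>"
      define z where "z = X T \<omega>"
      have traj: "escape_trajectory (\<rho> ?\<xi>)" using \<rho>(1) by (simp add: escape_strategy_def)
      have sum_D: "(\<Sum>t\<in>{\<tau> k..<T}. D t \<omega>) \<le> reach s k" if "k \<le> Suc K" for k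
        using that
      proof (induction k)
        case (Suc k)
        have "\<omega> \<notin> V k" using no Suc.prems by auto
        then have "(\<Sum>t\<in>{\<tau> (Suc k)..<\<tau> k}. D t \<omega>) \<le> move_bound s k" using \<omega> by (simp add: V_def)
        moreover have "\<tau> (Suc k) \<le> \<tau> k" "\<tau> k \<le> T" using \<tau>_Suc[of k] Suc.prems by (auto simp: \<tau>_def)
        then have "(\<Sum>t\<in>{\<tau> (Suc k)..<T}. D t \<omega>) = (\<Sum>t\<in>{\<tau> (Suc k)..<\<tau> k}. D t \<omega>) + (\<Sum>t\<in>{\<tau> k..<T}. D t \<omega>)"
          by (simp add: sum.atLeastLessThan_concat)
        ultimately show ?case using Suc by (simp add: reach_def)
      qed (simp add: \<tau>_0 reach_def)
      have ball: "z \<in> site_ball (X (\<tau> k) \<omega>) (reach s k)" if "k \<le> Suc K" for k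
      proof -
        have "real_of_int (l1_norm (X T \<omega> - X (\<tau> k) \<omega>)) \<le> (\<Sum>t\<in>{\<tau> k..<T}. D t \<omega>)"
          unfolding D_def by (rule site_ball_path[of "\<tau> k" T "\<lambda>t. X t \<omega>"]) (simp add: \<tau>_def)
        then show ?thesis using sum_D[OF that] by (simp add: site_ball_def z_def)
      qed
      have "\<rho> ?\<xi> 0 = (0, 0)" using traj by (simp add: escape_trajectory_def)
      then have "entry (\<rho> ?\<xi>) 0 = 0" unfolding entry_def by (intro Least_equality) auto
      then have "X 0 \<omega> = 0" using \<open>\<rho> ?\<xi> 0 = (0, 0)\<close> by (simp add: X_def entry_site_def)
      then have "z \<in> site_ball 0 (reach s (Suc K))" using ball[of "Suc K"] \<tau>_K by simp
      then have top: "level u K \<le> S K z \<omega>" using no by (auto simp: F'_def not_less)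
      have "level u k \<le> S k z \<omega>" if "k \<le> K" for k
        using that
      proof (induction rule: inc_induct)
        case (step k)
        show ?case
        proof (rule ccontr)
          assume "\<not> level u k \<le> S k z \<omega>"
          then have "\<omega> \<in> E k z" using step.IH by (simp add: E_def)
          moreover have "\<omega> \<in> U (\<tau> (Suc k))" using \<omega> UA by auto
          ultimately have "\<omega> \<in> F k" using ball[of "Suc k"] step.hyps by (auto simp: F_def)
          then show False using no step.hyps by auto
        qed
      qed (rule top)
      from this[of 0] have "0 < smoothed (Y z) T 0 z \<omega>" using u by (simp add: S_def level_def \<tau>_0)
      then obtain y where "0 < (\<Sum>i<fst \<omega> y. heat 0 (trap_position \<omega> (y, i) T - z))"
        unfolding smoothed_def by (meson not_less sum_nonpos)
      then obtain i where "i < fst \<omega> y" "0 < heat 0 (trap_position \<omega> (y, i) T - z)"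
        by (meson lessThan_iff not_less sum_nonpos)
      then have "trap_position \<omega> (y, i) T = z" by (simp add: heat_0 split: if_splits)
      then have "?\<xi> (z, T)" using \<open>i < fst \<omega> y\<close> by (auto simp: environment_def)
      moreover have "\<rho> ?\<xi> (entry (\<rho> ?\<xi>) T) = (z, T)"
        using entry_time[OF traj, of T] by (simp add: prod_eq_iff z_def X_def entry_site_def)
      ultimately show False using \<omega> by (auto simp: A_def escape_event_eq dest: spec[of _ "entry (\<rho> ?\<xi>) T"])
    qed
    have "p \<le> M.prob ((\<Union>k\<in>{..K}. V k) \<union> (\<Union>k\<in>{..<K}. F k) \<union> F')"
      unfolding p_def using cover F'_sets F_sets
      by (intro M.finite_measure_mono) (auto intro!: sets.Un sets.finite_UN)
    also have "\<dots> \<le> M.prob (\<Union>k\<in>{..K}. V k) + M.prob (\<Union>k\<in>{..<K}. F k) + M.prob F'"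
      using F'_sets F_sets
      by (intro order_trans[OF measure_Un_le] add_right_mono measure_Un_le)
         (auto intro!: sets.Un sets.finite_UN)
    also have "M.prob (\<Union>k\<in>{..K}. V k) \<le> (\<Sum>k\<in>{..K}. M.prob (V k))"
      by (intro measure_UNION_le) auto
    also have "\<dots> \<le> (\<Sum>k\<in>{..K}. p / 8 * (1 / 2) ^ k)" by (intro sum_mono V_le) simp
    also have "\<dots> = p / 8 * (\<Sum>k\<in>{..K}. (1 / 2) ^ k)" by (simp add: sum_distrib_left)
    also have "\<dots> \<le> p / 4"
    proof -
      have "(\<Sum>k\<in>{..K}. (1 / 2 :: real) ^ k) \<le> 2" by (simp add: sum_gp0)
      then have "p / 8 * (\<Sum>k\<in>{..K}. (1 / 2) ^ k) \<le> p / 8 * 2" using p by (intro mult_left_mono) auto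
      then show ?thesis by simp
    qed
    also have "M.prob (\<Union>k\<in>{..<K}. F k) \<le> (\<Sum>k\<in>{..<K}. M.prob (F k))"
      using F_sets by (intro measure_UNION_le) auto
    also have "\<dots> \<le> (\<Sum>k\<in>{..<K}. (1 / 2) ^ k / 16 * (2 * p))"
      using small p by (intro sum_mono order_trans[OF F_le] mult_right_mono) auto
    also have "\<dots> = p / 8 * (\<Sum>k\<in>{..<K}. (1 / 2) ^ k)" by (simp add: sum_distrib_left)
    also have "\<dots> \<le> p / 4"
    proof -
      have "(\<Sum>k\<in>{..<K}. (1 / 2 :: real) ^ k) \<le> 2" by (simp add: sum_gp_strict)
      then have "p / 8 * (\<Sum>k\<in>{..<K}. (1 / 2) ^ k) \<le> p / 8 * 2" using p by (intro mult_left_mono) auto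
      then show ?thesis by simp
    qed
    also have "M.prob F' \<le> failure_bound TYPE('d) s u K"
      using F'_emeasure s by (simp add: M.emeasure_eq_measure failure_bound_nonneg)
    also have "\<dots> \<le> (1 / 2) ^ K / 16" by (rule small)
    finally show ?thesis by simp
  qed
  have large: "t0 \<le> remaining (Suc K) - remaining K" if "t0 \<le> K" for K
  proof -
    have "K < 262144 ^ K" by (rule less_exp[THEN order.strict_trans2]) (rule power_mono, auto)
    then have "K \<le> remaining (Suc K) - remaining K" by (simp add: remaining_def)
    then show ?thesis using that by simp
  qed
  have "(\<lambda>K. (1 / 2 :: real) ^ K / 16) \<longlonglongrightarrow> 0 / 16" by (intro tendsto_divide LIMSEQ_power_zero tendsto_const) simp_all
  then have "\<forall>\<^sub>F K in sequentially. (1 / 2 :: real) ^ K / 16 < p / 2"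
    by (rule order_tendstoD(2)) (use p in simp)
  then have "\<forall>\<^sub>F K in sequentially. False"
    using eventually_ge_at_top[of t0]
  proof eventually_elim
    case (elim K)
    then show ?case using main[OF large[of K]] by simp
  qed
  then show False by simp
qed

section \<open>Lipschitz surfaces\<close>

text \<open>
  A Lipschitz surface above a set \<open>C\<close> of closed sites: \<open>climb n C x y\<close> holds if \<open>(x, y)\<close> can be
  reached in \<open>n\<close> steps from the lower half plane, where downward steps, straight or diagonal, are free
  and upward steps, straight or diagonal, must end in \<open>C\<close>. The lowest sites that cannot be reached
  form an open curve.
\<close>

primrec climb :: "nat \<Rightarrow> (int \<times> int) set \<Rightarrow> int \<Rightarrow> int \<Rightarrow> bool" where
  "climb 0 C x y \<longleftrightarrow> y < 0"
| "climb (Suc n) C x y \<longleftrightarrow>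
    (\<exists>d\<in>{-1, 0, 1}. climb n C (x + d) (y + 1) \<or> (x, y) \<in> C \<and> climb n C (x + d) (y - 1))"

definition climbable :: "(int \<times> int) set \<Rightarrow> int \<Rightarrow> int \<Rightarrow> bool" where
  "climbable C x y \<longleftrightarrow> (\<exists>n. climb n C x y)"

lemma climbable_base: "y < 0 \<Longrightarrow> climbable C x y"
  unfolding climbable_def by (rule exI[of _ 0]) simp

lemma climbable_down: "climbable C x' (y + 1) \<Longrightarrow> \<bar>x' - x\<bar> \<le> 1 \<Longrightarrow> climbable C x y"
proof -
  assume "climbable C x' (y + 1)" "\<bar>x' - x\<bar> \<le> 1"
  then obtain n where "climb n C (x + (x' - x)) (y + 1)" by (auto simp: climbable_def)
  moreover have "x' - x \<in> {-1, 0, 1}" using \<open>\<bar>x' - x\<bar> \<le> 1\<close> by auto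
  ultimately have "climb (Suc n) C x y" unfolding climb.simps by blast
  then show ?thesis unfolding climbable_def by blast
qed

lemma climbable_up: "climbable C x' (y - 1) \<Longrightarrow> \<bar>x' - x\<bar> \<le> 1 \<Longrightarrow> (x, y) \<in> C \<Longrightarrow> climbable C x y"
proof -
  assume "climbable C x' (y - 1)" "\<bar>x' - x\<bar> \<le> 1" "(x, y) \<in> C"
  then obtain n where "climb n C (x + (x' - x)) (y - 1)" by (auto simp: climbable_def)
  moreover have "x' - x \<in> {-1, 0, 1}" using \<open>\<bar>x' - x\<bar> \<le> 1\<close> by auto
  ultimately have "climb (Suc n) C x y" unfolding climb.simps using \<open>(x, y) \<in> C\<close> by blast
  then show ?thesis unfolding climbable_def by blast
qed

lemma climbable_le:
  assumes "climbable C x y'" "y \<le> y'"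
  shows "climbable C x y"
  using assms(2,1)
proof (induction rule: int_le_induct)
  case (step i)
  then show ?case using climbable_down[of C x "i - 1" x] by simp
qed simp

text \<open>A natural number suffices because all sites below height 0 are climbable. In a column
  that is climbable throughout the value is unspecified; the geometric facts assume a site of the
  column that is not climbable.\<close>

definition surface :: "(int \<times> int) set \<Rightarrow> int \<Rightarrow> nat" where
  "surface C x = (LEAST h. \<not> climbable C x (int h))"

lemma surface_le: "\<not> climbable C x (int h) \<Longrightarrow> surface C x \<le> h"
  unfolding surface_def by (rule Least_le)

lemma climbable_iff_surface:
  assumes "\<not> climbable C x (int h)"
  shows "climbable C x y \<longleftrightarrow> y < int (surface C x)"
proof
  have n: "\<not> climbable C x (int (surface C x))"
    unfolding surface_def by (rule LeastI[of "\<lambda>h. \<not> climbable C x (int h)", OF assms])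
  show "y < int (surface C x)" if "climbable C x y"
    using climbable_le[OF that, of "int (surface C x)"] n by force
  show "climbable C x y" if y: "y < int (surface C x)"
  proof (cases "y < 0")
    case False
    then have "nat y < surface C x" using y by simp
    then have "climbable C x (int (nat y))" using not_less_Least unfolding surface_def by blast
    then show ?thesis using False by simp
  qed (rule climbable_base)
qed

text \<open>The site just below is climbable, so a closed site here could be entered by a straight
  upward step.\<close>

lemma surface_open:
  assumes "\<not> climbable C x (int h)"
  shows "(x, int (surface C x)) \<notin> C"
proof
  note iff = climbable_iff_surface[OF assms]
  assume "(x, int (surface C x)) \<in> C"
  moreover have "climbable C x (int (surface C x) - 1)" unfolding iff by simp
  ultimately show False using climbable_up[of C x "int (surface C x)" x] unfolding iff by simp
qed

text \<open>The topmost climbable site of one column allows a free diagonal descent into the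
  neighbouring column.\<close>

lemma surface_lipschitz:
  assumes "\<not> climbable C x (int h)" "\<not> climbable C x' (int h')" "\<bar>x' - x\<bar> \<le> 1"
  shows "int (surface C x) \<le> int (surface C x') + 1"
proof -
  have "climbable C x (int (surface C x) - 1)" unfolding climbable_iff_surface[OF assms(1)] by simp
  then have "climbable C x' (int (surface C x) - 2)"
    using climbable_down[of C x "int (surface C x) - 2" x'] assms(3) by simp
  then show ?thesis unfolding climbable_iff_surface[OF assms(2)] by simp
qed

text \<open>The purpose of the diagonal upward steps: a closed corner could be entered from the
  climbable site of column \<open>x'\<close> at height \<open>surface C x\<close>. Open corners let
  the curve be followed by nearest-neighbour steps.\<close>

lemma surface_corner_open:
  assumes "\<not> climbable C x (int h)" "\<not> climbable C x' (int h')" "\<bar>x' - x\<bar> \<le> 1"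
    and "int (surface C x') = int (surface C x) + 1"
  shows "(x, int (surface C x) + 1) \<notin> C"
proof
  assume "(x, int (surface C x) + 1) \<in> C"
  moreover have "climbable C x' (int (surface C x))"
    unfolding climbable_iff_surface[OF assms(2)] using assms(4) by simp
  ultimately have "climbable C x (int (surface C x) + 1)"
    using climbable_up[of C x' "int (surface C x) + 1" x] assms(3) by simp
  then show False unfolding climbable_iff_surface[OF assms(1)] by simp
qed

section \<open>Crossing of surfaces over the two axes\<close>

definition adjacent :: "int \<times> int \<Rightarrow> int \<times> int \<Rightarrow> bool" where
  "adjacent p q \<longleftrightarrow> \<bar>fst q - fst p\<bar> + \<bar>snd q - snd p\<bar> = 1"

text \<open>The number is an upper bound for the length, as \<open>connected_in_refl\<close> leaves
  it arbitrary.\<close>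

inductive connected_in :: "(int \<times> int) set \<Rightarrow> nat \<Rightarrow> int \<times> int \<Rightarrow> int \<times> int \<Rightarrow> bool" for S where
  connected_in_refl: "p \<in> S \<Longrightarrow> connected_in S n p p"
| connected_in_step: "connected_in S n p q \<Longrightarrow> adjacent q r \<Longrightarrow> r \<in> S \<Longrightarrow> connected_in S (Suc n) p r"

lemma connected_in_mono: "connected_in S m p q \<Longrightarrow> m \<le> n \<Longrightarrow> connected_in S n p q"
proof (induction arbitrary: n rule: connected_in.induct)
  case (connected_in_step m p q r)
  then obtain n' where "n = Suc n'" "m \<le> n'" by (cases n) auto
  then show ?case using connected_in_step by (auto intro: connected_in.connected_in_step)
qed (auto intro: connected_in_refl)

lemma surface_step_cases:
  assumes "\<not> climbable C x (int h)" "\<not> climbable C (x + 1) (int h')"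
  obtains (level) "surface C (x + 1) = surface C x"
  | (up) "int (surface C (x + 1)) = int (surface C x) + 1" "(x, int (surface C x) + 1) \<notin> C"
  | (down) "int (surface C (x + 1)) = int (surface C x) - 1" "(x + 1, int (surface C x)) \<notin> C"
proof -
  have "int (surface C x) \<le> int (surface C (x + 1)) + 1" "int (surface C (x + 1)) \<le> int (surface C x) + 1"
    using surface_lipschitz[OF assms] surface_lipschitz[OF assms(2,1)] by auto
  then consider "surface C (x + 1) = surface C x" | "int (surface C (x + 1)) = int (surface C x) + 1"
    | "int (surface C (x + 1)) = int (surface C x) - 1" by linarith
  then show ?thesis
    using that surface_corner_open[OF assms] surface_corner_open[OF assms(2,1)] by cases auto
qed

lemma surface_connected:
  assumes "\<And>x. x \<le> n \<Longrightarrow> \<not> climbable C (int x) (int h)" "m \<le> n"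
  shows "connected_in (- C) (2 * m) (0, int (surface C 0)) (int m, int (surface C (int m)))"
  using assms(2)
proof (induction m)
  case 0
  then show ?case using surface_open[OF assms(1)[of 0]] by (auto intro: connected_in_refl)
next
  case (Suc m)
  let ?p = "(0, int (surface C 0))"
  have b: "\<not> climbable C (int m) (int h)" "\<not> climbable C (int m + 1) (int h)"
    using assms(1)[of m] assms(1)[of "Suc m"] Suc.prems by (auto simp: add.commute)
  have o: "(int m + 1, int (surface C (int m + 1))) \<in> - C" using surface_open[OF b(2)] by simp
  have IH: "connected_in (- C) (2 * m) ?p (int m, int (surface C (int m)))" using Suc by simp
  have "connected_in (- C) (Suc (Suc (2 * m))) ?p (int m + 1, int (surface C (int m + 1)))"
    using b
  proof (cases rule: surface_step_cases)
    case level
    have "connected_in (- C) (Suc (2 * m)) ?p (int m + 1, int (surface C (int m + 1)))"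
      using level by (intro connected_in_step[OF IH _ o]) (simp add: adjacent_def)
    then show ?thesis by (rule connected_in_mono) simp
  next
    case up
    have c: "connected_in (- C) (Suc (2 * m)) ?p (int m, int (surface C (int m)) + 1)"
      using up by (intro connected_in_step[OF IH]) (simp_all add: adjacent_def)
    show ?thesis using up by (intro connected_in_step[OF c _ o]) (simp_all add: adjacent_def)
  next
    case down
    have c: "connected_in (- C) (Suc (2 * m)) ?p (int m + 1, int (surface C (int m)))"
      using down by (intro connected_in_step[OF IH]) (simp_all add: adjacent_def)
    show ?thesis using down by (intro connected_in_step[OF c _ o]) (simp_all add: adjacent_def)
  qed
  then show ?case by (simp add: add.commute)
qed

text \<open>
  The surface of \<open>C\<close> lies over the second axis, with the coordinates exchanged. It is followed upwards
  until it is no longer below the surface of \<open>B\<close>.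
\<close>

lemma surfaces_meet:
  assumes B: "\<And>x. x \<le> n \<Longrightarrow> \<not> climbable B (int x) (int n)"
    and C: "\<And>x. x \<le> n \<Longrightarrow> \<not> climbable C (int x) (int n)"
  shows "\<exists>x y. connected_in (- B) (2 * n) (0, int (surface B 0)) (x, y) \<and>
    connected_in (- C) (2 * n) (0, int (surface C 0)) (y, x)"
proof -
  define F where "F = (\<lambda>x. int (surface B x))"
  define G where "G = (\<lambda>x. int (surface C x))"
  have F_le: "F (int x) \<le> int n" "F (int x) \<ge> 0" if "x \<le> n" for x
    using surface_le[OF B[OF that]] by (auto simp: F_def)
  have G_le: "G (int x) \<le> int n" "G (int x) \<ge> 0" if "x \<le> n" for x
    using surface_le[OF C[OF that]] by (auto simp: G_def)
  have B': "\<not> climbable B x (int n)" if "0 \<le> x" "x \<le> int n" for x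
    using B[of "nat x"] that by simp
  have lip: "\<bar>F x - F x'\<bar> \<le> 1" if "0 \<le> x" "x \<le> int n" "0 \<le> x'" "x' \<le> int n" "\<bar>x - x'\<bar> \<le> 1" for x x'
    using surface_lipschitz[OF B' B', of x x'] surface_lipschitz[OF B' B', of x' x] that
    by (auto simp: F_def abs_minus_commute abs_le_iff)
  \<comment> \<open>The invariant: either the curve of \<open>C\<close> has already met the surface
    of \<open>B\<close>, or at height \<open>m\<close> it is still strictly below it.\<close>
  have *: "(\<exists>x y. 0 \<le> x \<and> x \<le> int n \<and> F x = y \<and> connected_in (- C) (2 * m) (0, G 0) (y, x)) \<or>
      (connected_in (- C) (2 * m) (0, G 0) (int m, G (int m)) \<and> int m < F (G (int m)))" if "m \<le> n" for m
    using that
  proof (induction m)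
    case 0
    have c: "connected_in (- C) 0 (0, G 0) (0, G 0)"
      using surface_open[OF C[of 0]] by (auto simp: G_def intro: connected_in_refl)
    have G0: "0 \<le> G 0" "G 0 \<le> int n" using G_le[of 0] by simp_all
    then have "0 \<le> F (G 0)" using F_le(2)[of "nat (G 0)"] by simp
    show ?case
    proof (cases "F (G 0) = 0")
      case True
      then show ?thesis using c G0 by auto
    next
      case False
      then show ?thesis using c \<open>0 \<le> F (G 0)\<close> by auto
    qed
  next
    case (Suc m)
    then have m: "m \<le> n" by simp
    from Suc.IH[OF m] show ?case
    proof
      assume "\<exists>x y. 0 \<le> x \<and> x \<le> int n \<and> F x = y \<and> connected_in (- C) (2 * m) (0, G 0) (y, x)"
      then show ?thesis using connected_in_mono[of "- C" "2 * m" "(0, G 0)" _ "2 * Suc m"] by fastforce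
    next
      assume IH: "connected_in (- C) (2 * m) (0, G 0) (int m, G (int m)) \<and> int m < F (G (int m))"
      have b: "\<not> climbable C (int m) (int n)" "\<not> climbable C (int m + 1) (int n)"
        using C[of m] C[of "Suc m"] Suc.prems by (auto simp: add.commute)
      have r: "0 \<le> G (int m)" "G (int m) \<le> int n" "0 \<le> G (int m + 1)" "G (int m + 1) \<le> int n"
        using G_le[of m] G_le[of "Suc m"] Suc.prems by (auto simp: add.commute)
      have o: "(int m + 1, G (int m + 1)) \<in> - C" using surface_open[OF b(2)] by (simp add: G_def)
      define g where "g = G (int m)"
      define g' where "g' = G (int m + 1)"
      have le: "2 * Suc m = Suc (Suc (2 * m))" by simp
      have meet: ?thesis if "0 \<le> x" "x \<le> int n" "connected_in (- C) k (0, G 0) (F x, x)" "k \<le> 2 * Suc m" for x k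
        using that connected_in_mono by blast
      have c0: "connected_in (- C) (2 * m) (0, G 0) (int m, g)" and lt: "int m < F g"
        using IH by (auto simp: g_def)
      have go: ?thesis if "connected_in (- C) (Suc (Suc (2 * m))) (0, G 0) (int m + 1, g')"
        "int m + 1 \<le> F g'"
      proof (cases "F g' = int m + 1")
        case True
        then show ?thesis using that(1) r by (intro meet[of g']) (auto simp: g'_def)
      next
        case False
        then show ?thesis using that unfolding le g'_def by (intro disjI2) (simp add: add.commute)
      qed
      show ?thesis
        using b
      proof (cases rule: surface_step_cases)
        case level
        then have g': "g' = g" by (simp add: g_def g'_def G_def)
        have "connected_in (- C) (Suc (2 * m)) (0, G 0) (int m + 1, g')"
          using o g' by (intro connected_in_step[OF c0]) (auto simp: adjacent_def g'_def)
        then show ?thesis using lt g' by (intro go) (auto intro: connected_in_mono)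
      next
        case up
        then have g': "g' = g + 1" and o': "(int m, g + 1) \<in> - C" by (simp_all add: g_def g'_def G_def)
        have c1: "connected_in (- C) (Suc (2 * m)) (0, G 0) (int m, g + 1)"
          using o' by (intro connected_in_step[OF c0]) (auto simp: adjacent_def)
        have c2: "connected_in (- C) (Suc (Suc (2 * m))) (0, G 0) (int m + 1, g')"
          using o g' by (intro connected_in_step[OF c1]) (auto simp: adjacent_def g'_def)
        have "\<bar>F g - F g'\<bar> \<le> 1" using r g' by (intro lip) (auto simp: g_def g'_def)
        \<comment> \<open>A step might pass from below to above the surface of \<open>B\<close>. By
          the Lipschitz bound this happens only if the surface goes through the corner, which is
          then the meeting point; likewise in the case \<open>down\<close>.\<close>
        then consider "F g' = int m" | "int m + 1 \<le> F g'" using lt by linarith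
        then show ?thesis
        proof cases
          case 1
          then show ?thesis using c1 g' r by (intro meet[of g' "Suc (2 * m)"]) (auto simp: g'_def)
        qed (rule go[OF c2])
      next
        case down
        then have g': "g' = g - 1" and o': "(int m + 1, g) \<in> - C" by (simp_all add: g_def g'_def G_def)
        have c1: "connected_in (- C) (Suc (2 * m)) (0, G 0) (int m + 1, g)"
          using o' by (intro connected_in_step[OF c0]) (auto simp: adjacent_def)
        have c2: "connected_in (- C) (Suc (Suc (2 * m))) (0, G 0) (int m + 1, g')"
          using o g' by (intro connected_in_step[OF c1]) (auto simp: adjacent_def g'_def)
        have "\<bar>F g - F g'\<bar> \<le> 1" using r g' by (intro lip) (auto simp: g_def g'_def)
        then consider "F g = int m + 1" | "int m + 1 \<le> F g'" using lt by linarith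
        then show ?thesis
        proof cases
          case 1
          then show ?thesis using c1 r by (intro meet[of g "Suc (2 * m)"]) (auto simp: g_def)
        qed (rule go[OF c2])
      qed
    qed
  qed
  \<comment> \<open>At \<open>m = n\<close> the second alternative would force the surface of
    \<open>B\<close> above height \<open>n\<close>.\<close>
  have "\<not> int n < F (G (int n))"
    using F_le(1)[of "nat (G (int n))"] G_le[of n] by (simp add: nat_le_iff)
  then obtain x where x: "0 \<le> x" "x \<le> int n" "connected_in (- C) (2 * n) (0, G 0) (F x, x)"
    using *[of n] by auto
  have "connected_in (- B) (2 * nat x) (0, F 0) (x, F x)"
    using surface_connected[of n B n "nat x", OF B] x by (simp add: F_def)
  then have "connected_in (- B) (2 * n) (0, F 0) (x, F x)"
    by (rule connected_in_mono) (use x in auto)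
  then show ?thesis using x(3) by (auto simp: F_def G_def)
qed

text \<open>A shortest climb visits no site twice, so that its closed sites may be counted.\<close>

primrec avoiding_climb :: "nat \<Rightarrow> (int \<times> int) set \<Rightarrow> (int \<times> int) set \<Rightarrow> int \<Rightarrow> int \<Rightarrow> bool" where
  "avoiding_climb 0 C S x y \<longleftrightarrow> y < 0"
| "avoiding_climb (Suc n) C S x y \<longleftrightarrow> (x, y) \<notin> S \<and>
    (\<exists>d\<in>{-1, 0, 1}. avoiding_climb n C (insert (x, y) S) (x + d) (y + 1) \<or>
      (x, y) \<in> C \<and> avoiding_climb n C (insert (x, y) S) (x + d) (y - 1))"

lemma climb_avoiding:
  assumes "climb n C x y" "\<And>m. m < n \<Longrightarrow> \<not> climb m C x y"
    and "\<And>a b m. (a, b) \<in> S \<Longrightarrow> m \<le> n \<Longrightarrow> \<not> climb m C a b"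
  shows "avoiding_climb n C S x y"
  using assms
proof (induction n arbitrary: S x y)
  case (Suc n)
  from Suc.prems(1) obtain d where d: "d \<in> {-1, 0, 1}"
    "climb n C (x + d) (y + 1) \<or> (x, y) \<in> C \<and> climb n C (x + d) (y - 1)"
    unfolding climb.simps by blast
  have S: "(x, y) \<notin> S" using Suc.prems(1,3) by blast
  have S': "\<not> climb m C a b" if "(a, b) \<in> insert (x, y) S" "m \<le> n" for a b m
    using that Suc.prems(2)[of m] Suc.prems(3)[of a b m] by auto
  from d(2) show ?case
  proof
    assume c: "climb n C (x + d) (y + 1)"
    have "\<not> climb m C (x + d) (y + 1)" if "m < n" for m
    proof
      assume "climb m C (x + d) (y + 1)"
      then have "climb (Suc m) C x y" unfolding climb.simps using d(1) by blast
      then show False using Suc.prems(2)[of "Suc m"] that by simp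
    qed
    then have "avoiding_climb n C (insert (x, y) S) (x + d) (y + 1)" using S' by (intro Suc.IH[OF c])
    then show ?thesis unfolding avoiding_climb.simps using S d(1) by blast
  next
    assume c: "(x, y) \<in> C \<and> climb n C (x + d) (y - 1)"
    have "\<not> climb m C (x + d) (y - 1)" if "m < n" for m
    proof
      assume "climb m C (x + d) (y - 1)"
      then have "climb (Suc m) C x y" unfolding climb.simps using d(1) c by blast
      then show False using Suc.prems(2)[of "Suc m"] that by simp
    qed
    then have "avoiding_climb n C (insert (x, y) S) (x + d) (y - 1)"
      using S' c by (intro Suc.IH) auto
    then show ?thesis unfolding avoiding_climb.simps using S d(1) c by blast
  qed
qed simp

lemma climbable_avoiding: "climbable C x y \<Longrightarrow> \<exists>n. avoiding_climb n C {} x y"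
proof -
  assume "climbable C x y"
  then have ex: "\<exists>n. climb n C x y" by (simp add: climbable_def)
  show ?thesis
    by (rule exI[of _ "LEAST n. climb n C x y"], rule climb_avoiding)
       (use LeastI_ex[OF ex] not_less_Least in auto)
qed

text \<open>\<open>K\<close> collects the closed sites of the upward steps read off so far, from the
  end of the climb backwards. A climb of length \<open>n\<close> from below height 0 to height
  \<open>y\<close> has at least \<open>(n + y + 1) / 2\<close> upward steps, each to a new closed
  site of cost \<open>\<beta>^2\<close>. There are 6 possibilities per step.\<close>

lemma (in prob_space) emeasure_avoiding_climb_le:
  fixes Cl :: "'a \<Rightarrow> (int \<times> int) set"
  assumes meas [measurable]: "\<And>v. Measurable.pred M (\<lambda>\<omega>. v \<in> Cl \<omega>)"
    and \<beta>: "0 < \<beta>" "\<beta> \<le> 1"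
    and closed: "\<And>K. finite K \<Longrightarrow> emeasure M {\<omega>\<in>space M. \<forall>v\<in>K. v \<in> Cl \<omega>} \<le> ennreal (\<beta> ^ (2 * card K))"
    and "finite K" "K \<subseteq> S"
  shows "Measurable.pred M (\<lambda>\<omega>. avoiding_climb n (Cl \<omega>) S x y)"
    and "emeasure M {\<omega>\<in>space M. (\<forall>v\<in>K. v \<in> Cl \<omega>) \<and> avoiding_climb n (Cl \<omega>) S x y} \<le>
      ennreal (6 ^ n * \<beta> powi (int n + y + 1) * \<beta> ^ (2 * card K))"
proof -
  show m: "Measurable.pred M (\<lambda>\<omega>. avoiding_climb n (Cl \<omega>) S x y)" for n S x y
    by (induction n arbitrary: S x y) simp_all
  note [measurable] = m
  show "emeasure M {\<omega>\<in>space M. (\<forall>v\<in>K. v \<in> Cl \<omega>) \<and> avoiding_climb n (Cl \<omega>) S x y} \<le>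
      ennreal (6 ^ n * \<beta> powi (int n + y + 1) * \<beta> ^ (2 * card K))"
    using assms(5,6)
  proof (induction n arbitrary: K S x y)
    case 0
    show ?case
    proof (cases "y < 0")
      case True
      have "1 \<le> \<beta> powi (y + 1)"
      proof -
        have "\<beta> powi (y + 1) = inverse \<beta> ^ nat (- (y + 1))"
          using True by (simp add: power_int_def)
        also have "1 \<le> inverse \<beta> ^ nat (- (y + 1))"
          using \<beta> by (intro one_le_power) (simp add: one_le_inverse)
        finally show ?thesis .
      qed
      then have "\<beta> ^ (2 * card K) \<le> \<beta> powi (y + 1) * \<beta> ^ (2 * card K)"
        using \<beta> by (simp add: mult_le_cancel_right1)
      then show ?thesis using True closed[OF 0(1)] by (auto intro: order_trans ennreal_leI)
    qed simp
  next
    case (Suc n)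
    define K' where "K' = insert (x, y) K"
    define b where "b = 6 ^ n * \<beta> powi (int n + y + 2) * \<beta> ^ (2 * card K)"
    have b0: "0 \<le> b" using \<beta> by (simp add: b_def)
    define P where "P = (\<lambda>d. {\<omega>\<in>space M. (\<forall>v\<in>K. v \<in> Cl \<omega>) \<and> avoiding_climb n (Cl \<omega>) (insert (x, y) S) (x + d) (y + 1)})"
    define Q where "Q = (\<lambda>d. {\<omega>\<in>space M. (\<forall>v\<in>K'. v \<in> Cl \<omega>) \<and> avoiding_climb n (Cl \<omega>) (insert (x, y) S) (x + d) (y - 1)})"
    have [measurable]: "P d \<in> sets M" "Q d \<in> sets M" for d
      unfolding P_def Q_def using Suc.prems(1) by (auto simp: K'_def)
    show ?case
    proof (cases "(x, y) \<in> S")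
      case False
      \<comment> \<open>An upward step ends outside \<open>S\<close> and hence outside
        \<open>K\<close>, so it pays for a new closed site.\<close>
      then have card: "card K' = Suc (card K)" using Suc.prems unfolding K'_def by (intro card_insert_disjoint) auto
      have P: "emeasure M (P d) \<le> ennreal b" for d
        using Suc.IH[of K "insert (x, y) S" "x + d" "y + 1"] Suc.prems
        by (simp add: P_def b_def subset_insertI2 add.assoc)
      have "\<beta> powi (int n + y) * \<beta> ^ (2 * card K') = \<beta> powi (int n + y + 2) * \<beta> ^ (2 * card K)"
        using \<beta> by (simp add: card power_int_add power2_eq_square)
      then have Q: "emeasure M (Q d) \<le> ennreal b" for d
        using Suc.IH[of K' "insert (x, y) S" "x + d" "y - 1"] Suc.prems
        by (simp add: Q_def b_def K'_def subset_insertI2 mult.assoc)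
      have "emeasure M {\<omega>\<in>space M. (\<forall>v\<in>K. v \<in> Cl \<omega>) \<and> avoiding_climb (Suc n) (Cl \<omega>) S x y} \<le>
          emeasure M (\<Union>d\<in>{-1, 0, 1}. P d \<union> Q d)"
        by (intro emeasure_mono) (auto simp: P_def Q_def K'_def)
      also have "\<dots> \<le> (\<Sum>d\<in>{-1, 0, 1::int}. emeasure M (P d \<union> Q d))"
        by (intro emeasure_subadditive_finite) auto
      also have "\<dots> \<le> (\<Sum>d\<in>{-1, 0, 1::int}. ennreal b + ennreal b)"
        by (intro sum_mono order_trans[OF emeasure_subadditive] add_mono P Q) auto
      also have "\<dots> = ennreal (6 * b)" 
      proof -
        have "(\<Sum>d\<in>{-1, 0, 1::int}. ennreal b + ennreal b) = (\<Sum>d\<in>{-1, 0, 1::int}. ennreal (2 * b))"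
          using b0 by (intro sum.cong) (simp_all flip: ennreal_plus)
        also have "\<dots> = ennreal (\<Sum>d\<in>{-1, 0, 1::int}. 2 * b)" using b0 by (intro sum_ennreal) simp
        finally show ?thesis by simp
      qed
      also have "6 * b = 6 ^ Suc n * \<beta> powi (int (Suc n) + y + 1) * \<beta> ^ (2 * card K)"
        by (simp add: b_def algebra_simps)
      finally show ?thesis .
    qed simp
  qed
qed

text \<open>A union bound over the length of the climb; \<open>\<beta> \<le> 1 / 12\<close> gives a
  geometric series of ratio at most \<open>1 / 2\<close>.\<close>

lemma (in prob_space) emeasure_climbable_le:
  fixes Cl :: "'a \<Rightarrow> (int \<times> int) set"
  assumes meas [measurable]: "\<And>v. Measurable.pred M (\<lambda>\<omega>. v \<in> Cl \<omega>)"
    and \<beta>: "0 < \<beta>" "\<beta> \<le> 1 / 12"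
    and closed: "\<And>K. finite K \<Longrightarrow> emeasure M {\<omega>\<in>space M. \<forall>v\<in>K. v \<in> Cl \<omega>} \<le> ennreal (\<beta> ^ (2 * card K))"
  shows "emeasure M {\<omega>\<in>space M. climbable (Cl \<omega>) x (int h)} \<le> ennreal (2 * \<beta> ^ Suc h)"
proof -
  have \<beta>1: "\<beta> \<le> 1" using \<beta> by simp
  note av = emeasure_avoiding_climb_le[OF meas \<beta>(1) \<beta>1 closed, of "{}" "{}"]
  let ?A = "\<lambda>n. {\<omega>\<in>space M. avoiding_climb n (Cl \<omega>) {} x (int h)}"
  have [measurable]: "?A n \<in> sets M" for n using av(1)[of n x "int h"] by simp
  have "emeasure M {\<omega>\<in>space M. climbable (Cl \<omega>) x (int h)} \<le> emeasure M (\<Union>n. ?A n)"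
    by (intro emeasure_mono) (auto dest: climbable_avoiding)
  also have "\<dots> \<le> (\<Sum>n. emeasure M (?A n))" by (intro emeasure_subadditive_countably) auto
  also have "\<dots> \<le> (\<Sum>n. ennreal ((1 / 2) ^ n * \<beta> ^ Suc h))"
  proof (intro suminf_le)
    fix n
    have "emeasure M (?A n) \<le> ennreal (6 ^ n * \<beta> powi (int n + int h + 1))" using av(2)[of n x "int h"] by simp
    also have "\<beta> powi (int n + int h + 1) = \<beta> ^ n * \<beta> ^ Suc h"
    proof -
      have "int n + int h + 1 = int (n + Suc h)" by simp
      then show ?thesis unfolding power_add[symmetric] by (metis power_int_of_nat)
    qed
    also have "6 ^ n * (\<beta> ^ n * \<beta> ^ Suc h) = (6 * \<beta>) ^ n * \<beta> ^ Suc h" by (simp add: power_mult_distrib)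
    also have "ennreal \<dots> \<le> ennreal ((1 / 2) ^ n * \<beta> ^ Suc h)"
      using \<beta> by (intro ennreal_leI mult_right_mono power_mono) auto
    finally show "emeasure M (?A n) \<le> ennreal ((1 / 2) ^ n * \<beta> ^ Suc h)" .
  qed auto
  also have "\<dots> = ennreal (2 * \<beta> ^ Suc h)"
  proof (rule suminf_ennreal_eq)
    show "(\<lambda>n. (1 / 2) ^ n * \<beta> ^ Suc h) sums (2 * \<beta> ^ Suc h)"
      using sums_mult2[OF geometric_sums[of "1 / 2 :: real"], of "\<beta> ^ Suc h"] by simp
  qed (use \<beta> in auto)
  finally show ?thesis .
qed

lemma climbable_measurable:
  assumes [measurable]: "\<And>v. Measurable.pred M (\<lambda>\<omega>. v \<in> Cl \<omega>)"
  shows "Measurable.pred M (\<lambda>\<omega>. climbable (Cl \<omega>) x y)"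
proof -
  have "Measurable.pred M (\<lambda>\<omega>. climb n (Cl \<omega>) x y)" for n
    by (induction n arbitrary: x y) simp_all
  then show ?thesis unfolding climbable_def by measurable
qed

lemma surface_measurable:
  assumes "\<And>v. Measurable.pred M (\<lambda>\<omega>. v \<in> Cl \<omega>)"
  shows "(\<lambda>\<omega>. surface (Cl \<omega>) x) \<in> M \<rightarrow>\<^sub>M count_space UNIV"
  unfolding surface_def using climbable_measurable[OF assms] by measurable

section \<open>Blocks and vacant paths\<close>

definition center :: "'d::finite \<Rightarrow> 'd \<Rightarrow> int \<times> int \<Rightarrow> 'd site" where
  "center i j p = (\<chi> k. if k = i then 3 * fst p else if k = j then 3 * snd p else 0)"

text \<open>Cubes of side 3 in all dimensions: they contain all neighbours of their centre, and for
  \<open>i \<noteq> j\<close> different blocks are disjoint, so that several closed blocks require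
  several traps.\<close>

definition block :: "'d::finite \<Rightarrow> 'd \<Rightarrow> int \<times> int \<Rightarrow> 'd site set" where
  "block i j p = {z. \<forall>k. \<bar>z $ k - center i j p $ k\<bar> \<le> 1}"

definition closed_blocks :: "'d::finite \<Rightarrow> 'd \<Rightarrow> 'd env \<Rightarrow> nat \<Rightarrow> (int \<times> int) set" where
  "closed_blocks i j \<xi> t = {p. \<exists>z\<in>block i j p. \<xi> (z, t)}"

lemma block_disjoint:
  assumes "i \<noteq> j" "z \<in> block i j p" "z \<in> block i j q"
  shows "p = q"
proof -
  have "\<bar>z $ i - 3 * fst p\<bar> \<le> 1" "\<bar>z $ i - 3 * fst q\<bar> \<le> 1"
    "\<bar>z $ j - 3 * snd p\<bar> \<le> 1" "\<bar>z $ j - 3 * snd q\<bar> \<le> 1"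
    using assms by (auto simp: block_def center_def dest!: spec[of _ i] spec[of _ j] split: if_splits)
  then show ?thesis by (auto simp: prod_eq_iff)
qed

lemma block_bound:
  shows "finite (block i j p :: 'd::finite site set)"
    and "card (block i j p :: 'd site set) \<le> 3 ^ CARD('d)"
  unfolding block_def using box_bound[of "center i j p :: 'd site" 1] by simp_all

lemma avg_pow_has_sum:
  assumes "(f has_sum s) UNIV"
  shows "((avg ^^ n) f has_sum s) UNIV"
  using assms by (induction n) (auto intro: has_sum_avg)

text \<open>Stationarity of the Poisson system: averaging preserves the total mass of the indicator
  of \<open>W\<close>, so the bound depends neither on \<open>t\<close> nor on
  \<open>Y\<close>.\<close>

lemma trap_product_count_le:
  fixes W :: "'d::finite site set"
  assumes W: "finite W" and Y: "finite Y" and l: "0 \<le> \<alpha>" and u: "0 \<le> u"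
  shows "(\<integral>\<^sup>+ \<omega>. ennreal (trap_product Y (\<lambda>x. 1 + \<alpha> * of_bool (x \<in> W)) t \<omega>) \<partial>trap_measure u) \<le>
    ennreal (exp (u * \<alpha> * card W))"
proof -
  let ?g = "\<lambda>x :: 'd site. of_bool (x \<in> W) :: real"
  have "(?g has_sum real (card W)) W" by (rule has_sum_finiteI[OF W]) simp
  then have "(?g has_sum real (card W)) UNIV"
    by (rule has_sum_cong_neutral[THEN iffD1, rotated -1]) auto
  then have "((avg ^^ t) ?g has_sum real (card W)) UNIV" by (rule avg_pow_has_sum)
  then have le: "(\<Sum>y\<in>Y. (avg ^^ t) ?g y) \<le> card W"
    by (rule finite_sum_le_has_sum) (auto intro: Y avg_pow_nonneg)
  have "(\<integral>\<^sup>+ \<omega>. ennreal (trap_product Y (\<lambda>x. 1 + \<alpha> * ?g x) t \<omega>) \<partial>trap_measure u) =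
      ennreal (exp (u * (\<Sum>y\<in>Y. (avg ^^ t) (\<lambda>x. 1 + \<alpha> * ?g x) y - 1)))"
    using l by (intro trap_product_laplace Y u) simp
  also have "(\<Sum>y\<in>Y. (avg ^^ t) (\<lambda>x. 1 + \<alpha> * ?g x) y - 1) = \<alpha> * (\<Sum>y\<in>Y. (avg ^^ t) ?g y)"
    by (simp add: avg_pow_affine sum_distrib_left)
  also have "ennreal (exp (u * (\<alpha> * (\<Sum>y\<in>Y. (avg ^^ t) ?g y)))) \<le> ennreal (exp (u * \<alpha> * card W))"
    using le l u by (intro ennreal_leI) (simp add: mult_left_mono mult.assoc)
  finally show ?thesis .
qed

text \<open>Disjoint blocks are hit by different labels; each of these gives a factor
  \<open>1 + \<alpha>\<close>, and every other factor is at least 1.\<close>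

lemma trap_product_ge:
  assumes Y: "finite Y" and K: "finite K" and l: "0 \<le> \<alpha>"
    and disj: "\<And>p q z. p \<in> K \<Longrightarrow> q \<in> K \<Longrightarrow> z \<in> B p \<Longrightarrow> z \<in> B q \<Longrightarrow> p = q"
    and hit: "\<And>p. p \<in> K \<Longrightarrow> \<exists>y\<in>Y. \<exists>i<fst \<omega> y. trap_position \<omega> (y, i) t \<in> B p"
  shows "(1 + \<alpha>) ^ card K \<le> trap_product Y (\<lambda>x. 1 + \<alpha> * of_bool (x \<in> (\<Union>p\<in>K. B p))) t \<omega>"
proof -
  let ?f = "\<lambda>x. 1 + \<alpha> * of_bool (x \<in> (\<Union>p\<in>K. B p))"
  let ?L = "Sigma Y (\<lambda>y. {..<fst \<omega> y})"
  have "\<exists>l. l \<in> ?L \<and> trap_position \<omega> l t \<in> B p" if "p \<in> K" for p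
    using hit[OF that] by auto
  then obtain g where g: "\<And>p. p \<in> K \<Longrightarrow> g p \<in> ?L" "\<And>p. p \<in> K \<Longrightarrow> trap_position \<omega> (g p) t \<in> B p"
    by metis
  have inj: "inj_on g K" using disj g(2) by (metis inj_onI)
  have "(1 + \<alpha>) ^ card K = (\<Prod>p\<in>K. ?f (trap_position \<omega> (g p) t))"
    using g(2) by (subst prod.cong[OF refl, where h = "\<lambda>_. 1 + \<alpha>"]) auto
  also have "\<dots> = (\<Prod>l\<in>g ` K. ?f (trap_position \<omega> l t))" using inj by (simp add: prod.reindex)
  also have "\<dots> \<le> (\<Prod>l\<in>?L. ?f (trap_position \<omega> l t))"
  proof (rule prod_mono2)
    show "finite ?L" using Y by auto
    show "g ` K \<subseteq> ?L" using g(1) by blast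
  qed (use l in auto)
  also have "\<dots> = trap_product Y ?f t \<omega>"
    using Y by (simp add: trap_product_def prod.Sigma case_prod_beta')
  finally show ?thesis .
qed

text \<open>Markov's inequality for the product functional. As this functional sees finitely many
  starting sites, the event is exhausted by an increasing sequence \<open>E n\<close> with starting
  sites in \<open>Y n\<close>.\<close>

lemma emeasure_closed_blocks_le:
  fixes i j :: "'d::finite"
  assumes "i \<noteq> j" and K: "finite K" and u: "0 \<le> u" and l: "0 \<le> \<alpha>"
  shows "emeasure (trap_measure u) {\<omega>. \<forall>p\<in>K. p \<in> closed_blocks i j (environment \<omega>) t} \<le>
    ennreal ((exp (u * \<alpha> * 3 ^ CARD('d)) / (1 + \<alpha>)) ^ card K)"
proof -
  let ?M = "trap_measure u :: 'd traps measure"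
  define W where "W = (\<Union>p\<in>K. block i j p)"
  define Y where "Y = (\<lambda>n. {y :: 'd site. to_nat y < n})"
  have finY: "finite (Y n)" for n
    unfolding Y_def by (rule finite_imageD[of to_nat]) (auto intro: finite_subset[of _ "{..<n}"] inj_on_subset[OF inj_to_nat])
  have finW: "finite W" using K by (simp add: W_def block_bound)
  have "card W \<le> (\<Sum>p\<in>K. card (block i j p))" unfolding W_def by (rule card_UN_le[OF K])
  also have "\<dots> \<le> (\<Sum>p\<in>K. 3 ^ CARD('d))" by (intro sum_mono block_bound)
  finally have "real (card W) \<le> real (card K * 3 ^ CARD('d))" unfolding of_nat_le_iff by simp
  then have cardW: "real (card W) \<le> 3 ^ CARD('d) * real (card K)" by (simp add: mult.commute)
  define E where "E = (\<lambda>n. {\<omega>\<in>space ?M. \<forall>p\<in>K. \<exists>z\<in>block i j p. \<exists>y\<in>Y n. \<exists>i<fst \<omega> y. trap_position \<omega> (y, i) t = z})"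
  have E_sets [measurable]: "E n \<in> sets ?M" for n
  proof -
    have "E n = {\<omega>\<in>space ?M. \<forall>p\<in>K. \<exists>z\<in>block i j p. \<exists>y\<in>Y n. \<exists>i. i < fst \<omega> y \<and> trap_position \<omega> (y, i) t = z}"
      by (auto simp: E_def)
    also have "\<dots> \<in> sets ?M"
      using K finY[of n] block_bound(1) by measurable
    finally show ?thesis .
  qed
  have bound: "emeasure ?M (E n) \<le> ennreal ((exp (u * \<alpha> * 3 ^ CARD('d)) / (1 + \<alpha>)) ^ card K)" for n
  proof -
    let ?f = "\<lambda>x. 1 + \<alpha> * of_bool (x \<in> W)"
    have [measurable]: "trap_product (Y n) ?f t \<in> borel_measurable ?M" by (rule measurable_trap_product[OF finY])
    have "emeasure ?M (E n) = (\<integral>\<^sup>+ \<omega>. indicator (E n) \<omega> \<partial>?M)" by simp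
    also have "\<dots> \<le> (\<integral>\<^sup>+ \<omega>. ennreal (1 / (1 + \<alpha>) ^ card K) * ennreal (trap_product (Y n) ?f t \<omega>) \<partial>?M)"
    proof (rule nn_integral_mono)
      fix \<omega>
      have "1 \<le> 1 / (1 + \<alpha>) ^ card K * trap_product (Y n) ?f t \<omega>" if "\<omega> \<in> E n"
      proof -
        have "(1 + \<alpha>) ^ card K \<le> trap_product (Y n) ?f t \<omega>"
          unfolding W_def
        proof (rule trap_product_ge[OF finY K l])
          show "\<exists>y\<in>Y n. \<exists>i'<fst \<omega> y. trap_position \<omega> (y, i') t \<in> block i j p" if "p \<in> K" for p
            using \<open>\<omega> \<in> E n\<close> that by (fastforce simp: E_def)
        qed (rule block_disjoint[OF assms(1)])
        then show ?thesis using l by (simp add: field_simps)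
      qed
      then show "indicator (E n) \<omega> \<le> ennreal (1 / (1 + \<alpha>) ^ card K) * ennreal (trap_product (Y n) ?f t \<omega>)"
        using l by (auto simp: indicator_def ennreal_mult[symmetric] trap_product_nonneg)
    qed
    also have "\<dots> = ennreal (1 / (1 + \<alpha>) ^ card K) * (\<integral>\<^sup>+ \<omega>. ennreal (trap_product (Y n) ?f t \<omega>) \<partial>?M)"
      by (rule nn_integral_cmult) measurable
    also have "\<dots> \<le> ennreal (1 / (1 + \<alpha>) ^ card K) * ennreal (exp (u * \<alpha> * card W))"
      by (intro mult_left_mono trap_product_count_le finW finY l u) simp
    also have "\<dots> \<le> ennreal (1 / (1 + \<alpha>) ^ card K) * ennreal (exp (real (card K) * (u * \<alpha> * 3 ^ CARD('d))))"
    proof -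
      have "u * \<alpha> * card W \<le> u * \<alpha> * (3 ^ CARD('d) * real (card K))" using cardW l u by (intro mult_left_mono) auto
      then show ?thesis by (intro mult_left_mono ennreal_leI) (auto simp: mult_ac)
    qed
    also have "\<dots> = ennreal ((exp (u * \<alpha> * 3 ^ CARD('d)) / (1 + \<alpha>)) ^ card K)"
      using l by (simp add: ennreal_mult[symmetric] exp_of_nat_mult power_divide)
    finally show ?thesis .
  qed
  have "{\<omega>. \<forall>p\<in>K. p \<in> closed_blocks i j (environment \<omega>) t} \<subseteq> (\<Union>n. E n)"
  proof
    fix \<omega> assume \<omega>: "\<omega> \<in> {\<omega>. \<forall>p\<in>K. p \<in> closed_blocks i j (environment \<omega>) t}"
    then have "\<exists>y. \<exists>i'<fst \<omega> y. trap_position \<omega> (y, i') t \<in> block i j p" if "p \<in> K" for p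
      using that by (fastforce simp: closed_blocks_def environment_def)
    then obtain y where y: "\<And>p. p \<in> K \<Longrightarrow> \<exists>i'<fst \<omega> (y p). trap_position \<omega> (y p, i') t \<in> block i j p"
      by metis
    define n where "n = Suc (\<Sum>p\<in>K. to_nat (y p))"
    have "y p \<in> Y n" if "p \<in> K" for p
      using member_le_sum[of p K "\<lambda>p. to_nat (y p)"] K that by (simp add: Y_def n_def less_Suc_eq_le)
    then have "\<omega> \<in> E n" using y unfolding E_def by fastforce
    then show "\<omega> \<in> (\<Union>n. E n)" by blast
  qed
  then have "emeasure ?M {\<omega>. \<forall>p\<in>K. p \<in> closed_blocks i j (environment \<omega>) t} \<le> emeasure ?M (\<Union>n. E n)"
    by (rule emeasure_mono) auto
  also have "\<dots> = (SUP n. emeasure ?M (E n))"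
  proof (rule SUP_emeasure_incseq[symmetric])
    show "incseq E" unfolding incseq_def E_def Y_def by fastforce
  qed auto
  also have "\<dots> \<le> ennreal ((exp (u * \<alpha> * 3 ^ CARD('d)) / (1 + \<alpha>)) ^ card K)"
    by (rule SUP_least) (rule bound)
  finally show ?thesis .
qed

text \<open>Recorded as a property of environments because the sample space contains increments of
  any length; those of norm other than 1 have probability 0.\<close>

definition consistent :: "'d::finite env \<Rightarrow> bool" where
  "consistent \<xi> \<longleftrightarrow> (\<forall>x t. \<xi> (x, Suc t) \<longrightarrow> (\<exists>e. l1_norm e = 1 \<and> \<xi> (x - e, t)))"

lemma AE_consistent: "AE \<omega> in trap_measure u. consistent (environment (\<omega> :: 'd::finite traps))"
proof -
  let ?M = "trap_measure u :: 'd traps measure"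
  let ?S = "step_space :: (('d site \<times> nat) \<times> nat \<Rightarrow> 'd site) measure"
  interpret B: prob_space ?S
    by (rule prob_space_step_space)
  have "AE \<omega> in ?M. l1_norm (snd \<omega> c) = 1" for c
  proof (rule AE_I)
    let ?A = "{\<omega>\<in>space ?M. \<not> l1_norm (snd \<omega> c) = 1}"
    show A [measurable]: "?A \<in> sets ?M" 
    proof -
      have [measurable]: "Measurable.pred ?M (\<lambda>\<omega>. \<not> l1_norm (snd \<omega> c) = 1)"
        by (rule measurable_compose[OF measurable_snd_trap_step]) simp
      show ?thesis by measurable
    qed
    have "emeasure ?M ?A = (\<integral>\<^sup>+ \<omega>. of_bool (\<not> l1_norm (snd \<omega> c) = 1) \<partial>?M)"
      unfolding nn_integral_indicator[OF A, symmetric] by (intro nn_integral_cong) (simp add: indicator_def)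
    also have "\<dots> = (\<integral>\<^sup>+ N. \<integral>\<^sup>+ Z. of_bool (\<not> l1_norm (Z c) = 1) \<partial>?S
        \<partial>(count_measure u :: ('d site \<Rightarrow> nat) measure))"
      unfolding trap_measure_eq
    proof (subst B.nn_integral_fst[symmetric])
      have "(\<lambda>\<omega>. of_bool (\<not> l1_norm (snd \<omega> c) = 1) :: ennreal) \<in> borel_measurable ?M"
        by (rule measurable_compose[OF measurable_snd_trap_step]) simp
      then show "(\<lambda>\<omega>. of_bool (\<not> l1_norm (snd \<omega> c) = 1) :: ennreal) \<in> borel_measurable (count_measure u \<Otimes>\<^sub>M step_space)"
        by (simp add: trap_measure_eq)
    qed simp
    also have "(\<lambda>N :: 'd site \<Rightarrow> nat. \<integral>\<^sup>+ Z. of_bool (\<not> l1_norm (Z c) = 1) \<partial>?S) = (\<lambda>_. 0)"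
    proof
      have "(\<integral>\<^sup>+ Z. of_bool (\<not> l1_norm (Z c) = 1) \<partial>?S) =
          (\<integral>\<^sup>+ Z. \<integral>\<^sup>+ e. of_bool (\<not> l1_norm (e :: 'd site) = 1) \<partial>measure_pmf srw_step_pmf \<partial>?S)"
      proof (subst nn_integral_step_resample[where c = c])
        show "(\<lambda>Z. of_bool (\<not> l1_norm (Z c) = 1) :: ennreal) \<in>
            borel_measurable ?S"
          by (rule measurable_compose[OF measurable_step]) simp
      qed simp
      also have "(\<integral>\<^sup>+ e. of_bool (\<not> l1_norm (e :: 'd site) = 1) \<partial>measure_pmf srw_step_pmf) = 0"
        unfolding srw_step_pmf_def
        by (subst nn_integral_pmf_of_set[OF unit_steps_nonempty finite_unit_steps]) simp
      finally show "(\<integral>\<^sup>+ Z. of_bool (\<not> l1_norm (Z c) = 1) \<partial>?S) = 0"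
        by simp
    qed
    finally show "emeasure ?M ?A = 0" by simp
  qed auto
  then have "AE \<omega> in ?M. \<forall>c. l1_norm (snd \<omega> c) = 1" by (simp add: AE_all_countable)
  then show ?thesis
  proof eventually_elim
    case (elim \<omega>)
    show ?case unfolding consistent_def
    proof (intro allI impI)
      fix x t assume "environment \<omega> (x, Suc t)"
      then obtain y i where yi: "i < fst \<omega> y" "trap_position \<omega> (y, i) t + snd \<omega> ((y, i), t) = x"
        by (auto simp: environment_def trap_position_Suc)
      then have "environment \<omega> (x - snd \<omega> ((y, i), t), t)"
        unfolding environment_def by (auto intro!: exI[of _ y] exI[of _ i])
      then show "\<exists>e. l1_norm e = 1 \<and> environment \<omega> (x - e, t)"
        using elim by blast
    qed
  qed
qed

section \<open>Vacant paths along open blocks\<close>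

definition site_path :: "'d::finite site set \<Rightarrow> 'd site \<Rightarrow> 'd site \<Rightarrow> 'd site list \<Rightarrow> bool" where
  "site_path V x y ps \<longleftrightarrow> ps \<noteq> [] \<and> hd ps = x \<and> last ps = y \<and> set ps \<subseteq> V \<and>
    successively (\<lambda>a b. l1_norm (b - a) = 1) ps"

lemma l1_norm_minus_commute: "l1_norm (x - y) = l1_norm (y - x)"
  by (simp add: l1_norm_def abs_minus_commute)

lemma site_path_mono: "site_path V x y ps \<Longrightarrow> V \<subseteq> W \<Longrightarrow> site_path W x y ps"
  by (auto simp: site_path_def)

lemma site_path_single: "x \<in> V \<Longrightarrow> site_path V x x [x]"
  by (simp add: site_path_def)

lemma site_path_append:
  assumes "site_path V x y ps" "site_path V y z qs"
  shows "site_path V x z (ps @ tl qs)" "length (ps @ tl qs) = length ps + length qs - 1"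
proof -
  obtain qs' where qs: "qs = y # qs'" using assms(2) by (cases qs) (auto simp: site_path_def)
  show "site_path V x z (ps @ tl qs)"
    using assms unfolding qs site_path_def
    by (cases qs') (auto simp: successively_append_iff)
  show "length (ps @ tl qs) = length ps + length qs - 1" by (simp add: qs)
qed

lemma site_path_rev: "site_path V x y ps \<Longrightarrow> site_path V y x (rev ps)"
  by (auto simp: site_path_def hd_rev last_rev l1_norm_minus_commute)

lemma unit_vec_nth: "unit_vec i $ k = (if k = i then 1 else 0)"
  by (simp add: unit_vec_def axis_def)

text \<open>A coordinate of modulus 2 in the sum requires both vectors to have their whole norm in
  that coordinate, with the same sign.\<close>

lemma unit_step_cases:
  fixes e e' :: "int ^ 'd::finite"
  assumes "l1_norm e = 1" "l1_norm e' \<le> 1"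
  shows "e' = e \<or> (\<forall>k. \<bar>e $ k + e' $ k\<bar> \<le> 1)"
proof (rule disjCI)
  assume "\<not> (\<forall>k. \<bar>e $ k + e' $ k\<bar> \<le> 1)"
  then obtain k where k: "\<bar>e $ k + e' $ k\<bar> > 1" by (auto simp: not_le)
  have split: "l1_norm f = \<bar>f $ k\<bar> + (\<Sum>m\<in>UNIV - {k}. \<bar>f $ m\<bar>)" for f :: "int ^ 'd"
    unfolding l1_norm_def by (simp add: sum.remove)
  have nn: "0 \<le> (\<Sum>m\<in>UNIV - {k}. \<bar>f $ m\<bar>)" for f :: "int ^ 'd" by (simp add: sum_nonneg)
  have "\<bar>e $ k\<bar> \<le> 1" "\<bar>e' $ k\<bar> \<le> 1" using assms split[of e] split[of e'] nn[of e] nn[of e'] by linarith+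
  then have k1: "e $ k = e' $ k" "\<bar>e $ k\<bar> = 1" "\<bar>e' $ k\<bar> = 1" using k by linarith+
  then have "(\<Sum>m\<in>UNIV - {k}. \<bar>e $ m\<bar>) = 0" "(\<Sum>m\<in>UNIV - {k}. \<bar>e' $ m\<bar>) = 0"
    using assms split[of e] split[of e'] nn[of e] nn[of e'] by linarith+
  then have "\<forall>m\<in>UNIV - {k}. e $ m = 0" "\<forall>m\<in>UNIV - {k}. e' $ m = 0" by (simp_all add: sum_nonneg_eq_0_iff)
  then show "e' = e" using k1(1) by (metis DiffI UNIV_I singletonD vec_eq_iff)
qed

text \<open>With \<open>S\<close> the open blocks of time \<open>t\<close>, such sites have no trap
  within one step, hence they are vacant at time \<open>t\<close> and, in a consistent environment,
  at time \<open>t + 1\<close> too.\<close>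

definition shielded :: "'d::finite \<Rightarrow> 'd \<Rightarrow> (int \<times> int) set \<Rightarrow> 'd site set" where
  "shielded i j S = {w. \<forall>e. l1_norm e \<le> 1 \<longrightarrow> w + e \<in> (\<Union>p\<in>S. block i j p)}"

lemma center_shielded: "p \<in> S \<Longrightarrow> center i j p \<in> shielded i j S"
  using order_trans[OF l1_norm_component_le] by (force simp: shielded_def block_def)

lemma center_adjacent:
  assumes "i \<noteq> j" "adjacent p q"
  shows "\<exists>e. l1_norm e = 1 \<and> center i j q = center i j p + (e + e + e)"
proof -
  obtain a b where p: "p = (a, b)" by (cases p)
  have "q = (a + 1, b) \<or> q = (a - 1, b) \<or> q = (a, b + 1) \<or> q = (a, b - 1)"
    using assms(2) by (cases q) (auto simp: adjacent_def p)
  then consider "q = (a + 1, b)" | "q = (a - 1, b)" | "q = (a, b + 1)" | "q = (a, b - 1)" by blast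
  then show ?thesis
  proof cases
    case 1 then show ?thesis using assms(1)
      by (intro exI[of _ "unit_vec i"]) (simp add: unit_vec_step p vec_eq_iff center_def unit_vec_nth)
  next
    case 2 then show ?thesis using assms(1)
      by (intro exI[of _ "- unit_vec i"]) (simp add: unit_vec_step p vec_eq_iff center_def unit_vec_nth)
  next
    case 3 then show ?thesis using assms(1)
      by (intro exI[of _ "unit_vec j"]) (simp add: unit_vec_step p vec_eq_iff center_def unit_vec_nth)
  next
    case 4 then show ?thesis using assms(1)
      by (intro exI[of _ "- unit_vec j"]) (simp add: unit_vec_step p vec_eq_iff center_def unit_vec_nth)
  qed
qed

text \<open>One step from the centre of \<open>p\<close> towards \<open>q\<close>, the closed
  neighbourhood still lies in the block of \<open>p\<close>, apart from the next site ahead, which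
  belongs to the block of \<open>q\<close>.\<close>

lemma center_step_shielded:
  fixes e :: "'d::finite site"
  assumes "l1_norm e = 1" "center i j q = center i j p + (e + e + e)" "p \<in> S" "q \<in> S"
  shows "center i j p + e \<in> shielded i j S"
  unfolding shielded_def
proof (intro CollectI allI impI)
  fix e' :: "'d site" assume "l1_norm e' \<le> 1"
  with assms(1) have "e' = e \<or> (\<forall>k. \<bar>e $ k + e' $ k\<bar> \<le> 1)" by (rule unit_step_cases)
  then show "center i j p + e + e' \<in> (\<Union>p\<in>S. block i j p)"
  proof
    assume "e' = e"
    then have "center i j p + e + e' \<in> block i j q"
      using l1_norm_component_le[of e] assms(1,2) by (simp add: block_def)
    then show ?thesis using assms(4) by blast
  next
    assume "\<forall>k. \<bar>e $ k + e' $ k\<bar> \<le> 1"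
    then have "center i j p + e + e' \<in> block i j p" by (simp add: block_def add.assoc)
    then show ?thesis using assms(3) by blast
  qed
qed

lemma connected_in_site_path:
  assumes ij: "i \<noteq> j" and "connected_in S n p q"
  shows "\<exists>ps. site_path (shielded i j S) (center i j p) (center i j q) ps \<and> length ps \<le> 3 * n + 1 \<and> q \<in> S"
  using assms(2)
proof induction
  case (connected_in_refl p n)
  then show ?case
    by (intro exI[of _ "[center i j p]"]) (simp add: site_path_single center_shielded)
next
  case (connected_in_step n p q r)
  then obtain ps where ps: "site_path (shielded i j S) (center i j p) (center i j q) ps" "length ps \<le> 3 * n + 1"
    and q: "q \<in> S" by blast
  obtain e where e: "l1_norm e = 1" "center i j r = center i j q + (e + e + e)"
    using center_adjacent[OF ij connected_in_step.hyps(2)] by blast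
  have r: "r \<in> S" by (rule connected_in_step.hyps)
  have e': "l1_norm (- e) = 1" "center i j q = center i j r + (- e + - e + - e)"
    using e by (simp_all add: l1_norm_def)
  define qs where "qs = [center i j q, center i j q + e, center i j q + (e + e), center i j r]"
  \<comment> \<open>Seen from \<open>r\<close>, this site is again one step away from a
    centre.\<close>
  have mid: "center i j q + (e + e) = center i j r + - e" using e(2) by simp
  have "center i j q + (e + e) \<in> shielded i j S" unfolding mid by (rule center_step_shielded[OF e' r q])
  then have "set qs \<subseteq> shielded i j S"
    unfolding qs_def using center_shielded[OF q, of i j] center_shielded[OF r, of i j] center_step_shielded[OF e q r]
    by (simp del: mult_2)
  then have "site_path (shielded i j S) (center i j q) (center i j r) qs"
    using e by (simp add: site_path_def qs_def)
  from site_path_append[OF ps(1) this] ps(2) r show ?case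
    by (intro exI[of _ "ps @ tl qs"]) (simp add: qs_def)
qed

definition vacant :: "'d env \<Rightarrow> nat \<Rightarrow> 'd site set" where
  "vacant \<xi> t = {x. \<not> \<xi> (x, t)}"

lemma shielded_vacant: "shielded i j (- closed_blocks i j \<xi> t) \<subseteq> vacant \<xi> t"
proof
  fix w assume "w \<in> shielded i j (- closed_blocks i j \<xi> t)"
  then have "w + 0 \<in> (\<Union>p\<in>- closed_blocks i j \<xi> t. block i j p)" unfolding shielded_def by (metis (mono_tags) CollectD l1_norm_0 zero_le_one)
  then show "w \<in> vacant \<xi> t" by (auto simp: closed_blocks_def vacant_def)
qed

lemma shielded_vacant_Suc:
  assumes "consistent \<xi>"
  shows "shielded i j (- closed_blocks i j \<xi> t) \<subseteq> vacant \<xi> (Suc t)"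
proof (rule subsetI, rule ccontr)
  fix w assume w: "w \<in> shielded i j (- closed_blocks i j \<xi> t)" "w \<notin> vacant \<xi> (Suc t)"
  then obtain e where e: "l1_norm e = 1" "\<xi> (w - e, t)" using assms by (auto simp: consistent_def vacant_def)
  then have "l1_norm (- e) \<le> 1" by (simp add: l1_norm_def)
  then have "w + - e \<in> (\<Union>p\<in>- closed_blocks i j \<xi> t. block i j p)" using w(1) unfolding shielded_def by blast
  then show False using e(2) by (auto simp: closed_blocks_def)
qed

text \<open>Each of the two connections has at most \<open>2 * n\<close> block steps of 3 site
  steps; the meeting site is shared and counted once, which gives \<open>12 * n + 1\<close>
  sites.\<close>

lemma vacant_crossing:
  assumes ij: "i \<noteq> j" and cons: "consistent \<xi>"
    and B: "\<And>x. x \<le> n \<Longrightarrow> \<not> climbable (closed_blocks i j \<xi> t) (int x) (int n)"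
    and C: "\<And>x. x \<le> n \<Longrightarrow> \<not> climbable (closed_blocks j i \<xi> (Suc t)) (int x) (int n)"
  shows "\<exists>ps. site_path (vacant \<xi> (Suc t)) (center i j (0, int (surface (closed_blocks i j \<xi> t) 0)))
    (center j i (0, int (surface (closed_blocks j i \<xi> (Suc t)) 0))) ps \<and> length ps \<le> 12 * n + 1"
proof -
  let ?B = "closed_blocks i j \<xi> t" and ?C = "closed_blocks j i \<xi> (Suc t)"
  from surfaces_meet[of n ?B ?C, OF B C] obtain x y
    where *: "connected_in (- ?B) (2 * n) (0, int (surface ?B 0)) (x, y)"
      "connected_in (- ?C) (2 * n) (0, int (surface ?C 0)) (y, x)" by blast
  obtain ps where ps: "site_path (shielded i j (- ?B)) (center i j (0, int (surface ?B 0))) (center i j (x, y)) ps"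
    "length ps \<le> 3 * (2 * n) + 1"
    using connected_in_site_path[OF ij *(1)] by blast
  obtain qs where qs: "site_path (shielded j i (- ?C)) (center j i (0, int (surface ?C 0))) (center j i (y, x)) qs"
    "length qs \<le> 3 * (2 * n) + 1"
    using connected_in_site_path[OF ij[symmetric] *(2)] by blast
  have eq: "center j i (y, x) = center i j (x, y)" using ij by (auto simp: center_def vec_eq_iff)
  note ps' = site_path_mono[OF ps(1) shielded_vacant_Suc[OF cons]]
  note qs' = site_path_rev[OF site_path_mono[OF qs(1) shielded_vacant]]
  from site_path_append[OF ps' qs'[unfolded eq]] ps(2) qs(2) show ?thesis
    by (intro exI[of _ "ps @ tl (rev qs)"]) simp
qed

lemma ex_site_path: "\<exists>ps. site_path UNIV x y ps \<and> int (length ps) = l1_norm (y - x) + 1"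
proof (induction "nat (l1_norm (y - x))" arbitrary: x)
  case 0
  then have "l1_norm (y - x) = 0" using l1_norm_nonneg[of "y - x"] by simp
  then have "y = x" by (simp add: l1_norm_zero_iff)
  then show ?case by (intro exI[of _ "[x]"]) (simp add: site_path_single)
next
  case (Suc n)
  then have "l1_norm (y - x) \<noteq> 0" by auto
  then obtain k where k: "(y - x) $ k \<noteq> 0" by (auto simp: l1_norm_zero_iff vec_eq_iff)
  define e where "e = (if (y - x) $ k > 0 then unit_vec k else - unit_vec k)"
  have e: "l1_norm e = 1" by (simp add: e_def unit_vec_step)
  have "l1_norm (y - x) = \<bar>(y - x) $ k\<bar> + (\<Sum>m\<in>UNIV - {k}. \<bar>(y - x) $ m\<bar>)"
    unfolding l1_norm_def by (rule sum.remove) auto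
  moreover have "l1_norm (y - (x + e)) = \<bar>(y - (x + e)) $ k\<bar> + (\<Sum>m\<in>UNIV - {k}. \<bar>(y - (x + e)) $ m\<bar>)"
    unfolding l1_norm_def by (rule sum.remove) auto
  moreover have "(\<Sum>m\<in>UNIV - {k}. \<bar>(y - (x + e)) $ m\<bar>) = (\<Sum>m\<in>UNIV - {k}. \<bar>(y - x) $ m\<bar>)"
    by (intro sum.cong) (auto simp: e_def unit_vec_nth)
  moreover have "\<bar>(y - (x + e)) $ k\<bar> = \<bar>(y - x) $ k\<bar> - 1" using k by (auto simp: e_def unit_vec_nth)
  ultimately have l: "l1_norm (y - (x + e)) = l1_norm (y - x) - 1" by simp
  then have "n = nat (l1_norm (y - (x + e)))" using Suc.hyps(2) by simp
  from Suc.hyps(1)[OF this] obtain ps where ps: "site_path UNIV (x + e) y ps"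
    "int (length ps) = l1_norm (y - (x + e)) + 1" by blast
  have "site_path UNIV x y (x # ps)" using ps(1) e by (cases ps) (auto simp: site_path_def)
  then show ?case using ps(2) l by (intro exI[of _ "x # ps"]) simp
qed

section \<open>The surface strategy\<close>

text \<open>The state of the walk through the paths \<open>p t\<close> is the rest of the current path, and the time.\<close>

primrec walk :: "(nat \<Rightarrow> 'd::finite site list) \<Rightarrow> nat \<Rightarrow> 'd site list \<times> nat" where
  "walk p 0 = (p 0, 0)"
| "walk p (Suc k) = (if tl (fst (walk p k)) = [] then (p (Suc (snd (walk p k))), Suc (snd (walk p k)))
    else (tl (fst (walk p k)), snd (walk p k)))"

definition trajectory :: "(nat \<Rightarrow> 'd::finite site list) \<Rightarrow> 'd trajectory" where
  "trajectory p k = (hd (fst (walk p k)), snd (walk p k))"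

definition start_index :: "(nat \<Rightarrow> 'd::finite site list) \<Rightarrow> nat \<Rightarrow> nat" where
  "start_index p t = (\<Sum>s<t. length (p s))"

text \<open>Consecutive paths share an endpoint because the step that advances time must not move
  the site.\<close>

definition linked :: "(nat \<Rightarrow> 'd::finite site list) \<Rightarrow> bool" where
  "linked p \<longleftrightarrow> hd (p 0) = 0 \<and>
    (\<forall>t. p t \<noteq> [] \<and> successively (\<lambda>a b. l1_norm (b - a) = 1) (p t) \<and> hd (p (Suc t)) = last (p t))"

lemma walk_drop:
  assumes "walk p k = (p t, t)" "j < length (p t)"
  shows "walk p (k + j) = (drop j (p t), t)"
  using assms(2)
proof (induction j)
  case (Suc j)
  then have "walk p (k + j) = (drop j (p t), t)" by simp
  moreover have "tl (drop j (p t)) \<noteq> []" using Suc.prems by (simp add: tl_drop drop_Suc[symmetric])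
  ultimately show ?case by (simp add: tl_drop drop_Suc)
qed (simp add: assms)

lemma walk_start_index:
  assumes "\<And>t. p t \<noteq> []"
  shows "walk p (start_index p t) = (p t, t)"
proof (induction t)
  case (Suc t)
  have l: "length (p t) - 1 < length (p t)" using assms by simp
  have "walk p (start_index p t + (length (p t) - 1)) = (drop (length (p t) - 1) (p t), t)"
    by (rule walk_drop[OF Suc l])
  moreover have "tl (drop (length (p t) - 1) (p t)) = []" by (simp flip: drop_Suc add: tl_drop)
  moreover have "start_index p (Suc t) = Suc (start_index p t + (length (p t) - 1))"
    using assms[of t] by (simp add: start_index_def)
  ultimately show ?case by simp
qed (simp add: start_index_def)

lemma trajectory_nth:
  assumes "\<And>t. p t \<noteq> []" "j < length (p t)"
  shows "trajectory p (start_index p t + j) = (p t ! j, t)"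
  using walk_drop[of p "start_index p t" t j, OF walk_start_index[of p, OF assms(1)] assms(2)] assms(2)
  by (simp add: trajectory_def hd_drop_conv_nth)

lemma start_index_cases:
  assumes "\<And>t. p t \<noteq> []"
  obtains t j where "k = start_index p t + j" "j < length (p t)"
proof -
  have "\<exists>t j. k = start_index p t + j \<and> j < length (p t)"
  proof (induction k)
    case 0
    show ?case using assms by (intro exI[of _ 0]) (simp add: start_index_def)
  next
    case (Suc k)
    then obtain t j where tj: "k = start_index p t + j" "j < length (p t)" by blast
    show ?case
    proof (cases "Suc j < length (p t)")
      case True
      then show ?thesis using tj by (intro exI[of _ t] exI[of _ "Suc j"]) simp
    next
      case False
      then have "Suc k = start_index p (Suc t) + 0" using tj by (simp add: start_index_def)
      then show ?thesis using assms[of "Suc t"] by blast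
    qed
  qed
  then show ?thesis using that by blast
qed

lemma start_index_Suc: "start_index p (Suc t) = start_index p t + length (p t)"
  by (simp add: start_index_def)

lemma trajectory_time_iff:
  assumes "\<And>t. p t \<noteq> []"
  shows "{i. snd (trajectory p i) = t} = {start_index p t..<start_index p t + length (p t)}"
proof (intro set_eqI iffI)
  fix i assume i: "i \<in> {i. snd (trajectory p i) = t}"
  obtain s j where sj: "i = start_index p s + j" "j < length (p s)" by (rule start_index_cases[OF assms])
  then have "s = t" using i trajectory_nth[where p = p, OF assms sj(2)] by simp
  then show "i \<in> {start_index p t..<start_index p t + length (p t)}" using sj by simp
next
  fix i assume "i \<in> {start_index p t..<start_index p t + length (p t)}"
  then have "start_index p t \<le> i" "i - start_index p t < length (p t)" by auto
  then show "i \<in> {i. snd (trajectory p i) = t}"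
    using trajectory_nth[of p "i - start_index p t" t, OF assms] by simp
qed

lemma speed_trajectory:
  assumes "\<And>t. p t \<noteq> []"
  shows "speed (trajectory p) t = length (p t) - 1"
proof -
  let ?a = "start_index p t" and ?n = "length (p t)"
  have n: "0 < ?n" using assms by simp
  have "Max {a..<a + m} = a + m - 1" "Min {a..<a + m} = a" if "0 < m" for a m :: nat
    using that by (intro Max_eqI Min_eqI; auto)+
  from this[OF n, of ?a] have "Max {?a..<?a + ?n} = ?a + ?n - 1" "Min {?a..<?a + ?n} = ?a" .
  then show ?thesis unfolding speed_def trajectory_time_iff[of p, OF assms] by simp
qed

lemma trajectory_vacant_iff:
  assumes "\<And>t. p t \<noteq> []"
  shows "(\<forall>k. \<not> \<xi> (trajectory p k)) \<longleftrightarrow> (\<forall>t. set (p t) \<subseteq> vacant \<xi> t)"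
proof (intro iffI allI subsetI)
  fix t x assume *: "\<forall>k. \<not> \<xi> (trajectory p k)" and "x \<in> set (p t)"
  then obtain j where "j < length (p t)" "x = p t ! j" by (metis in_set_conv_nth)
  then have "trajectory p (start_index p t + j) = (x, t)" using trajectory_nth[of p j t, OF assms] by simp
  then show "x \<in> vacant \<xi> t" using *[rule_format, of "start_index p t + j"] by (simp add: vacant_def)
next
  fix k assume *: "\<forall>t. set (p t) \<subseteq> vacant \<xi> t"
  obtain t j where tj: "k = start_index p t + j" "j < length (p t)" by (rule start_index_cases[OF assms])
  then have "p t ! j \<in> vacant \<xi> t" using * nth_mem by blast
  then show "\<not> \<xi> (trajectory p k)" using trajectory_nth[where p = p, OF assms tj(2)] tj(1) by (simp add: vacant_def)
qed

lemma escape_trajectory_trajectory: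
  assumes "linked p"
  shows "escape_trajectory (trajectory p)"
proof -
  have ne: "\<And>t. p t \<noteq> []" using assms by (simp add: linked_def)
  have step: "l1_dist (trajectory p (Suc k)) (trajectory p k) = 1 \<and>
    snd (trajectory p k) \<le> snd (trajectory p (Suc k))" for k
  proof -
    obtain t j where tj: "k = start_index p t + j" "j < length (p t)" by (rule start_index_cases[OF ne])
    note k = trajectory_nth[where p = p, OF ne tj(2), folded tj(1)]
    show ?thesis
    proof (cases "Suc j < length (p t)")
      case True
      have "successively (\<lambda>a b. l1_norm (b - a) = 1) (p t)" using assms by (simp add: linked_def)
      then have "l1_norm (p t ! Suc j - p t ! j) = 1" using True by (auto simp: successively_conv_nth)
      then show ?thesis using k trajectory_nth[where p = p, OF ne True] by (simp add: tj(1) l1_dist_def)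
    next
      case False
      then have j: "j = length (p t) - 1" and Suc_k: "Suc k = start_index p (Suc t) + 0"
        using tj by (auto simp: start_index_Suc)
      have "0 < length (p (Suc t))" using ne by simp
      from trajectory_nth[where p = p, OF ne this, folded Suc_k] have "trajectory p (Suc k) = (hd (p (Suc t)), Suc t)"
        using ne by (simp add: hd_conv_nth)
      moreover have "p t ! j = last (p t)" using ne j by (simp add: last_conv_nth)
      moreover have "hd (p (Suc t)) = last (p t)" using assms by (simp add: linked_def)
      ultimately show ?thesis using k by (simp add: l1_dist_def)
    qed
  qed
  have mono: "mono (\<lambda>k. snd (trajectory p k))" using step by (simp add: mono_iff_le_Suc)
  have "filterlim (\<lambda>k. snd (trajectory p k)) at_top sequentially"
    unfolding filterlim_at_top
  proof
    fix t
    have "snd (trajectory p (start_index p t)) = t" using trajectory_nth[where p = p, OF ne, of 0 t] ne by simp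
    then have "t \<le> snd (trajectory p k)" if "start_index p t \<le> k" for k
      using monoD[OF mono that] by simp
    then show "\<forall>\<^sub>F k in sequentially. t \<le> snd (trajectory p k)"
      by (auto simp: eventually_sequentially)
  qed
  moreover have "trajectory p 0 = (0, 0)" using assms by (simp add: trajectory_def linked_def)
  ultimately show ?thesis using step mono by (simp add: escape_trajectory_def)
qed

section \<open>Adaptedness and measurable choice of paths\<close>

lemma space_env_filtration [simp]: "space (env_filtration t) = UNIV"
  by (simp add: env_filtration_def space_measure_of_conv)

lemma sets_env_filtration_mono:
  assumes "s \<le> t"
  shows "sets (env_filtration s) \<subseteq> sets (env_filtration t)"
proof -
  have "{{\<xi> :: 'a env. \<xi> (x, r) \<in> B} | x r B. r \<le> s} \<subseteq> {{\<xi>. \<xi> (x, r) \<in> B} | x r B. r \<le> t}"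
    using assms by (blast intro: order_trans)
  then show ?thesis unfolding env_filtration_def by (simp add: sets_measure_of sigma_sets_mono')
qed

lemma measurable_env_filtration [measurable]:
  assumes "s \<le> t"
  shows "Measurable.pred (env_filtration t) (\<lambda>\<xi>. \<xi> (x, s))"
proof -
  have "{\<xi>. \<xi> (x, s) \<in> {True}} \<in> sets (env_filtration t)"
    unfolding env_filtration_def using assms by (subst sets_measure_of) (simp, rule sigma_sets.Basic, blast)
  then show ?thesis by (simp add: pred_def)
qed

text \<open>The index at which time \<open>t\<close> begins is random, so the state of
  \<open>walk\<close> is handled by induction on \<open>k\<close>: a state at time \<open>t\<close>
  continues one at time \<open>t\<close>, or follows the end of a path at time \<open>t - 1\<close>,
  and then \<open>\<pi> t\<close> is consulted for the first time.\<close>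

lemma adapted_trajectory:
  fixes \<pi> :: "nat \<Rightarrow> 'd::finite env \<Rightarrow> 'd site list"
  assumes \<pi>: "\<And>t. \<pi> t \<in> env_filtration t \<rightarrow>\<^sub>M count_space UNIV"
  shows "adapted (\<lambda>\<xi>. trajectory (\<lambda>t. \<pi> t \<xi>))"
proof -
  have \<pi>': "{\<xi>. \<pi> t \<xi> = l} \<in> sets (env_filtration t)" for t l
    using measurable_sets[OF \<pi>, of "{l}" t] by (simp add: vimage_def)
  have W: "{\<xi>. walk (\<lambda>t. \<pi> t \<xi>) k = (l, t)} \<in> sets (env_filtration t)" for k l t
  proof (induction k arbitrary: l t)
    case 0
    have "{\<xi>. walk (\<lambda>t. \<pi> t \<xi>) 0 = (l, t)} = (if t = 0 then {\<xi>. \<pi> t \<xi> = l} else {})" by auto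
    then show ?case using \<pi>' by simp
  next
    case (Suc k)
    let ?w = "\<lambda>\<xi>. walk (\<lambda>t. \<pi> t \<xi>) k"
    have 1: "(\<Union>m\<in>{m. tl m \<noteq> [] \<and> tl m = l}. {\<xi>. ?w \<xi> = (m, t)}) \<in> sets (env_filtration t)"
      by (intro sets.countable_UN'' Suc) auto
    show ?case
    proof (cases t)
      case 0
      have "{\<xi>. walk (\<lambda>t. \<pi> t \<xi>) (Suc k) = (l, t)} = (\<Union>m\<in>{m. tl m \<noteq> [] \<and> tl m = l}. {\<xi>. ?w \<xi> = (m, t)})"
        using 0 by (auto simp: prod_eq_iff)
      then show ?thesis using 1 by simp
    next
      case (Suc t')
      have "{\<xi>. ?w \<xi> = (m, t')} \<in> sets (env_filtration t)" for m
        using \<open>\<And>l t. {\<xi>. ?w \<xi> = (l, t)} \<in> sets (env_filtration t)\<close> sets_env_filtration_mono[of t' t] Suc by auto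
      then have 2: "(\<Union>m\<in>{m. tl m = []}. {\<xi>. ?w \<xi> = (m, t')} \<inter> {\<xi>. \<pi> t \<xi> = l}) \<in> sets (env_filtration t)"
        by (intro sets.countable_UN'' sets.Int \<pi>') auto
      have "{\<xi>. walk (\<lambda>t. \<pi> t \<xi>) (Suc k) = (l, t)} =
        (\<Union>m\<in>{m. tl m \<noteq> [] \<and> tl m = l}. {\<xi>. ?w \<xi> = (m, t)}) \<union>
        (\<Union>m\<in>{m. tl m = []}. {\<xi>. ?w \<xi> = (m, t')} \<inter> {\<xi>. \<pi> t \<xi> = l})"
        using Suc by (auto simp: prod_eq_iff split: if_splits)
      then show ?thesis using 1 2 by simp
    qed
  qed
  show ?thesis unfolding adapted_def
  proof (intro allI)
    fix k x t
    have "{\<xi>. trajectory (\<lambda>t. \<pi> t \<xi>) k = (x, t)} = (\<Union>l\<in>{l. hd l = x}. {\<xi>. walk (\<lambda>t. \<pi> t \<xi>) k = (l, t)})"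
      by (auto simp: trajectory_def prod_eq_iff)
    then show "{\<xi>. trajectory (\<lambda>t. \<pi> t \<xi>) k = (x, t)} \<in> sets (env_filtration t)"
      using W by (auto intro!: sets.countable_UN'')
  qed
qed

text \<open>Among the shortest paths the one with the least code under \<open>from_nat\<close> is
  taken: a choice built from \<open>LEAST\<close> alone depends measurably on
  \<open>V\<close>.\<close>

definition shortest_path :: "'d::finite site set \<Rightarrow> 'd site \<Rightarrow> 'd site \<Rightarrow> 'd site list" where
  "shortest_path V x y = from_nat (LEAST m. site_path V x y (from_nat m) \<and>
    length (from_nat m :: 'd site list) = (LEAST n. \<exists>ps. site_path V x y ps \<and> length ps = n))"

lemma shortest_path:
  assumes "site_path V x y ps"
  shows "site_path V x y (shortest_path V x y)" "length (shortest_path V x y) \<le> length ps"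
proof -
  define n where "n = (LEAST n. \<exists>ps. site_path V x y ps \<and> length ps = n)"
  have ex: "\<exists>ps. site_path V x y ps \<and> length ps = length ps" using assms by blast
  have "\<exists>ps. site_path V x y ps \<and> length ps = n" unfolding n_def by (rule LeastI_ex) (use assms in blast)
  then have "\<exists>m. site_path V x y (from_nat m) \<and> length (from_nat m :: 'a site list) = n"
    by (metis from_nat_to_nat)
  from LeastI_ex[OF this]
  have *: "site_path V x y (shortest_path V x y) \<and> length (shortest_path V x y) = n"
    unfolding shortest_path_def n_def .
  then show "site_path V x y (shortest_path V x y)" by blast
  have "n \<le> length ps" unfolding n_def by (rule Least_le) (use assms in blast)
  then show "length (shortest_path V x y) \<le> length ps" using * by simp
qed

text \<open>The fallback disregards \<open>V\<close>. It keeps the strategy well defined on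
  exceptional environments, since \<open>escape_strategy\<close> asks for an escape trajectory for
  every \<open>\<xi>\<close>.\<close>

definition select_path :: "'d::finite site set \<Rightarrow> 'd site \<Rightarrow> 'd site \<Rightarrow> 'd site list" where
  "select_path V x y = (if \<exists>ps. site_path V x y ps then shortest_path V x y else shortest_path UNIV x y)"

lemma select_path: "site_path UNIV x y (select_path V x y)"
proof -
  obtain ps where "site_path UNIV x y ps" using ex_site_path by blast
  then show ?thesis
    unfolding select_path_def by (auto intro: shortest_path site_path_mono[OF _ subset_UNIV])
qed

lemma select_path_le:
  assumes "site_path V x y ps"
  shows "set (select_path V x y) \<subseteq> V" "length (select_path V x y) \<le> length ps"
  using shortest_path[OF assms] assms by (auto simp: select_path_def site_path_def)

lemma measurable_site_path:
  "Measurable.pred (env_filtration t) (\<lambda>\<xi>. site_path (vacant \<xi> t) x y ps)"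
proof -
  have "(\<lambda>\<xi>. site_path (vacant \<xi> t) x y ps) = (\<lambda>\<xi>. (ps \<noteq> [] \<and> hd ps = x \<and> last ps = y \<and>
      successively (\<lambda>a b. l1_norm (b - a) = 1) ps) \<and> (\<forall>z\<in>set ps. \<not> \<xi> (z, t)))"
    by (auto simp: site_path_def vacant_def)
  also have "Measurable.pred (env_filtration t) \<dots>"
    by (intro pred_intros_logic pred_intros_finite measurable_env_filtration) auto
  finally show ?thesis .
qed

lemma measurable_select_path:
  "(\<lambda>\<xi>. select_path (vacant \<xi> t) x y) \<in> env_filtration t \<rightarrow>\<^sub>M count_space UNIV"
proof -
  note [measurable] = measurable_site_path
  have "(\<lambda>\<xi>. LEAST n. \<exists>ps. site_path (vacant \<xi> t) x y ps \<and> length ps = n) \<in> env_filtration t \<rightarrow>\<^sub>M count_space UNIV"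
    by measurable
  note [measurable] = this
  have "(\<lambda>\<xi>. LEAST m. site_path (vacant \<xi> t) x y (from_nat m) \<and> length (from_nat m :: 'a site list) =
    (LEAST n. \<exists>ps. site_path (vacant \<xi> t) x y ps \<and> length ps = n)) \<in> env_filtration t \<rightarrow>\<^sub>M count_space UNIV"
    by measurable
  then have "(\<lambda>\<xi>. shortest_path (vacant \<xi> t) x y) \<in> env_filtration t \<rightarrow>\<^sub>M count_space UNIV"
    unfolding shortest_path_def by (rule measurable_compose) simp
  note [measurable] = this
  show ?thesis unfolding select_path_def by measurable
qed

text \<open>The axis over which the curve of time \<open>t\<close> runs; with \<open>i\<close> and
  \<open>j\<close> exchanged, the axis along which its height is measured.\<close>

definition axis1 :: "'d \<Rightarrow> 'd \<Rightarrow> nat \<Rightarrow> 'd" where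
  "axis1 i j t = (if even t then i else j)"

abbreviation closed_at :: "'d::finite \<Rightarrow> 'd \<Rightarrow> nat \<Rightarrow> 'd env \<Rightarrow> (int \<times> int) set" where
  "closed_at i j t \<xi> \<equiv> closed_blocks (axis1 i j t) (axis1 j i t) \<xi> t"

definition target :: "'d::finite \<Rightarrow> 'd \<Rightarrow> nat \<Rightarrow> 'd env \<Rightarrow> 'd site" where
  "target i j t \<xi> = center (axis1 i j t) (axis1 j i t) (0, int (surface (closed_at i j t \<xi>) 0))"

text \<open>The path at time 0 pays no attention to traps; escape is derived only when it reduces to
  the vacant origin.\<close>

primrec escape_path :: "'d::finite \<Rightarrow> 'd \<Rightarrow> nat \<Rightarrow> 'd env \<Rightarrow> 'd site list" where
  "escape_path i j 0 \<xi> = shortest_path UNIV 0 (target i j 0 \<xi>)"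
| "escape_path i j (Suc t) \<xi> = select_path (vacant \<xi> (Suc t)) (target i j t \<xi>) (target i j (Suc t) \<xi>)"

definition surface_strategy :: "'d::finite \<Rightarrow> 'd \<Rightarrow> 'd strategy" where
  "surface_strategy i j \<xi> = trajectory (\<lambda>t. escape_path i j t \<xi>)"

lemma escape_path_site_path:
  "site_path UNIV (case t of 0 \<Rightarrow> 0 | Suc s \<Rightarrow> target i j s \<xi>) (target i j t \<xi>) (escape_path i j t \<xi>)"
proof (cases t)
  case 0
  obtain ps where "site_path UNIV 0 (target i j 0 \<xi>) ps" using ex_site_path by blast
  then show ?thesis using 0 by (simp add: shortest_path(1))
qed (simp add: select_path)

lemma escape_path_nonempty: "escape_path i j t \<xi> \<noteq> []"
  using escape_path_site_path[where t = t and i = i and j = j and \<xi> = \<xi>] by (simp add: site_path_def)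

lemma linked_escape_path: "linked (\<lambda>t. escape_path i j t \<xi>)"
  unfolding linked_def
proof (intro conjI allI)
  show "hd (escape_path i j 0 \<xi>) = 0" using escape_path_site_path[where t = 0 and i = i and j = j and \<xi> = \<xi>] by (simp add: site_path_def)
  show "hd (escape_path i j (Suc t) \<xi>) = last (escape_path i j t \<xi>)" for t
    using escape_path_site_path[where t = "Suc t" and i = i and j = j and \<xi> = \<xi>] escape_path_site_path[where t = t and i = i and j = j and \<xi> = \<xi>] by (simp add: site_path_def)
  show "successively (\<lambda>a b. l1_norm (b - a) = 1) (escape_path i j t \<xi>)" for t
    using escape_path_site_path[where t = t and i = i and j = j and \<xi> = \<xi>] by (simp add: site_path_def)
qed (rule escape_path_nonempty)

lemma escape_strategy_surface: "escape_strategy (surface_strategy i j)"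
  unfolding escape_strategy_def surface_strategy_def
  by (intro allI escape_trajectory_trajectory linked_escape_path)

lemma measurable_closed_at:
  assumes "s \<le> t"
  shows "Measurable.pred (env_filtration t) (\<lambda>\<xi>. v \<in> closed_at i j s \<xi>)"
proof -
  have "(\<lambda>\<xi>. v \<in> closed_at i j s \<xi>) = (\<lambda>\<xi>. \<exists>z\<in>block (axis1 i j s) (axis1 j i s) v. \<xi> (z, s))"
    by (simp add: closed_blocks_def)
  also have "Measurable.pred (env_filtration t) \<dots>"
    using assms by (intro pred_intros_finite measurable_env_filtration block_bound)
  finally show ?thesis .
qed

lemma measurable_target:
  "s \<le> t \<Longrightarrow> target i j s \<in> env_filtration t \<rightarrow>\<^sub>M count_space UNIV"
  unfolding target_def
  by (rule measurable_compose[OF surface_measurable[OF measurable_closed_at]]) simp_all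

lemma measurable_escape_path: "escape_path i j t \<in> env_filtration t \<rightarrow>\<^sub>M count_space UNIV"
proof (cases t)
  case 0
  have "(\<lambda>\<xi>. shortest_path UNIV 0 (target i j 0 \<xi>)) \<in> env_filtration t \<rightarrow>\<^sub>M count_space UNIV"
    by (rule measurable_compose[OF measurable_target]) simp_all
  moreover have "escape_path i j 0 = (\<lambda>\<xi>. shortest_path UNIV 0 (target i j 0 \<xi>))" by (rule ext) simp
  ultimately show ?thesis using 0 by simp
next
  case (Suc s)
  have "(\<lambda>\<xi>. select_path (vacant \<xi> t) x (target i j t \<xi>)) \<in> env_filtration t \<rightarrow>\<^sub>M count_space UNIV" for x
    by (rule measurable_compose_countable[OF measurable_select_path measurable_target]) simp
  then have "(\<lambda>\<xi>. select_path (vacant \<xi> t) (target i j s \<xi>) (target i j t \<xi>)) \<in> env_filtration t \<rightarrow>\<^sub>M count_space UNIV"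
    by (rule measurable_compose_countable[OF _ measurable_target]) (simp add: Suc)
  moreover have "escape_path i j (Suc s) = (\<lambda>\<xi>. select_path (vacant \<xi> (Suc s)) (target i j s \<xi>) (target i j (Suc s) \<xi>))"
    by (rule ext) simp
  ultimately show ?thesis using Suc by simp
qed

lemma adapted_surface: "adapted (surface_strategy i j)"
  unfolding surface_strategy_def[abs_def] by (rule adapted_trajectory) (rule measurable_escape_path)

lemma speed_surface: "speed (surface_strategy i j \<xi>) t = length (escape_path i j t \<xi>) - 1"
  unfolding surface_strategy_def by (rule speed_trajectory) (rule escape_path_nonempty)

lemma escape_event_surface:
  "escape_event (surface_strategy i j) = {\<xi>. \<forall>t. set (escape_path i j t \<xi>) \<subseteq> vacant \<xi> t}"
  unfolding escape_event_eq surface_strategy_def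
  by (subst trajectory_vacant_iff) (simp_all add: escape_path_nonempty)

text \<open>Confines the curve to the square of side \<open>n\<close>, so that two such curves over
  different axes must cross. This is not monotone in \<open>n\<close>, hence the same
  \<open>n\<close> is required at consecutive times.\<close>

definition low_surface :: "'d::finite \<Rightarrow> 'd \<Rightarrow> nat \<Rightarrow> nat \<Rightarrow> 'd env \<Rightarrow> bool" where
  "low_surface i j t n \<xi> \<longleftrightarrow> (\<forall>x\<le>n. \<not> climbable (closed_at i j t \<xi>) (int x) (int n))"

lemma escape_path_Suc:
  assumes ij: "i \<noteq> j" and "consistent \<xi>" "low_surface i j t n \<xi>" "low_surface i j (Suc t) n \<xi>"
  shows "set (escape_path i j (Suc t) \<xi>) \<subseteq> vacant \<xi> (Suc t)"
    and "length (escape_path i j (Suc t) \<xi>) \<le> 12 * n + 1"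
proof -
  have ax: "axis1 i j (Suc t) = axis1 j i t" "axis1 j i (Suc t) = axis1 i j t" by (simp_all add: axis1_def)
  have ne: "axis1 i j t \<noteq> axis1 j i t" using ij by (simp add: axis1_def)
  have B: "\<not> climbable (closed_blocks (axis1 i j t) (axis1 j i t) \<xi> t) (int x) (int n)" if "x \<le> n" for x
    using assms(3) that by (simp add: low_surface_def)
  have C: "\<not> climbable (closed_blocks (axis1 j i t) (axis1 i j t) \<xi> (Suc t)) (int x) (int n)" if "x \<le> n" for x
    using assms(4) that unfolding low_surface_def ax by blast
  from vacant_crossing[OF ne assms(2), of n t, OF B C] obtain ps where
    ps: "site_path (vacant \<xi> (Suc t)) (target i j t \<xi>) (target i j (Suc t) \<xi>) ps" "length ps \<le> 12 * n + 1"
    unfolding target_def ax by blast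
  show "set (escape_path i j (Suc t) \<xi>) \<subseteq> vacant \<xi> (Suc t)" using select_path_le(1)[OF ps(1)] by simp
  show "length (escape_path i j (Suc t) \<xi>) \<le> 12 * n + 1" using select_path_le(2)[OF ps(1)] ps(2) by simp
qed

lemma center_0: "i \<noteq> j \<Longrightarrow> l1_norm (center i j (0, int h)) = 3 * int h"
proof -
  assume "i \<noteq> j"
  then have "\<bar>center i j (0, int h) $ k\<bar> = (if k = j then 3 * int h else 0)" for k by (simp add: center_def)
  then show ?thesis unfolding l1_norm_def by simp
qed

lemma escape_path_0_le:
  assumes "i \<noteq> j" "low_surface i j 0 n \<xi>"
  shows "length (escape_path i j 0 \<xi>) \<le> 3 * n + 1"
proof -
  have "\<not> climbable (closed_at i j 0 \<xi>) 0 (int n)"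
    using assms(2) unfolding low_surface_def by (metis le0 of_nat_0)
  then have n: "surface (closed_at i j 0 \<xi>) 0 \<le> n" by (rule surface_le)
  obtain ps where ps: "site_path UNIV 0 (target i j 0 \<xi>) ps" "int (length ps) = l1_norm (target i j 0 \<xi> - 0) + 1"
    using ex_site_path by blast
  have "int (length ps) = 3 * int (surface (closed_at i j 0 \<xi>) 0) + 1"
    using ps(2) assms(1) by (simp add: target_def axis1_def center_0)
  then have "length ps \<le> 3 * n + 1" using n by linarith
  then show ?thesis using shortest_path(2)[OF ps(1)] by simp
qed

lemma escape_path_0_vacant:
  assumes "i \<noteq> j" "low_surface i j 0 0 \<xi>"
  shows "set (escape_path i j 0 \<xi>) \<subseteq> vacant \<xi> 0"
proof -
  have nc: "\<not> climbable (closed_at i j 0 \<xi>) 0 (int 0)" using assms(2) unfolding low_surface_def by force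
  have "surface (closed_at i j 0 \<xi>) 0 = 0" using surface_le[OF nc] by simp
  then have o: "(0, 0) \<notin> closed_at i j 0 \<xi>" and target: "target i j 0 \<xi> = center i j (0, 0)"
    using surface_open[OF nc] by (simp_all add: target_def axis1_def)
  have zero: "center i j (0, 0) = 0" by (simp add: center_def vec_eq_iff)
  have "length (escape_path i j 0 \<xi>) \<le> 1" using escape_path_0_le[OF assms] by simp
  moreover have "hd (escape_path i j 0 \<xi>) = 0" using linked_escape_path[of i j \<xi>] unfolding linked_def by blast
  moreover have "ps = [0]" if "length ps \<le> 1" "hd ps = 0" "ps \<noteq> []" for ps :: "'a site list"
    using that by (cases ps) auto
  ultimately have "escape_path i j 0 \<xi> = [0]" using escape_path_nonempty by blast
  moreover have "0 \<in> vacant \<xi> 0"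
  proof -
    have "0 \<in> block (axis1 i j 0) (axis1 j i 0) (0, 0)" by (simp add: block_def axis1_def zero)
    then show ?thesis using o by (auto simp: closed_blocks_def vacant_def)
  qed
  ultimately show ?thesis by simp
qed

text \<open>At \<open>t = 0\<close> the truncated difference \<open>t - 1\<close> is 0, so both
  conditions coincide and cover the initial path.\<close>

lemma speed_surface_le:
  assumes ij: "i \<noteq> j" and "consistent \<xi>" "low_surface i j (t - 1) n \<xi>" "low_surface i j t n \<xi>"
  shows "speed (surface_strategy i j \<xi>) t \<le> 12 * n"
proof (cases t)
  case 0
  then show ?thesis using escape_path_0_le[OF ij] assms(4) unfolding speed_surface by fastforce
next
  case (Suc s)
  then show ?thesis using escape_path_Suc(2)[OF ij assms(2), of s n] assms(3,4) unfolding speed_surface by fastforce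
qed

text \<open>Height 0 at time 0 makes the first path a single vacant site; later any finite height
  will do, so positive probability is at stake only at the start.\<close>

lemma escape_if_low:
  assumes ij: "i \<noteq> j" and "consistent \<xi>" "low_surface i j 0 0 \<xi>"
    and "\<And>t. \<exists>n. low_surface i j t n \<xi> \<and> low_surface i j (Suc t) n \<xi>"
  shows "\<xi> \<in> escape_event (surface_strategy i j)"
  unfolding escape_event_surface
proof (intro CollectI allI)
  fix t show "set (escape_path i j t \<xi>) \<subseteq> vacant \<xi> t"
  proof (cases t)
    case 0
    then show ?thesis using escape_path_0_vacant[OF ij assms(3)] by simp
  next
    case (Suc s)
    then show ?thesis using escape_path_Suc(1)[OF ij assms(2)] assms(4)[of s] by blast
  qed
qed

section \<open>Escape at low intensity\<close>

lemma measurable_closed_at_traps: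
  "Measurable.pred (trap_measure u) (\<lambda>\<omega>. v \<in> closed_at i j t (environment \<omega>))"
proof -
  have "Measurable.pred env_space (\<lambda>\<xi>. \<exists>z\<in>block (axis1 i j t) (axis1 j i t) v. \<xi> (z, t))"
    by (intro pred_intros_finite measurable_env_at block_bound)
  then show ?thesis unfolding closed_blocks_def mem_Collect_eq by (rule environment_comp)
qed

text \<open>For this \<open>u\<close> the bound for the probability that a block is closed, with parameter \<open>1 / u\<close>, is at most \<open>\<beta>\<^sup>2\<close>.\<close>

lemma emeasure_not_low_surface_le:
  fixes i j :: "'d::finite"
  assumes ij: "i \<noteq> j" and \<beta>: "0 < \<beta>" "\<beta> \<le> 1 / 12" and u: "u = \<beta>\<^sup>2 * exp (- (3 ^ CARD('d)))"
  shows "Measurable.pred (trap_measure u) (\<lambda>\<omega>. low_surface i j t n (environment \<omega>))"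
    and "emeasure (trap_measure u) {\<omega>. \<not> low_surface i j t n (environment \<omega>)} \<le> ennreal (2 * \<beta> * (2 * \<beta>) ^ n)"
proof -
  let ?M = "trap_measure u :: 'd traps measure" and ?Cl = "\<lambda>\<omega>. closed_at i j t (environment \<omega>)"
  interpret prob_space ?M by (rule prob_space_trap_measure)
  have u0: "0 < u" using \<beta> by (simp add: u)
  have ax: "axis1 i j t \<noteq> axis1 j i t" using ij by (simp add: axis1_def)
  note meas = measurable_closed_at_traps[where u = u and i = i and j = j and t = t]
  have [measurable]: "Measurable.pred ?M (\<lambda>\<omega>. climbable (?Cl \<omega>) x y)" for x y
    by (rule climbable_measurable[OF meas])
  show "Measurable.pred ?M (\<lambda>\<omega>. low_surface i j t n (environment \<omega>))"
    unfolding low_surface_def by measurable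
  have closed: "emeasure ?M {\<omega>\<in>space ?M. \<forall>v\<in>K. v \<in> ?Cl \<omega>} \<le> ennreal (\<beta> ^ (2 * card K))" if "finite K" for K
  proof -
    have "exp (u * (1 / u) * 3 ^ CARD('d)) / (1 + 1 / u) = u * exp (3 ^ CARD('d)) / (u + 1)"
      using u0 by (simp add: field_simps)
    also have "\<dots> \<le> u * exp (3 ^ CARD('d)) / 1" using u0 by (intro divide_left_mono) auto
    also have "\<dots> = \<beta>\<^sup>2" by (simp add: u exp_minus)
    finally have le: "exp (u * (1 / u) * 3 ^ CARD('d)) / (1 + 1 / u) \<le> \<beta>\<^sup>2" .
    have "emeasure ?M {\<omega>\<in>space ?M. \<forall>v\<in>K. v \<in> ?Cl \<omega>} \<le>
        ennreal ((exp (u * (1 / u) * 3 ^ CARD('d)) / (1 + 1 / u)) ^ card K)"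
      using emeasure_closed_blocks_le[OF ax that, of u "1 / u" t] u0 by simp
    also have "\<dots> \<le> ennreal ((\<beta>\<^sup>2) ^ card K)" using le u0 by (intro ennreal_leI power_mono) auto
    finally show ?thesis by (simp add: power_mult)
  qed
  have climb: "emeasure ?M {\<omega>\<in>space ?M. climbable (?Cl \<omega>) x (int n)} \<le> ennreal (2 * \<beta> ^ Suc n)" for x
    by (rule emeasure_climbable_le[OF meas \<beta> closed])
  have "{\<omega>. \<not> low_surface i j t n (environment \<omega>)} = (\<Union>x\<in>{..n}. {\<omega>\<in>space ?M. climbable (?Cl \<omega>) (int x) (int n)})"
    by (auto simp: low_surface_def)
  then have "emeasure ?M {\<omega>. \<not> low_surface i j t n (environment \<omega>)} \<le>
      (\<Sum>x\<in>{..n}. emeasure ?M {\<omega>\<in>space ?M. climbable (?Cl \<omega>) (int x) (int n)})"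
  proof (simp only:, intro emeasure_subadditive_finite subsetI)
    fix A assume "A \<in> (\<lambda>x. {\<omega>\<in>space ?M. climbable (?Cl \<omega>) (int x) (int n)}) ` {..n}"
    moreover have "{\<omega>\<in>space ?M. climbable (?Cl \<omega>) (int x) (int n)} \<in> sets ?M" for x by measurable
    ultimately show "A \<in> sets ?M" by blast
  qed simp
  also have "\<dots> \<le> (\<Sum>x\<in>{..n}. ennreal (2 * \<beta> ^ Suc n))" by (intro sum_mono climb)
  also have "\<dots> = ennreal (real (Suc n) * (2 * \<beta> ^ Suc n))"
    using \<beta> by (simp add: ennreal_mult ennreal_of_nat_eq_real_of_nat)
  \<comment> \<open>The number \<open>n + 1\<close> of columns is absorbed into
    \<open>2 ^ n\<close>, which keeps a geometric bound of ratio \<open>2 * \<beta>\<close>.\<close>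
  also have "\<dots> \<le> ennreal (2 ^ n * (2 * \<beta> ^ Suc n))"
  proof (intro ennreal_leI mult_right_mono)
    show "real (Suc n) \<le> 2 ^ n" by (induction n) auto
  qed (use \<beta> in auto)
  also have "2 ^ n * (2 * \<beta> ^ Suc n) = 2 * \<beta> * (2 * \<beta>) ^ n" by (simp add: power_mult_distrib)
  finally show "emeasure ?M {\<omega>. \<not> low_surface i j t n (environment \<omega>)} \<le> ennreal (2 * \<beta> * (2 * \<beta>) ^ n)" .
qed

text \<open>The event that every \<open>n\<close> fails is contained in the failure at each
  \<open>n\<close>, whose probability tends to 0.\<close>

lemma ex_not_both_low_null:
  fixes i j :: "'d::finite"
  assumes ij: "i \<noteq> j" and \<beta>: "0 < \<beta>" "\<beta> \<le> 1 / 12" and u: "u = \<beta>\<^sup>2 * exp (- (3 ^ CARD('d)))"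
  shows "AE \<omega> in trap_measure u. \<exists>n. low_surface i j t n (environment \<omega>) \<and> low_surface i j (Suc t) n (environment \<omega>)"
proof (rule AE_I)
  let ?M = "trap_measure u :: 'd traps measure"
  let ?L = "\<lambda>t n. {\<omega>. \<not> low_surface i j t n (environment \<omega>)}"
  note low = emeasure_not_low_surface_le[OF assms]
  note [measurable] = low(1)
  have L [measurable]: "?L t n \<in> sets ?M" for t n
  proof -
    have "{\<omega>\<in>space ?M. \<not> low_surface i j t n (environment \<omega>)} \<in> sets ?M" by measurable
    then show ?thesis by simp
  qed
  let ?B = "\<Inter>n. ?L t n \<union> ?L (Suc t) n"
  show "{\<omega>\<in>space ?M. \<not> (\<exists>n. low_surface i j t n (environment \<omega>) \<and> low_surface i j (Suc t) n (environment \<omega>))} \<subseteq> ?B"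
    by auto
  have "UNIV \<in> sets ?M" using sets.top[of ?M] by simp
  then show "?B \<in> sets ?M" by (intro sets.countable_INT'' sets.Un L) simp_all
  have le: "emeasure ?M ?B \<le> ennreal (4 * \<beta> * (2 * \<beta>) ^ n)" for n
  proof -
    have "emeasure ?M ?B \<le> emeasure ?M (?L t n \<union> ?L (Suc t) n)"
      by (intro emeasure_mono sets.Un L) auto
    also have "\<dots> \<le> emeasure ?M (?L t n) + emeasure ?M (?L (Suc t) n)" by (intro emeasure_subadditive L)
    also have "\<dots> \<le> ennreal (2 * \<beta> * (2 * \<beta>) ^ n) + ennreal (2 * \<beta> * (2 * \<beta>) ^ n)"
      by (intro add_mono low(2))
    also have "\<dots> = ennreal (4 * \<beta> * (2 * \<beta>) ^ n)" using \<beta> by (simp flip: ennreal_plus)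
    finally show ?thesis .
  qed
  have "(\<lambda>n. 4 * \<beta> * (2 * \<beta>) ^ n) \<longlonglongrightarrow> 4 * \<beta> * 0"
    using \<beta> by (intro tendsto_mult_left LIMSEQ_power_zero) simp
  then have "(\<lambda>n. ennreal (4 * \<beta> * (2 * \<beta>) ^ n)) \<longlonglongrightarrow> 0" by (simp flip: ennreal_0) 
  then have "emeasure ?M ?B \<le> 0" by (rule LIMSEQ_le_const) (use le in blast)
  then show "emeasure ?M ?B = 0" by simp
qed

text \<open>A curve of height 0 at time 0 leads to escape almost surely, and its absence has
  probability at most \<open>2 * \<beta>\<close>, which is at most \<open>1 / 6\<close>.\<close>

lemma surface_strategy_escapes:
  fixes i j :: "'d::finite"
  assumes ij: "i \<noteq> j" and \<beta>: "0 < \<beta>" "\<beta> \<le> 1 / 12" and u: "u = \<beta>\<^sup>2 * exp (- (3 ^ CARD('d)))"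
  shows "emeasure (env_law u) (escape_event (surface_strategy i j)) \<ge> ennreal (1 / 2)"
proof -
  let ?M = "trap_measure u :: 'd traps measure" and ?E = "escape_event (surface_strategy i j)"
  interpret prob_space ?M by (rule prob_space_trap_measure)
  note low = emeasure_not_low_surface_le[OF assms]
  have E: "?E \<in> sets env_space"
    using escape_event_measurable[OF adapted_surface[of i j], of u] by (simp add: env_law_def)
  have [measurable]: "{\<omega>. environment \<omega> \<in> ?E} \<in> sets ?M"
    using measurable_sets[OF environment_measurable[of u] E] by (simp add: vimage_def)
  have [measurable]: "{\<omega>. low_surface i j 0 0 (environment \<omega>)} \<in> sets ?M"
    using low(1)[of 0 0] by (simp add: pred_def)
  have "AE \<omega> in ?M. \<forall>t. \<exists>n. low_surface i j t n (environment \<omega>) \<and> low_surface i j (Suc t) n (environment \<omega>)"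
    unfolding AE_all_countable using ex_not_both_low_null[OF assms] by blast
  then have "AE \<omega> in ?M. \<omega> \<in> {\<omega>. low_surface i j 0 0 (environment \<omega>)} \<longrightarrow> \<omega> \<in> {\<omega>. environment \<omega> \<in> ?E}"
    using AE_consistent[of u] by eventually_elim (auto intro: escape_if_low[OF ij])
  then have "emeasure ?M {\<omega>. low_surface i j 0 0 (environment \<omega>)} \<le> emeasure ?M {\<omega>. environment \<omega> \<in> ?E}"
    by (rule emeasure_mono_AE) measurable
  moreover have "emeasure ?M {\<omega>. environment \<omega> \<in> ?E} = emeasure (env_law u) ?E"
    unfolding env_law_def by (subst emeasure_distr[OF environment_measurable E]) (simp add: vimage_def)
  moreover have "ennreal (1 / 2) \<le> emeasure ?M {\<omega>. low_surface i j 0 0 (environment \<omega>)}"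
  proof -
    have "{\<omega>. \<not> low_surface i j 0 0 (environment \<omega>)} = space ?M - {\<omega>. low_surface i j 0 0 (environment \<omega>)}" by auto
    then have "prob {\<omega>. \<not> low_surface i j 0 0 (environment \<omega>)} = 1 - prob {\<omega>. low_surface i j 0 0 (environment \<omega>)}"
      using prob_compl[of "{\<omega>. low_surface i j 0 0 (environment \<omega>)}"] by simp
    moreover have "prob {\<omega>. \<not> low_surface i j 0 0 (environment \<omega>)} \<le> 2 * \<beta>"
      using low(2)[of 0 0] \<beta> by (simp add: emeasure_eq_measure)
    ultimately have "1 / 2 \<le> prob {\<omega>. low_surface i j 0 0 (environment \<omega>)}" using \<beta> by linarith
    then show ?thesis unfolding emeasure_eq_measure by (rule ennreal_leI)
  qed
  ultimately show ?thesis by simp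
qed

lemma speed_surface_measurable:
  "(\<lambda>\<xi>. speed (surface_strategy i j \<xi>) t) \<in> env_space \<rightarrow>\<^sub>M count_space UNIV"
proof -
  have "(\<lambda>\<xi>. escape_path i j t \<xi>) \<in> env_space \<rightarrow>\<^sub>M count_space UNIV"
    using measurable_escape_path[of i j t] sets_env_filtration_subset[of t]
    by (auto simp: measurable_def subset_iff)
  then show ?thesis unfolding speed_surface by (rule measurable_compose) simp
qed

text \<open>A layer-cake sum: each \<open>n\<close> with \<open>12 * n < S\<close> forces a curve of
  time \<open>t - 1\<close> or \<open>t\<close> that is not low at \<open>n\<close>, and
  \<open>S\<close> is at most 12 times the number of such \<open>n\<close>.\<close>

lemma speed_surface_mean_le:
  fixes i j :: "'d::finite"
  assumes ij: "i \<noteq> j" and \<beta>: "0 < \<beta>" "\<beta> \<le> 1 / 12" and u: "u = \<beta>\<^sup>2 * exp (- (3 ^ CARD('d)))"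
  shows "(\<integral>\<^sup>+ \<omega>. of_nat (speed (surface_strategy i j (environment \<omega>)) t) \<partial>trap_measure u) \<le> ennreal (96 * \<beta>)"
proof -
  let ?M = "trap_measure u :: 'd traps measure"
  let ?L = "\<lambda>t n. {\<omega>. \<not> low_surface i j t n (environment \<omega>)}"
  note low = emeasure_not_low_surface_le[OF assms]
  have L [measurable]: "?L t n \<in> sets ?M" for t n
  proof -
    note [measurable] = low(1)
    have "{\<omega>\<in>space ?M. \<not> low_surface i j t n (environment \<omega>)} \<in> sets ?M" by measurable
    then show ?thesis by simp
  qed
  have "(\<integral>\<^sup>+ \<omega>. of_nat (speed (surface_strategy i j (environment \<omega>)) t) \<partial>?M) \<le>
      (\<integral>\<^sup>+ \<omega>. (\<Sum>n. 12 * (indicator (?L (t - 1) n) \<omega> + indicator (?L t n) \<omega>)) \<partial>?M)"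
  proof (rule nn_integral_mono_AE)
    show "AE \<omega> in ?M. of_nat (speed (surface_strategy i j (environment \<omega>)) t) \<le>
      (\<Sum>n. 12 * (indicator (?L (t - 1) n) \<omega> + indicator (?L t n) \<omega>) :: ennreal)"
      using AE_consistent[of u]
    proof eventually_elim
      case (elim \<omega>)
      define S where "S = speed (surface_strategy i j (environment \<omega>)) t"
      define c where "c = (\<lambda>n. 12 * (indicator (?L (t - 1) n) \<omega> + indicator (?L t n) \<omega>) :: ennreal)"
      have bad: "12 \<le> c n" if "12 * n < S" for n
      proof -
        have "\<not> (low_surface i j (t - 1) n (environment \<omega>) \<and> low_surface i j t n (environment \<omega>))"
          using speed_surface_le[OF ij elim, of t n] that by (auto simp: S_def)
        then show ?thesis by (auto simp: c_def indicator_def)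
      qed
      \<comment> \<open>\<open>S / 12\<close> rounded up.\<close>
      define m where "m = (S + 11) div 12"
      have m: "S \<le> 12 * m" "\<And>n. n < m \<Longrightarrow> 12 * n < S" by (auto simp: m_def)
      have "of_nat S \<le> (of_nat (12 * m) :: ennreal)" using m(1) by (intro of_nat_mono)
      also have "\<dots> = (\<Sum>n<m. 12)" by (simp add: mult.commute)
      also have "\<dots> \<le> (\<Sum>n<m. c n)" by (intro sum_mono bad m) auto
      also have "\<dots> \<le> (\<Sum>n. c n)" by (intro sum_le_suminf) auto
      finally show ?case by (simp add: S_def c_def)
    qed
  qed
  also have "\<dots> = (\<Sum>n. \<integral>\<^sup>+ \<omega>. 12 * (indicator (?L (t - 1) n) \<omega> + indicator (?L t n) \<omega>) \<partial>?M)"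
    by (rule nn_integral_suminf) measurable
  also have "\<dots> = (\<Sum>n. 12 * (emeasure ?M (?L (t - 1) n) + emeasure ?M (?L t n)))"
    by (intro suminf_cong) (simp add: nn_integral_cmult nn_integral_add)
  also have "\<dots> \<le> (\<Sum>n. ennreal (48 * \<beta> * (1 / 2) ^ n))"
  proof (intro suminf_le)
    fix n
    have "12 * (emeasure ?M (?L (t - 1) n) + emeasure ?M (?L t n)) \<le>
        12 * (ennreal (2 * \<beta> * (2 * \<beta>) ^ n) + ennreal (2 * \<beta> * (2 * \<beta>) ^ n))"
      by (intro mult_left_mono add_mono low(2)) auto
    also have "\<dots> = ennreal (12 * (2 * \<beta> * (2 * \<beta>) ^ n + 2 * \<beta> * (2 * \<beta>) ^ n))"
      using \<beta> by (subst ennreal_mult) (auto simp flip: ennreal_plus)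
    also have "\<dots> = ennreal (48 * \<beta> * (2 * \<beta>) ^ n)" by (simp add: algebra_simps)
    also have "\<dots> \<le> ennreal (48 * \<beta> * (1 / 2) ^ n)"
      using \<beta> by (intro ennreal_leI mult_left_mono power_mono) auto
    finally show "12 * (emeasure ?M (?L (t - 1) n) + emeasure ?M (?L t n)) \<le> ennreal (48 * \<beta> * (1 / 2) ^ n)" .
  qed auto
  also have "\<dots> = ennreal (96 * \<beta>)"
  proof (rule suminf_ennreal_eq)
    show "(\<lambda>n. 48 * \<beta> * (1 / 2) ^ n) sums (96 * \<beta>)"
      using sums_mult[OF geometric_sums[of "1 / 2 :: real"], of "48 * \<beta>"] by simp
  qed (use \<beta> in auto)
  finally show ?thesis .
qed

text \<open>Escape has probability at least \<open>1 / 2\<close>, so conditioning on it at most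
  doubles the mean speed.\<close>

lemma surface_strategy_speed:
  fixes i j :: "'d::finite"
  assumes ij: "i \<noteq> j" and \<beta>: "0 < \<beta>" "\<beta> \<le> 1 / 12" and u: "u = \<beta>\<^sup>2 * exp (- (3 ^ CARD('d)))"
  shows "expected_speed_given_escape u (surface_strategy i j) t \<le> ennreal (192 * \<beta>)"
proof -
  let ?\<rho> = "surface_strategy i j"
  let ?E = "escape_event ?\<rho>"
  interpret E: prob_space "env_law u :: 'd env measure" by (rule prob_space_env_law)
  have E: "?E \<in> sets (env_law u)" by (rule escape_event_measurable[OF adapted_surface])
  have s: "(\<lambda>\<xi>. of_nat (speed (?\<rho> \<xi>) t) :: ennreal) \<in> borel_measurable env_space"
    by (rule measurable_compose[OF speed_surface_measurable]) simp
  have s': "(\<lambda>\<xi>. of_nat (speed (?\<rho> \<xi>) t) :: ennreal) \<in> borel_measurable (env_law u)"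
    using s by (simp add: env_law_def)
  define p where "p = E.prob ?E"
  have p: "1 / 2 \<le> p"
  proof -
    have "ennreal (1 / 2) \<le> ennreal p"
      using surface_strategy_escapes[OF assms] unfolding E.emeasure_eq_measure p_def .
    then show ?thesis by (subst (asm) ennreal_le_iff) (simp_all add: p_def)
  qed
  have "(\<integral>\<^sup>+ \<xi>. of_nat (speed (?\<rho> \<xi>) t) * indicator ?E \<xi> \<partial>env_law u) \<le>
      (\<integral>\<^sup>+ \<xi>. of_nat (speed (?\<rho> \<xi>) t) \<partial>env_law u)"
    by (intro nn_integral_mono) (simp add: indicator_def)
  also have "\<dots> = (\<integral>\<^sup>+ \<omega>. of_nat (speed (?\<rho> (environment \<omega>)) t) \<partial>trap_measure u)"
    unfolding env_law_def by (rule nn_integral_distr[OF environment_measurable]) (use s in simp)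
  also have "\<dots> \<le> ennreal (96 * \<beta>)" by (rule speed_surface_mean_le[OF assms])
  finally have le: "(\<integral>\<^sup>+ \<xi>. of_nat (speed (?\<rho> \<xi>) t) * indicator ?E \<xi> \<partial>env_law u) \<le> ennreal (96 * \<beta>)" .
  have "expected_speed_given_escape u ?\<rho> t =
      (\<integral>\<^sup>+ \<xi>. of_nat (speed (?\<rho> \<xi>) t) * indicator ?E \<xi> \<partial>env_law u) / ennreal p"
    unfolding expected_speed_given_escape_def nn_integral_uniform_measure[OF s' E]
    by (simp add: E.emeasure_eq_measure p_def)
  also have "\<dots> \<le> ennreal (96 * \<beta>) / ennreal p" using le by (rule divide_right_mono_ennreal)
  also have "\<dots> = ennreal (96 * \<beta> / p)" using p \<beta> by (intro divide_ennreal) auto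
  also have "\<dots> \<le> ennreal (192 * \<beta>)"
  proof (rule ennreal_leI)
    have "96 * \<beta> \<le> 192 * \<beta> * p" using p \<beta> by (simp add: field_simps)
    then show "96 * \<beta> / p \<le> 192 * \<beta>" using p by (simp add: pos_divide_le_eq)
  qed
  finally show ?thesis .
qed

theorem theorem1:
  fixes s :: real
  assumes "CARD('d::finite) \<ge> 2"
    and "s > 0"
  shows "0 < critical_intensity TYPE('d) s \<and> critical_intensity TYPE('d) s < \<infinity>"
proof
  obtain i j :: 'd where ij: "i \<noteq> j"
    using assms(1) card_2_iff'[of "UNIV :: 'd set"] by (metis One_nat_def UNIV_I card_le_Suc0_iff_eq finite not_less_eq_eq numeral_2_eq_2)
  \<comment> \<open>\<open>1 / 12\<close> serves the climbing estimate and \<open>s / 192\<close>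
    the bound on the conditional mean speed.\<close>
  define \<beta> where "\<beta> = min (1 / 12) (s / 192)"
  define u where "u = \<beta>\<^sup>2 * exp (- (3 ^ CARD('d)))"
  have \<beta>: "0 < \<beta>" "\<beta> \<le> 1 / 12" "192 * \<beta> \<le> s" using assms(2) by (auto simp: \<beta>_def)
  note surface = ij \<beta>(1,2) u_def
  have "0 < emeasure (env_law u) (escape_event (surface_strategy i j))"
  proof (rule less_le_trans[OF _ surface_strategy_escapes[OF surface]])
    show "0 < ennreal (1 / 2)" unfolding ennreal_0[symmetric] by (rule ennreal_lessI) auto
  qed
  moreover have "expected_speed_given_escape u (surface_strategy i j) t \<le> ennreal s" for t
    using surface_strategy_speed[OF surface, of t] \<beta>(3) by (meson ennreal_leI order_trans)
  moreover have u: "0 < u" using \<beta> by (simp add: u_def)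
  ultimately have "ennreal u \<le> critical_intensity TYPE('d) s"
    unfolding critical_intensity_def
    by (intro SUP_upper) (auto intro!: exI[of _ "surface_strategy i j"] escape_strategy_surface adapted_surface)
  then show "0 < critical_intensity TYPE('d) s" using u by (simp add: less_le_trans[rotated])
next
  obtain u0 where u0: "u0 > 0" "\<And>u k. u0 \<le> u \<Longrightarrow> failure_bound TYPE('d) s u k \<le> (1 / 2) ^ k / 16"
    using ex_failure_bound[of s] assms(2) by auto
  have "critical_intensity TYPE('d) s \<le> ennreal u0"
    unfolding critical_intensity_def
  proof (rule SUP_least)
    fix u assume "u \<in> {u. 0 \<le> u \<and> (\<exists>\<rho> :: 'd strategy. escape_strategy \<rho> \<and> adapted \<rho> \<and>
      0 < emeasure (env_law u) (escape_event \<rho>) \<and> (\<forall>t. expected_speed_given_escape u \<rho> t \<le> ennreal s))}"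
    then obtain \<rho> :: "'d strategy" where \<rho>: "escape_strategy \<rho>" "adapted \<rho>"
      "0 < emeasure (env_law u) (escape_event \<rho>)" "\<And>t. expected_speed_given_escape u \<rho> t \<le> ennreal s" by blast
    have "u < u0"
    proof (rule ccontr)
      assume "\<not> u < u0"
      then have u: "u0 \<le> u" "0 < u" using u0(1) by auto
      have "emeasure (env_law u) (escape_event \<rho>) = 0"
        by (rule escape_probability_zero[OF \<rho>(1,2) u(2) assms(2) \<rho>(4) u0(2)[OF u(1)]])
      then show False using \<rho>(3) by simp
    qed
    then show "ennreal u \<le> ennreal u0" by (intro ennreal_leI) simp
  qed
  also have "\<dots> < \<infinity>" by simp
  finally show "critical_intensity TYPE('d) s < \<infinity>" .
qed

end
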